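(* Let $K$ be a (non-trivially) valued field of equi-characteristic $0$ in a language $\mathcal L$ containing the language $\{+,\cdot,\mathcal O_K\}$ of valued fields. Fix $\ell\in\{0,1,\omega\}$ and suppose that $\mathrm{Th}_{\mathcal L}(K)$ is $\ell$-h-minimal. Moreover, fix an $\mathrm{RV}$-expansion of $K$ with language $\mathcal L'\supset\mathcal L$ (i.e., an expansion of $K$ by arbitrary predicates on Cartesian powers of $\mathrm{RV}$). Then $\mathrm{Th}_{\mathcal L'}(K)$ is also $\ell$-h-minimal.
   Context: Valued fields: valuations are arbitrary non-trivial Krull valuations. $K$ has valuation ring $\mathcal O_K\subsetneq K$; equi-characteristic $0$ means that $K$ and its residue field have characteristic $0$. The value group is written multiplicatively, $\Gamma_K^\times=K^\times/\mathcal O_K^\times$, $\Gamma_K=\Gamma_K^\times\cup\{0\}$, with valuation $|\cdot|\colon K\to\Gamma_K$, $|0|=0$, ordered so that $\mathcal O_K=\{x:|x|\le 1\}$. Leading terms: for $\lambda\le 1$ in $\Gamma_K^\times$ let $\mathrm{RV}_\lambda=K^\times/(1+\{x:|x|<\lambda\})\ \cup\{0\}$ and let $\mathrm{rv}_\lambda\colon K\to\mathrm{RV}_\lambda$ be the quotient map on $K^\times$ extended by $0\mapsto 0$. Write $\mathrm{RV}=\mathrm{RV}_1$, $\mathrm{rv}=\mathrm{rv}_1$. These are imaginary sets: elements of $\mathrm{RV}_\lambda$ may be used as parameters, and adding a predicate on $\mathrm{RV}^n$ to a structure on $K$ amounts to adding a predicate for its preimage in $K^n$ under coordinatewise $\mathrm{rv}$.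 "$A$-definable" means definable with parameters from $A$. Preparation: a finite non-empty set $C\subset K$ $\lambda$-prepares $X\subset K$ if whether $x\in K$ lies in $X$ depends only on the tuple $(\mathrm{rv}_\lambda(x-c))_{c\in C}$. Hensel minimality: for $\ell\ge 0$ an integer or $\omega$, a theory $\mathcal T$ of valued fields of equi-characteristic $0$ in a language containing $\{+,\cdot,\mathcal O_K\}$ is $\ell$-h-minimal if for every model $K\models\mathcal T$, every $\lambda\le1$ in $\Gamma_K^\times$, every $A\subset K$ and every $A'\subset\mathrm{RV}_\lambda$ with $\#A'\le\ell$, every $(A\cup\mathrm{RV}\cup A')$-definable set $X\subset K$ can be $\lambda$-prepared by a finite $A$-definable set $C\subset K$. *)

theory Defs
  imports
    "HOL-Algebra.Multiplicative_Group"
    "HOL-Algebra.QuotRing"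
    "HOL-Algebra.Subrings"
    "HOL-Library.Countable_Set"
    "HOL-Library.Extended_Nat"
begin

section \<open>First-order logic\<close>

text \<open>
  A language assigns arities to its symbols; \<open>None\<close> means that the symbol does not belong to the
  language. Variables are de Bruijn indices: \<open>Var i\<close> denotes the \<open>i\<close>-th entry of the environment
  list, and \<open>Exi\<close> pushes a new entry to its front.
\<close>

record ('f, 'p) lang =
  farity :: "'f \<rightharpoonup> nat"
  parity :: "'p \<rightharpoonup> nat"

datatype 'f trm = Var nat | App 'f "'f trm list"

datatype ('f, 'p) fm =
    Eq "'f trm" "'f trm"
  | Rel 'p "'f trm list"
  | Neg "('f, 'p) fm"
  | Conj "('f, 'p) fm" "('f, 'p) fm"
  | Exi "('f, 'p) fm"

fun wf_trm :: "('f, 'p) lang \<Rightarrow> nat \<Rightarrow> 'f trm \<Rightarrow> bool" where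
  "wf_trm L n (Var i) \<longleftrightarrow> i < n"
| "wf_trm L n (App f ts) \<longleftrightarrow> farity L f = Some (length ts) \<and> (\<forall>t\<in>set ts. wf_trm L n t)"

text \<open>\<open>wf_fm L n \<phi>\<close>: \<open>\<phi>\<close> is an \<open>L\<close>-formula all of whose free variables have index below \<open>n\<close>.\<close>

fun wf_fm :: "('f, 'p) lang \<Rightarrow> nat \<Rightarrow> ('f, 'p) fm \<Rightarrow> bool" where
  "wf_fm L n (Eq s t) \<longleftrightarrow> wf_trm L n s \<and> wf_trm L n t"
| "wf_fm L n (Rel p ts) \<longleftrightarrow> parity L p = Some (length ts) \<and> (\<forall>t\<in>set ts. wf_trm L n t)"
| "wf_fm L n (Neg \<phi>) \<longleftrightarrow> wf_fm L n \<phi>"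
| "wf_fm L n (Conj \<phi> \<psi>) \<longleftrightarrow> wf_fm L n \<phi> \<and> wf_fm L n \<psi>"
| "wf_fm L n (Exi \<phi>) \<longleftrightarrow> wf_fm L (Suc n) \<phi>"

record ('a, 'f, 'p) struct =
  dom_of :: "'a set"
  fun_of :: "'f \<Rightarrow> 'a list \<Rightarrow> 'a"
  rel_of :: "'p \<Rightarrow> 'a list \<Rightarrow> bool"

definition tuples :: "nat \<Rightarrow> 'a set \<Rightarrow> 'a list set" where
  "tuples n D = {xs. length xs = n \<and> set xs \<subseteq> D}"

definition is_struct :: "('f, 'p) lang \<Rightarrow> ('a, 'f, 'p) struct \<Rightarrow> bool" where
  "is_struct L M \<longleftrightarrow> dom_of M \<noteq> {} \<and>
     (\<forall>f n. farity L f = Some n \<longrightarrow> (\<forall>xs\<in>tuples n (dom_of M). fun_of M f xs \<in> dom_of M))"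

fun val :: "('a, 'f, 'p) struct \<Rightarrow> 'a list \<Rightarrow> 'f trm \<Rightarrow> 'a" where
  "val M e (Var i) = e ! i"
| "val M e (App f ts) = fun_of M f (map (val M e) ts)"

fun sat :: "('a, 'f, 'p) struct \<Rightarrow> 'a list \<Rightarrow> ('f, 'p) fm \<Rightarrow> bool" where
  "sat M e (Eq s t) \<longleftrightarrow> val M e s = val M e t"
| "sat M e (Rel p ts) \<longleftrightarrow> rel_of M p (map (val M e) ts)"
| "sat M e (Neg \<phi>) \<longleftrightarrow> \<not> sat M e \<phi>"
| "sat M e (Conj \<phi> \<psi>) \<longleftrightarrow> sat M e \<phi> \<and> sat M e \<psi>"
| "sat M e (Exi \<phi>) \<longleftrightarrow> (\<exists>x\<in>dom_of M. sat M (x # e) \<phi>)"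

definition Th :: "('f, 'p) lang \<Rightarrow> ('a, 'f, 'p) struct \<Rightarrow> ('f, 'p) fm set" where
  "Th L M = {\<phi>. wf_fm L 0 \<phi> \<and> sat M [] \<phi>}"

definition is_model :: "('f, 'p) lang \<Rightarrow> ('f, 'p) fm set \<Rightarrow> ('a, 'f, 'p) struct \<Rightarrow> bool" where
  "is_model L T M \<longleftrightarrow> is_struct L M \<and> (\<forall>\<phi>\<in>T. sat M [] \<phi>)"

text \<open>
  An element of a quotient of (a subset of) the domain is a subset \<open>\<xi>\<close> of the domain. Using it as
  a parameter means adding a constant for it on the imaginary side, that is, the singleton
  predicate \<open>{\<xi>}\<close>, whose preimage in the domain is the set \<open>\<xi>\<close> itself. Accordingly a set \<open>\<Xi>\<close> of
  imaginary parameters is added to the language as unary predicates \<open>Inr \<xi>\<close>, \<open>\<xi> \<in> \<Xi>\<close>, with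
  \<open>Inr \<xi>\<close> holding of \<open>x\<close> iff the class of \<open>x\<close> is \<open>\<xi>\<close>, i.e. iff \<open>x \<in> \<xi>\<close>.
\<close>

definition lang_imag :: "('f, 'p) lang \<Rightarrow> 'a set set \<Rightarrow> ('f, 'p + 'a set) lang" where
  "lang_imag L \<Xi> = \<lparr> farity = farity L,
     parity = case_sum (parity L) (\<lambda>\<xi>. if \<xi> \<in> \<Xi> then Some 1 else None) \<rparr>"

definition struct_imag :: "('a, 'f, 'p) struct \<Rightarrow> ('a, 'f, 'p + 'a set) struct" where
  "struct_imag M = \<lparr> dom_of = dom_of M, fun_of = fun_of M,
     rel_of = case_sum (rel_of M) (\<lambda>\<xi> xs. hd xs \<in> \<xi>) \<rparr>"

text \<open>Definability of subsets of the domain with parameters from \<open>A \<union> \<Xi>\<close>, where \<open>A\<close> consists of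
  elements of the domain and \<open>\<Xi>\<close> of imaginary elements.\<close>

definition definable ::
  "('f, 'p) lang \<Rightarrow> ('a, 'f, 'p) struct \<Rightarrow> 'a set \<Rightarrow> 'a set set \<Rightarrow> 'a set \<Rightarrow> bool" where
  "definable L M A \<Xi> X \<longleftrightarrow>
     (\<exists>\<phi> as. set as \<subseteq> A \<and> wf_fm (lang_imag L \<Xi>) (Suc (length as)) \<phi> \<and>
       X = {x \<in> dom_of M. sat (struct_imag M) (x # as) \<phi>})"


section \<open>Valued fields as first-order structures\<close>

datatype 'f vfun = Plus | Times | OtherFun 'f

datatype 'p vpred = ValRing | OtherPred 'p

type_synonym ('f, 'p) vlang = "('f vfun, 'p vpred) lang"
type_synonym ('f, 'p) vfm = "('f vfun, 'p vpred) fm"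
type_synonym ('a, 'f, 'p) vstruct = "('a, 'f vfun, 'p vpred) struct"

definition contains_vf :: "('f, 'p) vlang \<Rightarrow> bool" where
  "contains_vf L \<longleftrightarrow>
     farity L Plus = Some 2 \<and> farity L Times = Some 2 \<and> parity L ValRing = Some 1"

text \<open>\<open>0\<close> and \<open>1\<close> are not symbols of the language and are recovered as the neutral elements.\<close>

definition Rng :: "('a, 'f, 'p) vstruct \<Rightarrow> 'a ring" where
  "Rng M = (let D = dom_of M; pl = (\<lambda>x y. fun_of M Plus [x, y]); ti = (\<lambda>x y. fun_of M Times [x, y])
     in \<lparr> carrier = D, mult = ti,
          one = (THE e. e \<in> D \<and> (\<forall>x\<in>D. ti e x = x \<and> ti x e = x)),
          zero = (THE z. z \<in> D \<and> (\<forall>x\<in>D. pl z x = x \<and> pl x z = x)),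
          add = pl \<rparr>)"

definition VR :: "('a, 'f, 'p) vstruct \<Rightarrow> 'a set" where
  "VR M = {x \<in> dom_of M. rel_of M ValRing [x]}"

definition val_ring :: "('a, 'f, 'p) vstruct \<Rightarrow> 'a ring" where
  "val_ring M = (Rng M)\<lparr>carrier := VR M\<rparr>"

text \<open>The non-zero values are the cosets of the unit group of the valuation ring; the value of
  \<open>0\<close> is represented by \<open>{0}\<close>, which is what the coset formula gives for \<open>x = 0\<close>.\<close>

definition value_group :: "('a, 'f, 'p) vstruct \<Rightarrow> 'a set monoid" where
  "value_group M = mult_of (Rng M) Mod Units (val_ring M)"

definition vabs :: "('a, 'f, 'p) vstruct \<Rightarrow> 'a \<Rightarrow> 'a set" where
  "vabs M x = Units (val_ring M) #>\<^bsub>Rng M\<^esub> x"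

definition vle :: "('a, 'f, 'p) vstruct \<Rightarrow> 'a set \<Rightarrow> 'a set \<Rightarrow> bool" where
  "vle M \<gamma> \<delta> \<longleftrightarrow> (\<exists>x\<in>\<gamma>. \<exists>y\<in>\<delta>. \<exists>r\<in>VR M. x = r \<otimes>\<^bsub>Rng M\<^esub> y)"

definition vless :: "('a, 'f, 'p) vstruct \<Rightarrow> 'a set \<Rightarrow> 'a set \<Rightarrow> bool" where
  "vless M \<gamma> \<delta> \<longleftrightarrow> vle M \<gamma> \<delta> \<and> \<gamma> \<noteq> \<delta>"

definition vone :: "('a, 'f, 'p) vstruct \<Rightarrow> 'a set" where
  "vone M = vabs M \<one>\<^bsub>Rng M\<^esub>"

definition oball :: "('a, 'f, 'p) vstruct \<Rightarrow> 'a set \<Rightarrow> 'a set" where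
  "oball M lam = {x \<in> dom_of M. vless M (vabs M x) lam}"

definition char_0 :: "('a, 'b) ring_scheme \<Rightarrow> bool" where
  "char_0 R \<longleftrightarrow> (\<forall>n::nat. n > 0 \<longrightarrow> [n] \<cdot>\<^bsub>R\<^esub> \<one>\<^bsub>R\<^esub> \<noteq> \<zero>\<^bsub>R\<^esub>)"

definition valued_field :: "('a, 'f, 'p) vstruct \<Rightarrow> bool" where
  "valued_field M \<longleftrightarrow> field (Rng M) \<and> subring (VR M) (Rng M) \<and> VR M \<noteq> dom_of M \<and>
     (\<forall>x \<in> dom_of M - {\<zero>\<^bsub>Rng M\<^esub>}. x \<in> VR M \<or> inv\<^bsub>Rng M\<^esub> x \<in> VR M)"

definition equichar_0 :: "('a, 'f, 'p) vstruct \<Rightarrow> bool" where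
  "equichar_0 M \<longleftrightarrow> char_0 (Rng M) \<and> char_0 (val_ring M Quot oball M (vone M))"


section \<open>Leading terms and preparation\<close>

definition rv_kernel :: "('a, 'f, 'p) vstruct \<Rightarrow> 'a set \<Rightarrow> 'a set" where
  "rv_kernel M lam = (\<lambda>x. \<one>\<^bsub>Rng M\<^esub> \<oplus>\<^bsub>Rng M\<^esub> x) ` oball M lam"

text \<open>The additional element \<open>0\<close> of \<open>RV M lam\<close> is represented by \<open>{0}\<close>, its preimage in the field.\<close>

definition RV :: "('a, 'f, 'p) vstruct \<Rightarrow> 'a set \<Rightarrow> 'a set set" where
  "RV M lam = carrier (mult_of (Rng M) Mod rv_kernel M lam) \<union> {{\<zero>\<^bsub>Rng M\<^esub>}}"

definition rv :: "('a, 'f, 'p) vstruct \<Rightarrow> 'a set \<Rightarrow> 'a \<Rightarrow> 'a set" where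
  "rv M lam x = (if x = \<zero>\<^bsub>Rng M\<^esub> then {\<zero>\<^bsub>Rng M\<^esub>} else rv_kernel M lam #>\<^bsub>mult_of (Rng M)\<^esub> x)"

definition prepares :: "('a, 'f, 'p) vstruct \<Rightarrow> 'a set \<Rightarrow> 'a set \<Rightarrow> 'a set \<Rightarrow> bool" where
  "prepares M lam C X \<longleftrightarrow> finite C \<and> C \<noteq> {} \<and> C \<subseteq> dom_of M \<and>
     (\<forall>x \<in> dom_of M. \<forall>x' \<in> dom_of M.
        (\<forall>c\<in>C. rv M lam (x \<ominus>\<^bsub>Rng M\<^esub> c) = rv M lam (x' \<ominus>\<^bsub>Rng M\<^esub> c)) \<longrightarrow> (x \<in> X \<longleftrightarrow> x' \<in> X))"


section \<open>Hensel minimality\<close>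

text \<open>The value \<open>\<infinity>\<close> of \<open>l\<close> stands for the cardinal \<open>\<omega>\<close>.\<close>

definition card_le :: "'a set \<Rightarrow> enat \<Rightarrow> bool" where
  "card_le S l \<longleftrightarrow> (case l of enat n \<Rightarrow> finite S \<and> card S \<le> n | \<infinity> \<Rightarrow> countable S)"

text \<open>
  HOL cannot quantify over all models of all cardinalities inside one formula, so the type
  \<open>'u\<close> in which the domains of the models live is a parameter of the definition.
\<close>

definition h_minimal ::
  "'u itself \<Rightarrow> enat \<Rightarrow> ('f, 'p) vlang \<Rightarrow> ('f, 'p) vfm set \<Rightarrow> bool" where
  "h_minimal U l L T \<longleftrightarrow> contains_vf L \<and>
     (\<forall>M :: ('u, 'f, 'p) vstruct. is_model L T M \<longrightarrow>
        valued_field M \<and> equichar_0 M \<and>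
        (\<forall>lam A A' X.
           lam \<in> carrier (value_group M) \<and> vle M lam (vone M) \<and>
           A \<subseteq> dom_of M \<and> A' \<subseteq> RV M lam \<and> card_le A' l \<and>
           definable L M A (RV M (vone M) \<union> A') X \<longrightarrow>
           (\<exists>C. finite C \<and> definable L M A {} C \<and> prepares M lam C X)))"

text \<open>
  \<open>'u\<close> contains at least as many elements as there are \<open>L\<close>-formulas. By the downward
  Loewenheim-Skolem theorem, \<open>'u\<close> then has a copy of an elementary substructure (containing any
  prescribed finite set) of every infinite \<open>L\<close>-structure.
\<close>

definition large_universe :: "'u itself \<Rightarrow> ('f, 'p) lang \<Rightarrow> bool" where
  "large_universe U L \<longleftrightarrow> (\<exists>e :: ('f, 'p) fm \<Rightarrow> 'u. inj_on e {\<phi>. \<exists>n. wf_fm L n \<phi>})"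


section \<open>Expansions by predicates on the leading terms\<close>

definition RV_expansion ::
  "('f, 'p) vlang \<Rightarrow> ('a, 'f, 'p) vstruct \<Rightarrow> ('f, 'p) vlang \<Rightarrow> ('a, 'f, 'p) vstruct \<Rightarrow> bool" where
  "RV_expansion L K L' K' \<longleftrightarrow>
     farity L' = farity L \<and> parity L \<subseteq>\<^sub>m parity L' \<and> dom_of K' = dom_of K \<and>
     (\<forall>f n. farity L f = Some n \<longrightarrow>
        (\<forall>xs \<in> tuples n (dom_of K). fun_of K' f xs = fun_of K f xs)) \<and>
     (\<forall>p n. parity L p = Some n \<longrightarrow>
        (\<forall>xs \<in> tuples n (dom_of K). rel_of K' p xs \<longleftrightarrow> rel_of K p xs)) \<and>
     (\<forall>p n. parity L p = None \<and> parity L' p = Some n \<longrightarrow>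
        (\<exists>P \<subseteq> tuples n (RV K (vone K)).
           \<forall>xs \<in> tuples n (dom_of K). rel_of K' p xs \<longleftrightarrow> map (rv K (vone K)) xs \<in> P))"

end

theory Submission
  imports Defs
begin

text \<open>
  Call two tuples \<open>a\<close>, \<open>b\<close> of a model \<open>M\<close> similar with respect to a definable family if they
  satisfy the same of its members \<open>\<phi>(_, \<xi>)\<close>, where \<open>\<xi>\<close> ranges over all tuples of leading terms. By
  compactness, preparation is uniform in families, so for each \<open>a\<close> the elements \<open>x\<close> whose
  differences to the points of a finite \<open>a\<close>-definable preparing set have leading terms in a
  prescribed finite set fall into boundedly many similarity classes over \<open>a\<close>. Finitely many
  further parameters on the leading terms single out one of these classes, and the existence of such
  an \<open>x\<close> is again a condition on \<open>a\<close> of the same kind. This is a finitary back-and-forth: for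
  every formula of the expansion there is a family in the small language such that similar tuples
  satisfy the formula alike. In the presence of parameters from \<open>RV_\<lambda>\<close> one quantifies over
  representatives of them; the resulting sets are definable in the small language over the
  parameters, and a finite set preparing all of them prepares the given set.
\<close>

section \<open>Ultrafilters, tuples and renaming of variables\<close>

text \<open>A parameter in \<open>RV M lam\<close> is a class whose level must stay anonymous:
  adding an element of that level, or of the class, to \<open>A\<close> would enlarge the set over
  which the preparing set has to be definable. Hence preparation is only asked of sets that quantify
  over all pairs of a level and representatives with the same trace, and such a pair has to be
  selected together with the class of \<open>x\<close>. This is why the classes of whole tuples, and
  not only of single elements, must be bounded. The bound must not depend on the base, because the
  separating parameters have to form a tuple of one fixed length. It comes from the preparing sets:
  at most \<kappa> centres, each with one of \<kappa> leading terms, leave at most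
  \<open>\<kappa> ^ \<kappa>\<close> classes of single elements, and the bounds multiply for tuples.
  The assumption speaks of models in the type \<open>'u\<close> only, the conclusion of models in
  another type. So the compactness argument has to produce its model inside \<open>'u\<close>; a
  failure of uniform preparation in a model of any type is then refuted there.\<close>

lemma ex_ultrafilter_le:
  fixes F :: "'i filter"
  assumes "F \<noteq> bot"
  obtains U where "U \<le> F" "U \<noteq> bot" "\<And>P. eventually P U \<or> eventually (\<lambda>x. \<not> P x) U"
proof -
  define E where "E = {X. eventually (\<lambda>x. x \<in> X) F}"
  define fip where "fip = (\<lambda>\<V> :: 'i set set. \<forall>\<F>. finite \<F> \<and> \<F> \<subseteq> \<V> \<longrightarrow> \<Inter>\<F> \<noteq> {})"
  have fip_E: "fip E"
    unfolding fip_def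
  proof (intro allI impI)
    fix \<F> assume "finite \<F> \<and> \<F> \<subseteq> E"
    hence "eventually (\<lambda>x. \<forall>X\<in>\<F>. x \<in> X) F"
      by (auto simp: E_def intro!: eventually_ball_finite)
    then obtain x where "\<forall>X\<in>\<F>. x \<in> X"
      using eventually_happens'[OF assms] by blast
    thus "\<Inter>\<F> \<noteq> {}" by blast
  qed
  have "\<exists>\<V>\<in>{\<V>. E \<subseteq> \<V> \<and> fip \<V>}. \<forall>\<W>\<in>{\<V>. E \<subseteq> \<V> \<and> fip \<V>}. \<V> \<subseteq> \<W> \<longrightarrow> \<W> = \<V>"
  proof (rule subset_Zorn_nonempty)
    show "{\<V>. E \<subseteq> \<V> \<and> fip \<V>} \<noteq> {}" using fip_E by blast
    fix \<C> assume ne: "\<C> \<noteq> {}" and ch: "subset.chain {\<V>. E \<subseteq> \<V> \<and> fip \<V>} \<C>"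
    have sub: "\<V> \<in> \<C> \<Longrightarrow> E \<subseteq> \<V> \<and> fip \<V>" for \<V>
      using ch unfolding subset.chain_def by blast
    have "fip (\<Union>\<C>)"
      unfolding fip_def
    proof (intro allI impI)
      fix \<F> assume \<F>: "finite \<F> \<and> \<F> \<subseteq> \<Union>\<C>"
      then obtain \<V> where "\<V> \<in> \<C>" "\<F> \<subseteq> \<V>"
        using finite_subset_Union_chain[of \<F> \<C>] ne ch by blast
      thus "\<Inter>\<F> \<noteq> {}"
        using sub \<F> unfolding fip_def by blast
    qed
    moreover obtain \<V> where "\<V> \<in> \<C>" using ne by blast
    hence "E \<subseteq> \<Union>\<C>" using sub[of \<V>] by (meson Union_upper order_trans)
    ultimately show "\<Union>\<C> \<in> {\<V>. E \<subseteq> \<V> \<and> fip \<V>}" by simp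
  qed
  then obtain \<V> where V: "\<V> \<in> {\<V>. E \<subseteq> \<V> \<and> fip \<V>}"
    and mx: "\<forall>\<W>\<in>{\<V>. E \<subseteq> \<V> \<and> fip \<V>}. \<V> \<subseteq> \<W> \<longrightarrow> \<W> = \<V>"
    by (rule bexE) (rule that)
  have \<V>: "E \<subseteq> \<V>" "fip \<V>" using V by blast+
  have max: "\<W> = \<V>" if "E \<subseteq> \<W>" "fip \<W>" "\<V> \<subseteq> \<W>" for \<W>
    using mx[rule_format, of \<W>] that by blast
  define U where "U = (INF X\<in>\<V>. principal X)"
  have ev: "eventually P U \<longleftrightarrow> (\<exists>\<F>\<subseteq>\<V>. finite \<F> \<and> (\<forall>x\<in>\<Inter>\<F>. P x))" for P
  proof -
    have *: "eventually P (INF X\<in>\<F>. principal X) \<longleftrightarrow> (\<forall>x\<in>\<Inter>\<F>. P x)" if "finite \<F>" for \<F> :: "'i set set"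
      unfolding INF_principal_finite[OF that] eventually_principal by simp
    show ?thesis
      unfolding U_def by (subst eventually_INF) (use * in blast)
  qed
  show thesis
  proof (rule that)
    show "U \<noteq> bot"
      unfolding trivial_limit_def ev using \<V>(2) unfolding fip_def by blast
    show "U \<le> F"
    proof (rule filter_leI)
      fix P assume "eventually P F"
      hence "{{x. P x}} \<subseteq> \<V>" using \<V>(1) by (auto simp: E_def)
      thus "eventually P U" unfolding ev by (intro exI[of _ "{{x. P x}}"]) auto
    qed
    fix P
    show "eventually P U \<or> eventually (\<lambda>x. \<not> P x) U"
    proof (cases "fip (insert {x. P x} \<V>)")
      case True
      hence "{{x. P x}} \<subseteq> \<V>" using max[of "insert {x. P x} \<V>"] \<V>(1) by blast
      hence "eventually P U" unfolding ev by (intro exI[of _ "{{x. P x}}"]) auto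
      thus ?thesis ..
    next
      case False
      then obtain \<F> where \<F>: "finite \<F>" "\<F> \<subseteq> insert {x. P x} \<V>" "\<Inter>\<F> = {}"
        unfolding fip_def by blast
      \<comment> \<open>The members of \<F> other than \<open>{x. P x}\<close> lie in \<V>, and
        their intersection avoids \<open>{x. P x}\<close>.\<close>
      hence "eventually (\<lambda>x. \<not> P x) U"
        unfolding ev by (intro exI[of _ "\<F> - {{x. P x}}"]) auto
      thus ?thesis ..
    qed
  qed
qed

lemma tuples_0 [simp]: "tuples 0 D = {[]}"
  by (auto simp: tuples_def)

lemma tuples_length: "xs \<in> tuples n D \<Longrightarrow> length xs = n"
  by (simp add: tuples_def)

lemma tuples_append [intro]: "xs \<in> tuples m D \<Longrightarrow> ys \<in> tuples n D \<Longrightarrow> xs @ ys \<in> tuples (m + n) D"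
  by (auto simp: tuples_def)

lemma tuples_Cons [simp]: "x # xs \<in> tuples (Suc n) D \<longleftrightarrow> x \<in> D \<and> xs \<in> tuples n D"
  by (auto simp: tuples_def)

lemma tuples_nth: "xs \<in> tuples n D \<Longrightarrow> i < n \<Longrightarrow> xs ! i \<in> D"
  by (auto simp: tuples_def)

lemma tuples_SucE:
  assumes "xs \<in> tuples (Suc n) D"
  obtains y ys where "xs = y # ys" "y \<in> D" "ys \<in> tuples n D"
  using assms by (cases xs) (auto simp: tuples_def)

lemma tuples_map [intro]: "(\<And>x. x \<in> set xs \<Longrightarrow> f x \<in> D) \<Longrightarrow> length xs = n \<Longrightarrow> map f xs \<in> tuples n D"
  by (auto simp: tuples_def)

lemma tuples_nth_select: "xs \<in> tuples n D \<Longrightarrow> set is \<subseteq> {..<n} \<Longrightarrow> map ((!) xs) is \<in> tuples (length is) D"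
  by (auto simp: tuples_def subset_iff)

text \<open>Padding with an arbitrary element turns a bound on a cardinality into a tuple of fixed
  length, over which a formula can quantify.\<close>

lemma tuples_extend:
  assumes "finite S" "card S \<le> n" "S \<subseteq> D" "D \<noteq> {}"
  obtains xs where "xs \<in> tuples n D" "S \<subseteq> set xs"
proof -
  obtain ys where ys: "set ys = S" "length ys = card S"
    using assms(1) by (metis distinct_card finite_distinct_list)
  obtain d where "d \<in> D" using assms(4) by blast
  show thesis
  proof
    show "ys @ replicate (n - card S) d \<in> tuples n D"
      using ys assms \<open>d \<in> D\<close> by (auto simp: tuples_def)
    show "S \<subseteq> set (ys @ replicate (n - card S) d)" using ys by auto
  qed
qed

lemma val_in_dom:
  assumes "is_struct L M" "wf_trm L (length e) t" "set e \<subseteq> dom_of M"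
  shows "val M e t \<in> dom_of M"
  using assms(2)
proof (induction t)
  case (App f ts)
  hence "map (val M e) ts \<in> tuples (length ts) (dom_of M)"
    by (auto intro!: tuples_map)
  thus ?case using App.prems assms(1) by (simp add: is_struct_def)
qed (use assms(3) in auto)

lemma wf_trm_mono: "wf_trm L m t \<Longrightarrow> m \<le> n \<Longrightarrow> wf_trm L n t"
  by (induction t) auto

lemma wf_fm_mono: "wf_fm L m \<phi> \<Longrightarrow> m \<le> n \<Longrightarrow> wf_fm L n \<phi>"
  by (induction \<phi> arbitrary: m n) (auto intro: wf_trm_mono)

section \<open>Renaming of variables and of relation symbols\<close>

primrec ren_trm :: "(nat \<Rightarrow> nat) \<Rightarrow> 'f trm \<Rightarrow> 'f trm" where
  "ren_trm r (Var i) = Var (r i)"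
| "ren_trm r (App f ts) = App f (map (ren_trm r) ts)"

primrec ren_fm :: "(nat \<Rightarrow> nat) \<Rightarrow> ('f, 'p) fm \<Rightarrow> ('f, 'p) fm" where
  "ren_fm r (Eq s t) = Eq (ren_trm r s) (ren_trm r t)"
| "ren_fm r (Rel p ts) = Rel p (map (ren_trm r) ts)"
| "ren_fm r (Neg \<phi>) = Neg (ren_fm r \<phi>)"
| "ren_fm r (Conj \<phi> \<psi>) = Conj (ren_fm r \<phi>) (ren_fm r \<psi>)"
| "ren_fm r (Exi \<phi>) = Exi (ren_fm (case_nat 0 (\<lambda>i. Suc (r i))) \<phi>)"

lemma wf_ren_trm: "wf_trm L n t \<Longrightarrow> (\<And>i. i < n \<Longrightarrow> r i < m) \<Longrightarrow> wf_trm L m (ren_trm r t)"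
  by (induction t) auto

lemma wf_ren_fm: "wf_fm L n \<phi> \<Longrightarrow> (\<And>i. i < n \<Longrightarrow> r i < m) \<Longrightarrow> wf_fm L m (ren_fm r \<phi>)"
proof (induction \<phi> arbitrary: n m r)
  case (Exi \<phi>)
  show ?case
    using Exi.prems by (auto intro!: Exi.IH[of "Suc n"] split: nat.split)
qed (auto intro: wf_ren_trm)

lemma val_ren: "wf_trm L n t \<Longrightarrow> (\<And>i. i < n \<Longrightarrow> e ! r i = e' ! i) \<Longrightarrow> val M e (ren_trm r t) = val M e' t"
  by (induction t) (auto intro!: arg_cong[of _ _ "fun_of M _"])

lemma sat_ren:
  "wf_fm L n \<phi> \<Longrightarrow> (\<And>i. i < n \<Longrightarrow> e ! r i = e' ! i) \<Longrightarrow> sat M e (ren_fm r \<phi>) = sat M e' \<phi>"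
proof (induction \<phi> arbitrary: n e e' r)
  case (Eq s t)
  thus ?case using val_ren[of L n _ e r e' M] by simp
next
  case (Rel p ts)
  hence "map (val M e \<circ> ren_trm r) ts = map (val M e') ts"
    using val_ren[of L n _ e r e' M] by simp
  thus ?case by (simp only: ren_fm.simps sat.simps map_map)
next
  case (Exi \<phi>)
  have "sat M (x # e) (ren_fm (case_nat 0 (\<lambda>i. Suc (r i))) \<phi>) = sat M (x # e') \<phi>" for x
    by (rule Exi.IH[of "Suc n"]) (use Exi.prems in \<open>auto split: nat.split simp: less_Suc_eq_0_disj\<close>)
  thus ?case by simp
qed auto

lemma map_trm_ident [simp]: "map_trm (\<lambda>a. a) = (\<lambda>t. t)" "map_trm id = (\<lambda>t. t)"
  by (simp_all add: fun_eq_iff trm.map_ident trm.map_id)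

text \<open>Used with \<open>Inl\<close> to enter the language with imaginary parameters, with
  \<open>projl\<close> to leave it when there are none, and with \<open>id\<close> to enlarge the
  language.\<close>

lemma wf_fm_map:
  assumes "wf_fm L n \<phi>" "farity L' = farity L"
    and "\<And>p a. parity L p = Some a \<Longrightarrow> parity L' (g p) = Some a"
  shows "wf_fm L' n (map_fm id g \<phi>)"
proof -
  have trm: "wf_trm L' n t" if "wf_trm L n t" for n t
    using that assms(2) by (induction t) auto
  show ?thesis
    using assms(1) by (induction \<phi> arbitrary: n) (auto simp: trm assms(3) comp_def)
qed

lemma sat_map_fm:
  assumes "dom_of M' = dom_of M" "fun_of M' = fun_of M"
    and "wf_fm L n \<phi>" "\<And>p a xs. parity L p = Some a \<Longrightarrow> rel_of M' (g p) xs = rel_of M p xs"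
  shows "sat M' e (map_fm id g \<phi>) = sat M e \<phi>"
proof -
  have "val M' e t = val M e t" for e t
    using assms(2) by (induction t) (auto cong: map_cong)
  hence val: "val M' = val M" by (simp add: fun_eq_iff)
  show ?thesis
    using assms(3)
  proof (induction \<phi> arbitrary: n e)
    case (Rel p ts)
    hence "parity L p = Some (length ts)" by simp
    from assms(4)[OF this] show ?case by (simp add: val comp_def)
  qed (auto simp: val assms(1))
qed

section \<open>Compactness inside a given universe\<close>

text \<open>Skolem terms: \<open>Base i\<close> names an entry of a given tuple,
  \<open>Sk \<phi> ts\<close> a witness for \<open>Exi \<phi>\<close> at the values of
  \<open>ts\<close>. The formula itself plays the role of the Skolem function symbol.\<close>

datatype 'x sk = Base nat | Sk 'x "'x sk list"

fun wf_sk :: "('f, 'p) lang \<Rightarrow> nat \<Rightarrow> ('f, 'p) fm sk \<Rightarrow> bool" where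
  "wf_sk L n (Base i) \<longleftrightarrow> i < n"
| "wf_sk L n (Sk \<phi> ts) \<longleftrightarrow> wf_fm L (Suc (length ts)) \<phi> \<and> (\<forall>t\<in>set ts. wf_sk L n t)"

text \<open>The choice stays in the domain even if \<phi> has no solution, so that every Skolem term
  denotes an element.\<close>

definition wit :: "('a, 'f, 'p) struct \<Rightarrow> ('f, 'p) fm \<Rightarrow> 'a list \<Rightarrow> 'a" where
  "wit M \<phi> e = (SOME x. x \<in> dom_of M \<and> ((\<exists>y\<in>dom_of M. sat M (y # e) \<phi>) \<longrightarrow> sat M (x # e) \<phi>))"

fun sk_val :: "('a, 'f, 'p) struct \<Rightarrow> 'a list \<Rightarrow> ('f, 'p) fm sk \<Rightarrow> 'a" where
  "sk_val M e (Base i) = e ! i"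
| "sk_val M e (Sk \<phi> ts) = wit M \<phi> (map (sk_val M e) ts)"

lemma wit:
  assumes "dom_of M \<noteq> {}"
  shows "wit M \<phi> e \<in> dom_of M" "y \<in> dom_of M \<Longrightarrow> sat M (y # e) \<phi> \<Longrightarrow> sat M (wit M \<phi> e # e) \<phi>"
proof -
  have "\<exists>x. x \<in> dom_of M \<and> ((\<exists>y\<in>dom_of M. sat M (y # e) \<phi>) \<longrightarrow> sat M (x # e) \<phi>)"
    using assms by blast
  from someI_ex[OF this] show "wit M \<phi> e \<in> dom_of M"
    "y \<in> dom_of M \<Longrightarrow> sat M (y # e) \<phi> \<Longrightarrow> sat M (wit M \<phi> e # e) \<phi>"
    unfolding wit_def by blast+
qed

lemma sk_val_in_dom:
  "wf_sk L n t \<Longrightarrow> dom_of M \<noteq> {} \<Longrightarrow> e \<in> tuples n (dom_of M) \<Longrightarrow> sk_val M e t \<in> dom_of M"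
  by (cases t) (auto intro: wit(1) tuples_nth)

text \<open>Skolem terms are coded by formulas, so that a universe that is large enough for the formulas
  also accommodates a Skolem hull.\<close>

fun enc :: "('f, 'p) fm sk \<Rightarrow> ('f, 'p) fm" and encs :: "('f, 'p) fm sk list \<Rightarrow> ('f, 'p) fm" where
  "enc (Base i) = Eq (Var i) (Var i)"
| "enc (Sk \<phi> ts) = Conj \<phi> (encs ts)"
| "encs [] = Eq (Var 0) (Var 0)"
| "encs (t # ts) = Conj (enc t) (encs ts)"

lemma fixes s t :: "('f, 'p) fm sk" and ss ts :: "('f, 'p) fm sk list"
  shows enc_inj: "enc s = enc t \<Longrightarrow> s = t"
  and encs_inj: "encs ss = encs ts \<Longrightarrow> ss = ts"
proof (induction s and ss arbitrary: t and ts rule: enc_encs.induct)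
  case (1 i) thus ?case by (cases t) auto
next
  case (2 \<phi> ss) thus ?case by (cases t) auto
next
  case 3 thus ?case by (cases ts) auto
next
  case (4 s ss) thus ?case by (cases ts) auto
qed

lemma fixes t :: "('f, 'p) fm sk" and ts :: "('f, 'p) fm sk list"
  shows wf_enc: "wf_sk L n t \<Longrightarrow> \<exists>k. wf_fm L k (enc t)"
  and wf_encs: "\<forall>t\<in>set ts. wf_sk L n t \<Longrightarrow> \<exists>k. wf_fm L k (encs ts)"
proof (induction t and ts rule: enc_encs.induct)
  case (2 \<phi> ts)
  then obtain k where "wf_fm L k (encs ts)" by auto
  hence "wf_fm L (max k (Suc (length ts))) (enc (Sk \<phi> ts))"
    using 2 by (auto intro: wf_fm_mono)
  thus ?case ..
next
  case (4 t ts)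
  then obtain k k' where "wf_fm L k (enc t)" "wf_fm L k' (encs ts)" by auto
  hence "wf_fm L (max k k') (encs (t # ts))" by (auto intro: wf_fm_mono)
  thus ?case ..
qed auto

text \<open>Compactness and downward Loewenheim-Skolem in one step: the new structure is the Skolem hull
  of the class of \<open>es\<close> in an ultrapower of \<open>M\<close>.\<close>

lemma compactness_in_universe:
  fixes M :: "('a, 'f, 'p) struct" and es :: "'s set \<Rightarrow> 'a list"
  assumes M: "is_struct L M" and large: "large_universe TYPE('u) L"
    and es: "\<And>S. es S \<in> tuples n (dom_of M)"
  obtains N :: "('u, 'f, 'p) struct" and e where "is_struct L N" "e \<in> tuples n (dom_of N)"
    "\<forall>\<phi> S0. wf_fm L n \<phi> \<longrightarrow> finite S0 \<longrightarrow> (\<forall>S. finite S \<longrightarrow> S0 \<subseteq> S \<longrightarrow> sat M (es S) \<phi>) \<longrightarrow> sat N e \<phi>"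
proof -
  have D: "dom_of M \<noteq> {}" using M by (simp add: is_struct_def)
  obtain code :: "('f, 'p) fm \<Rightarrow> 'u" where code: "inj_on code {\<phi>. \<exists>n. wf_fm L n \<phi>}"
    using large unfolding large_universe_def by blast
  \<comment> \<open>Being finer than \<open>finite_subsets_at_top\<close>, \<open>U\<close> contains
    every property that holds for all finite \<open>S\<close> above some finite
    \<open>S0\<close>.\<close>
  obtain U :: "'s set filter" where U: "U \<le> finite_subsets_at_top UNIV" "U \<noteq> bot"
    and ultra: "\<And>P. eventually P U \<or> eventually (\<lambda>x. \<not> P x) U"
    using ex_ultrafilter_le[OF finite_subsets_at_top_neq_bot] by metis
  have not_ev: "eventually (\<lambda>x. \<not> P x) U \<longleftrightarrow> \<not> eventually P U" for P
    using ultra[of P] eventually_conj[of P U "\<lambda>x. \<not> P x"] U(2) by auto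
  define W where "W = {t. wf_sk L n t}"
  define I where "I S = sk_val M (es S)" for S
  define eqv where "eqv s t \<longleftrightarrow> eventually (\<lambda>S. I S s = I S t) U" for s t
  have eqv_refl: "eqv t t" for t by (simp add: eqv_def)
  have eqv_sym: "eqv s t \<Longrightarrow> eqv t s" for s t by (simp add: eqv_def eq_commute)
  have eqv_trans: "eqv r s \<Longrightarrow> eqv s t \<Longrightarrow> eqv r t" for r s t
    unfolding eqv_def by (erule (1) eventually_elim2) simp
  \<comment> \<open>The domain of \<open>N\<close> consists of codes of chosen representatives,
    since classes of terms need not embed into \<open>'u\<close>. Equivalent terms get the same
    representative because they make the same choice.\<close>
  define cl where "cl t = (SOME s. s \<in> W \<and> eqv t s)" for t
  have cl: "cl t \<in> W" "eqv t (cl t)" if "t \<in> W" for t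
    using someI[of "\<lambda>s. s \<in> W \<and> eqv t s" t] that eqv_refl unfolding cl_def by blast+
  have cl_eq: "cl s = cl t \<longleftrightarrow> eqv s t" if "s \<in> W" "t \<in> W" for s t
  proof
    assume "cl s = cl t" thus "eqv s t" using cl that eqv_sym eqv_trans by metis
  next
    assume "eqv s t"
    hence "eqv s r \<longleftrightarrow> eqv t r" for r using eqv_sym eqv_trans by blast
    thus "cl s = cl t" by (simp add: cl_def)
  qed
  define rep where "rep t = code (enc (cl t))" for t
  have rep_eq: "rep s = rep t \<longleftrightarrow> eqv s t" if "s \<in> W" "t \<in> W" for s t
  proof -
    have "\<exists>k. wf_fm L k (enc (cl t))" if "t \<in> W" for t
      using cl(1)[OF that] wf_enc unfolding W_def by blast
    hence "rep s = rep t \<longleftrightarrow> cl s = cl t"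
      unfolding rep_def using inj_on_eq_iff[OF code] enc_inj that by (metis mem_Collect_eq)
    thus ?thesis using cl_eq[OF that] by simp
  qed
  define h where "h u = (SOME t. t \<in> W \<and> rep t = u)" for u
  have h: "h u \<in> W" "rep (h u) = u" if "u \<in> rep ` W" for u
    using someI_ex[of "\<lambda>t. t \<in> W \<and> rep t = u"] that unfolding h_def by blast+
  have h_rep: "eqv (h (rep t)) t" if "t \<in> W" for t
    using h[of "rep t"] rep_eq that by blast
  \<comment> \<open>The graph of \<open>f\<close>: the value of \<open>f\<close> is the only
    witness, so function symbols are interpreted by Skolem terms as well.\<close>
  define Fn :: "'f \<Rightarrow> nat \<Rightarrow> ('f, 'p) fm" where
    "Fn f k = Eq (Var 0) (App f (map Var [1..<Suc k]))" for f k
  define N :: "('u, 'f, 'p) struct" where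
    "N = \<lparr> dom_of = rep ` W, fun_of = (\<lambda>f us. rep (Sk (Fn f (length us)) (map h us))),
       rel_of = (\<lambda>p us. eventually (\<lambda>S. rel_of M p (map (I S \<circ> h) us)) U) \<rparr>"
  have dom_N: "dom_of N = rep ` W" by (simp add: N_def)
  have I_dom: "I S t \<in> dom_of M" if "t \<in> W" for S t
    using that sk_val_in_dom[OF _ D es] unfolding W_def I_def by blast
  have Sk_W: "Sk \<phi> (map h us) \<in> W"
    if "set us \<subseteq> dom_of N" "wf_fm L (Suc (length us)) \<phi>" for \<phi> us
    using that h unfolding dom_N W_def by auto
  have Fn_W: "Sk (Fn f (length us)) (map h us) \<in> W"
    if "set us \<subseteq> dom_of N" "farity L f = Some (length us)" for f us
    using that by (intro Sk_W) (auto simp: Fn_def simp del: upt_Suc)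
  have I_Fn: "I S (Sk (Fn f (length us)) (map h us)) = fun_of M f (map (I S \<circ> h) us)"
    if us: "set us \<subseteq> dom_of N" and f: "farity L f = Some (length us)" for S f us
  proof -
    have "map (I S \<circ> h) us \<in> tuples (length us) (dom_of M)"
      using us h I_dom by (auto simp: dom_N intro!: tuples_map)
    hence "fun_of M f (map (I S \<circ> h) us) \<in> dom_of M"
      using M f by (simp add: is_struct_def)
    moreover have sat: "sat M (y # map (I S \<circ> h) us) (Fn f (length us)) \<longleftrightarrow> y = fun_of M f (map (I S \<circ> h) us)" for y
    proof -
      have "map ((!) (y # map (I S \<circ> h) us)) [1..<Suc (length us)] = map (I S \<circ> h) us"
        by (rule nth_equalityI) (auto simp del: upt_Suc)
      thus ?thesis by (simp add: Fn_def comp_def del: upt_Suc)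
    qed
    ultimately have "sat M (wit M (Fn f (length us)) (map (I S \<circ> h) us) # map (I S \<circ> h) us) (Fn f (length us))"
      using wit(2)[OF D] by blast
    hence "wit M (Fn f (length us)) (map (I S \<circ> h) us) = fun_of M f (map (I S \<circ> h) us)"
      unfolding sat .
    thus ?thesis by (simp add: I_def comp_def)
  qed
  have struct_N: "is_struct L N"
    unfolding is_struct_def
  proof (intro conjI allI impI ballI)
    have "Sk (Eq (Var 0) (Var 0)) [] \<in> W" by (simp add: W_def)
    thus "dom_of N \<noteq> {}" by (auto simp: dom_N)
    fix f k us assume "farity L f = Some k" "us \<in> tuples k (dom_of N)"
    hence "Sk (Fn f (length us)) (map h us) \<in> W" by (intro Fn_W) (auto simp: tuples_def)
    thus "fun_of N f us \<in> dom_of N" by (simp add: N_def)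
  qed
  define ev where "ev us S = map (I S \<circ> h) us" for us S
  have vals: "eventually (\<lambda>S. I S (h (val N us t)) = val M (ev us S) t) U"
    if "set us \<subseteq> dom_of N" "wf_trm L (length us) t" for us t
    using that(2)
  proof (induction t)
    case (Var i) thus ?case by (simp add: ev_def)
  next
    case (App f ts)
    let ?vs = "map (val N us) ts"
    have vs: "set ?vs \<subseteq> dom_of N"
      using val_in_dom[OF struct_N] App.prems that(1) by auto
    have f: "farity L f = Some (length ?vs)" using App.prems by simp
    have "val N us (App f ts) = rep (Sk (Fn f (length ?vs)) (map h ?vs))"
      by (simp add: N_def comp_def)
    hence "eventually (\<lambda>S. I S (h (val N us (App f ts))) = fun_of M f (map (I S \<circ> h) ?vs)) U"
      using h_rep[OF Fn_W[OF vs f]] I_Fn[OF vs f] by (simp only: eqv_def)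
    moreover have "eventually (\<lambda>S. \<forall>t\<in>set ts. I S (h (val N us t)) = val M (ev us S) t) U"
      using App by (intro eventually_ball_finite) auto
    ultimately show ?case
      by (rule eventually_elim2) (auto intro!: arg_cong[of _ _ "fun_of M f"])
  qed
  have los: "sat N us \<phi> \<longleftrightarrow> eventually (\<lambda>S. sat M (ev us S) \<phi>) U"
    if "set us \<subseteq> dom_of N" "wf_fm L (length us) \<phi>" for us \<phi>
    using that
  proof (induction \<phi> arbitrary: us)
    case (Eq s t)
    have "val N us s \<in> rep ` W" "val N us t \<in> rep ` W"
      using val_in_dom[OF struct_N] Eq by (auto simp: dom_N)
    hence "val N us s = val N us t \<longleftrightarrow> eqv (h (val N us s)) (h (val N us t))"
      using rep_eq h by metis
    also have "\<dots> \<longleftrightarrow> eventually (\<lambda>S. val M (ev us S) s = val M (ev us S) t) U"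
    proof -
      have "eventually (\<lambda>S. I S (h (val N us s)) = val M (ev us S) s \<and> I S (h (val N us t)) = val M (ev us S) t) U"
        using vals Eq by (intro eventually_conj) auto
      thus ?thesis unfolding eqv_def by (rule eventually_cong) auto
    qed
    finally show ?case by simp
  next
    case (Rel p ts)
    have "eventually (\<lambda>S. \<forall>t\<in>set ts. I S (h (val N us t)) = val M (ev us S) t) U"
      using Rel vals by (intro eventually_ball_finite) auto
    hence "eventually (\<lambda>S. map (I S \<circ> h) (map (val N us) ts) = map (val M (ev us S)) ts) U"
      by (rule eventually_mono) auto
    hence "eventually (\<lambda>S. rel_of M p (map (I S \<circ> h) (map (val N us) ts))) U
      \<longleftrightarrow> eventually (\<lambda>S. rel_of M p (map (val M (ev us S)) ts)) U"
      by (rule eventually_cong) (simp only:)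
    thus ?case by (simp add: N_def)
  next
    case (Neg \<phi>) thus ?case by (simp add: not_ev)
  next
    case (Conj \<phi> \<psi>) thus ?case by (simp add: eventually_conj_iff)
  next
    case (Exi \<phi>)
    have IH: "sat N (u # us) \<phi> \<longleftrightarrow> eventually (\<lambda>S. sat M (I S (h u) # ev us S) \<phi>) U" if "u \<in> dom_of N" for u
      using Exi.IH[of "u # us"] Exi.prems that by (simp add: ev_def)
    show ?case
    proof
      assume "sat N us (Exi \<phi>)"
      then obtain u where u: "u \<in> dom_of N" "sat N (u # us) \<phi>" by auto
      hence "eventually (\<lambda>S. sat M (I S (h u) # ev us S) \<phi>) U" using IH by blast
      thus "eventually (\<lambda>S. sat M (ev us S) (Exi \<phi>)) U"
        by (rule eventually_mono) (use h(1) I_dom u(1) dom_N in auto)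
    next
      assume *: "eventually (\<lambda>S. sat M (ev us S) (Exi \<phi>)) U"
      \<comment> \<open>The witnesses in the single factors vary with \<open>S\<close>, but this one
        term yields a witness wherever there is one.\<close>
      let ?t = "Sk \<phi> (map h us)"
      have t: "?t \<in> W" using Exi.prems by (intro Sk_W) auto
      hence eq: "eventually (\<lambda>S. I S (h (rep ?t)) = I S ?t) U"
        using h_rep unfolding eqv_def by blast
      have It: "I S ?t = wit M \<phi> (ev us S)" for S
        by (simp add: I_def ev_def comp_def)
      from * eq have "eventually (\<lambda>S. sat M (I S (h (rep ?t)) # ev us S) \<phi>) U"
        by (rule eventually_elim2) (use wit(2)[OF D] in \<open>auto simp: It\<close>)
      moreover have "rep ?t \<in> dom_of N" using t by (simp add: dom_N)
      ultimately show "sat N us (Exi \<phi>)" using IH by auto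
    qed
  qed
  let ?e = "map (rep \<circ> Base) [0..<n]"
  show thesis
  proof (rule that)
    show "is_struct L N" by fact
    show e: "?e \<in> tuples n (dom_of N)"
      by (auto simp: dom_N W_def intro!: tuples_map)
    show "\<forall>\<phi> S0. wf_fm L n \<phi> \<longrightarrow> finite S0 \<longrightarrow>
      (\<forall>S. finite S \<longrightarrow> S0 \<subseteq> S \<longrightarrow> sat M (es S) \<phi>) \<longrightarrow> sat N ?e \<phi>"
    proof (intro allI impI)
      fix \<phi> S0 assume \<phi>: "wf_fm L n \<phi>" and S0: "finite S0"
        and sat: "\<forall>S. finite S \<longrightarrow> S0 \<subseteq> S \<longrightarrow> sat M (es S) \<phi>"
      have "eventually (\<lambda>S. finite S \<and> S0 \<subseteq> S) U"
        using U(1) S0 eventually_finite_subsets_at_top[of "\<lambda>S. finite S \<and> S0 \<subseteq> S" UNIV]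
        by (metis filter_leD subset_UNIV)
      moreover have "eventually (\<lambda>S. \<forall>i\<in>{..<n}. I S (h (rep (Base i))) = es S ! i) U"
      proof (intro eventually_ball_finite ballI)
        fix i assume "i \<in> {..<n}"
        hence "eqv (h (rep (Base i))) (Base i)" by (intro h_rep) (simp add: W_def)
        thus "eventually (\<lambda>S. I S (h (rep (Base i))) = es S ! i) U" by (simp add: eqv_def I_def)
      qed simp
      ultimately have "eventually (\<lambda>S. sat M (ev ?e S) \<phi>) U"
      proof (rule eventually_elim2)
        fix S assume S: "finite S \<and> S0 \<subseteq> S" and "\<forall>i\<in>{..<n}. I S (h (rep (Base i))) = es S ! i"
        hence "ev ?e S = es S"
          using tuples_length[OF es] by (intro nth_equalityI) (auto simp: ev_def)
        thus "sat M (ev ?e S) \<phi>" using sat S by simp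
      qed
      thus "sat N ?e \<phi>"
        using los[of ?e \<phi>] e \<phi> by (simp add: tuples_def)
    qed
  qed
qed

section \<open>Codefinability\<close>

text \<open>Predicates \<open>R\<close> on \<open>M\<close> and \<open>S\<close> on \<open>N\<close> are codefinable if one formula defines both. With
  \<open>M = N\<close> and \<open>R = S\<close> this is plain definability.\<close>

definition codef :: "('f, 'p) lang \<Rightarrow> ('a, 'f, 'p) struct \<Rightarrow> ('b, 'f, 'p) struct \<Rightarrow> nat \<Rightarrow>
    ('a list \<Rightarrow> bool) \<Rightarrow> ('b list \<Rightarrow> bool) \<Rightarrow> bool" where
  "codef L M N n R S \<longleftrightarrow> (\<exists>\<phi>. wf_fm L n \<phi> \<and> (\<forall>e\<in>tuples n (dom_of M). sat M e \<phi> \<longleftrightarrow> R e) \<and>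
     (\<forall>e\<in>tuples n (dom_of N). sat N e \<phi> \<longleftrightarrow> S e))"

definition sel :: "nat \<Rightarrow> nat list \<Rightarrow> ('a list \<Rightarrow> 'a list) \<Rightarrow> bool" where
  "sel n is p \<longleftrightarrow> set is \<subseteq> {..<n} \<and> (\<forall>e. length e = n \<longrightarrow> p e = map ((!) e) is)"

abbreviation dfn :: "('f, 'p) lang \<Rightarrow> ('a, 'f, 'p) struct \<Rightarrow> nat \<Rightarrow> ('a list \<Rightarrow> bool) \<Rightarrow> bool" where
  "dfn L M n R \<equiv> codef L M M n R R"

text \<open>One index list for both functions amounts to one substitution of variables, valid in two
  structures whose elements have different types.\<close>

definition cosel :: "nat \<Rightarrow> ('a list \<Rightarrow> 'a list) \<Rightarrow> ('b list \<Rightarrow> 'b list) \<Rightarrow> bool" where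
  "cosel n p q \<longleftrightarrow> (\<exists>is. sel n is p \<and> sel n is q)"

definition covar :: "nat \<Rightarrow> ('a list \<Rightarrow> 'a) \<Rightarrow> ('b list \<Rightarrow> 'b) \<Rightarrow> bool" where
  "covar n u v \<longleftrightarrow> (\<exists>i<n. (\<forall>e. length e = n \<longrightarrow> u e = e ! i) \<and> (\<forall>e. length e = n \<longrightarrow> v e = e ! i))"

lemma cosel_id: "cosel n (\<lambda>e. e) (\<lambda>e. e)"
  unfolding cosel_def sel_def by (intro exI[of _ "[0..<n]"]) (auto simp: map_nth)

lemma cosel_Nil: "cosel n (\<lambda>e. []) (\<lambda>e. [])"
  unfolding cosel_def sel_def by (intro exI[of _ "[]"]) auto

lemma sel_drop: "sel n is p \<Longrightarrow> sel n (drop k is) (\<lambda>e. drop k (p e))"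
  by (auto simp: sel_def drop_map dest: in_set_dropD)

lemma cosel_drop: "cosel n p q \<Longrightarrow> cosel n (\<lambda>e. drop k (p e)) (\<lambda>e. drop k (q e))"
  unfolding cosel_def by (elim exE conjE, rule exI, rule conjI; erule sel_drop)

lemma cosel_tl: "cosel n p q \<Longrightarrow> cosel n (\<lambda>e. tl (p e)) (\<lambda>e. tl (q e))"
  using cosel_drop[of n p q 1] by (simp add: drop_Suc)

lemma sel_take: "sel n is p \<Longrightarrow> sel n (take k is) (\<lambda>e. take k (p e))"
  by (auto simp: sel_def take_map dest: in_set_takeD)

lemma cosel_take: "cosel n p q \<Longrightarrow> cosel n (\<lambda>e. take k (p e)) (\<lambda>e. take k (q e))"
  unfolding cosel_def by (elim exE conjE, rule exI, rule conjI; erule sel_take)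

lemma sel_append: "sel n is p \<Longrightarrow> sel n js p' \<Longrightarrow> sel n (is @ js) (\<lambda>e. p e @ p' e)"
  by (auto simp: sel_def)

lemma cosel_append: "cosel n p q \<Longrightarrow> cosel n p' q' \<Longrightarrow> cosel n (\<lambda>e. p e @ p' e) (\<lambda>e. q e @ q' e)"
  unfolding cosel_def by (elim exE conjE, rule exI, rule conjI; erule (1) sel_append)

lemma cosel_Cons:
  assumes "covar n u v" "cosel n p q"
  shows "cosel n (\<lambda>e. u e # p e) (\<lambda>e. v e # q e)"
proof -
  from assms(2) obtain "is" where "sel n is p" "sel n is q" unfolding cosel_def by blast
  moreover from assms(1) obtain i where "i < n" "\<forall>e. length e = n \<longrightarrow> u e = e ! i"
    "\<forall>e. length e = n \<longrightarrow> v e = e ! i" unfolding covar_def by blast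
  ultimately show ?thesis unfolding cosel_def sel_def by (intro exI[of _ "i # is"]) auto
qed

lemma covar_nth:
  fixes p :: "'a list \<Rightarrow> 'a list"
  assumes "cosel n p q" "\<And>e :: 'a list. length e = n \<Longrightarrow> i < length (p e)"
  shows "covar n (\<lambda>e. p e ! i) (\<lambda>e. q e ! i)"
proof -
  from assms(1) obtain "is" where "is": "set is \<subseteq> {..<n}" "\<forall>e. length e = n \<longrightarrow> p e = map ((!) e) is"
    "\<forall>e. length e = n \<longrightarrow> q e = map ((!) e) is" unfolding cosel_def sel_def by blast
  \<comment> \<open>Any tuple of length \<open>n\<close> will do: the hypothesis on lengths is
    tested on it only to learn the length of \<open>is\<close>.\<close>
  have "i < length is" using assms(2)[of "replicate n undefined"] "is"(2) by simp
  with "is" show ?thesis unfolding covar_def by (intro exI[of _ "is ! i"]) (auto dest: nth_mem)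
qed

lemma covar_hd:
  fixes p :: "'a list \<Rightarrow> 'a list"
  assumes "cosel n p q" "\<And>e :: 'a list. length e = n \<Longrightarrow> 0 < length (p e)"
  shows "covar n (\<lambda>e. hd (p e)) (\<lambda>e. hd (q e))"
proof -
  from assms(1) obtain "is" where "is": "set is \<subseteq> {..<n}" "\<forall>e. length e = n \<longrightarrow> p e = map ((!) e) is"
    "\<forall>e. length e = n \<longrightarrow> q e = map ((!) e) is" unfolding cosel_def sel_def by blast
  have "0 < length is" using assms(2)[of "replicate n undefined"] "is"(2) by simp
  with "is" show ?thesis unfolding covar_def
    by (cases "is") (auto intro!: exI[of _ "hd is"])
qed

section \<open>Closure properties of codefinability\<close>

lemma codefI:
  assumes "wf_fm L n \<phi>" "\<And>e. e \<in> tuples n (dom_of M) \<Longrightarrow> sat M e \<phi> \<longleftrightarrow> R e"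
    "\<And>e. e \<in> tuples n (dom_of N) \<Longrightarrow> sat N e \<phi> \<longleftrightarrow> S e"
  shows "codef L M N n R S"
  using assms unfolding codef_def by blast

lemma codef_cong:
  assumes "codef L M N n R S" "\<And>e. e \<in> tuples n (dom_of M) \<Longrightarrow> R e \<longleftrightarrow> R' e"
    "\<And>e. e \<in> tuples n (dom_of N) \<Longrightarrow> S e \<longleftrightarrow> S' e"
  shows "codef L M N n R' S'"
proof -
  from assms(1) obtain \<phi> where "wf_fm L n \<phi>" "\<forall>e\<in>tuples n (dom_of M). sat M e \<phi> \<longleftrightarrow> R e"
     "\<forall>e\<in>tuples n (dom_of N). sat N e \<phi> \<longleftrightarrow> S e" unfolding codef_def by blast
  with assms(2,3) show ?thesis by (intro codefI[of L n \<phi>]) auto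
qed

lemma codef_app:
  fixes p :: "'a list \<Rightarrow> 'a list" and M :: "('a, 'f, 'p) struct"
  assumes "codef L M N k R S" "cosel n p q" "\<And>e :: 'a list. length e = n \<Longrightarrow> length (p e) = k"
  shows "codef L M N n (\<lambda>e. R (p e)) (\<lambda>e. S (q e))"
proof -
  from assms(2) obtain "is" where "is": "set is \<subseteq> {..<n}" "\<forall>e. length e = n \<longrightarrow> p e = map ((!) e) is"
    "\<forall>e. length e = n \<longrightarrow> q e = map ((!) e) is" unfolding cosel_def sel_def by blast
  have len: "length is = k" using assms(3)[of "replicate n undefined"] "is"(2) by simp
  from assms(1) obtain \<phi> where \<phi>: "wf_fm L k \<phi>" "\<forall>e\<in>tuples k (dom_of M). sat M e \<phi> \<longleftrightarrow> R e"
     "\<forall>e\<in>tuples k (dom_of N). sat N e \<phi> \<longleftrightarrow> S e" unfolding codef_def by blast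
  show ?thesis
  proof (rule codefI[of L n "ren_fm ((!) is) \<phi>"])
    show "wf_fm L n (ren_fm ((!) is) \<phi>)"
      by (rule wf_ren_fm[OF \<phi>(1)]) (use len "is"(1) nth_mem in blast)
    have ren: "sat X e (ren_fm ((!) is) \<phi>) = sat X (map ((!) e) is) \<phi>" for X :: "('c, 'f, 'p) struct" and e
      by (rule sat_ren[OF \<phi>(1)]) (simp add: len)
    show "sat M e (ren_fm ((!) is) \<phi>) = R (p e)" if "e \<in> tuples n (dom_of M)" for e
      using \<phi>(2) tuples_nth_select[OF that "is"(1)] "is"(2) tuples_length[OF that] by (simp add: sat_ren[OF \<phi>(1)] ren len)
    show "sat N e (ren_fm ((!) is) \<phi>) = S (q e)" if "e \<in> tuples n (dom_of N)" for e
      using \<phi>(3) tuples_nth_select[OF that "is"(1)] "is"(3) tuples_length[OF that] by (simp add: ren len)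
  qed
qed

lemma codef_sat:
  fixes p :: "'a list \<Rightarrow> 'a list" and M :: "('a, 'f, 'p) struct"
  assumes "wf_fm L k \<phi>" "cosel n p q" "\<And>e :: 'a list. length e = n \<Longrightarrow> length (p e) = k"
  shows "codef L M N n (\<lambda>e. sat M (p e) \<phi>) (\<lambda>e. sat N (q e) \<phi>)"
  by (rule codef_app[OF _ assms(2,3)], rule codefI[OF assms(1)]) auto

lemma codef_True: "codef L M N n (\<lambda>_. True) (\<lambda>_. True)"
  by (rule codefI[of _ _ "Neg (Exi (Neg (Eq (Var 0) (Var 0))))"]) auto

lemma codef_not:
  assumes "codef L M N n R S"
  shows "codef L M N n (\<lambda>e. \<not> R e) (\<lambda>e. \<not> S e)"
proof -
  from assms obtain \<phi> where "wf_fm L n \<phi>" "\<forall>e\<in>tuples n (dom_of M). sat M e \<phi> \<longleftrightarrow> R e"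
     "\<forall>e\<in>tuples n (dom_of N). sat N e \<phi> \<longleftrightarrow> S e" unfolding codef_def by blast
  thus ?thesis by (intro codefI[of L n "Neg \<phi>"]) auto
qed

lemma codef_conj:
  assumes "codef L M N n R S" "codef L M N n R' S'"
  shows "codef L M N n (\<lambda>e. R e \<and> R' e) (\<lambda>e. S e \<and> S' e)"
proof -
  from assms(1) obtain \<phi> where 1: "wf_fm L n \<phi>" "\<forall>e\<in>tuples n (dom_of M). sat M e \<phi> \<longleftrightarrow> R e"
     "\<forall>e\<in>tuples n (dom_of N). sat N e \<phi> \<longleftrightarrow> S e" unfolding codef_def by blast
  from assms(2) obtain \<psi> where "wf_fm L n \<psi>" "\<forall>e\<in>tuples n (dom_of M). sat M e \<psi> \<longleftrightarrow> R' e"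
     "\<forall>e\<in>tuples n (dom_of N). sat N e \<psi> \<longleftrightarrow> S' e" unfolding codef_def by blast
  with 1 show ?thesis by (intro codefI[of L n "Conj \<phi> \<psi>"]) auto
qed

lemma codef_disj:
  assumes "codef L M N n R S" "codef L M N n R' S'"
  shows "codef L M N n (\<lambda>e. R e \<or> R' e) (\<lambda>e. S e \<or> S' e)"
proof -
  have "codef L M N n (\<lambda>e. \<not> (\<not> R e \<and> \<not> R' e)) (\<lambda>e. \<not> (\<not> S e \<and> \<not> S' e))"
    by (intro codef_not codef_conj assms)
  thus ?thesis by (simp only: de_Morgan_conj not_not)
qed

lemma codef_imp:
  assumes "codef L M N n R S" "codef L M N n R' S'"
  shows "codef L M N n (\<lambda>e. R e \<longrightarrow> R' e) (\<lambda>e. S e \<longrightarrow> S' e)"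
  unfolding imp_conv_disj by (intro codef_disj codef_not assms)

lemma codef_iff:
  assumes "codef L M N n R S" "codef L M N n R' S'"
  shows "codef L M N n (\<lambda>e. R e \<longleftrightarrow> R' e) (\<lambda>e. S e \<longleftrightarrow> S' e)"
  unfolding iff_conv_conj_imp by (intro codef_conj codef_imp assms)

text \<open>With \<open>hd\<close> and \<open>tl\<close> in the premise, the rule applied backwards
  matches any body and leaves a goal of the same shape with one more variable. Definability proofs
  thereby become syntax-directed.\<close>

lemma codef_ex:
  assumes "codef L M N (Suc n) (\<lambda>e. R (hd e) (tl e)) (\<lambda>e. S (hd e) (tl e))"
  shows "codef L M N n (\<lambda>e. \<exists>x\<in>dom_of M. R x e) (\<lambda>e. \<exists>x\<in>dom_of N. S x e)"
proof -
  from assms obtain \<phi> where "wf_fm L (Suc n) \<phi>"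
    "\<forall>e\<in>tuples (Suc n) (dom_of M). sat M e \<phi> \<longleftrightarrow> R (hd e) (tl e)"
    "\<forall>e\<in>tuples (Suc n) (dom_of N). sat N e \<phi> \<longleftrightarrow> S (hd e) (tl e)" unfolding codef_def by blast
  thus ?thesis by (intro codefI[of L n "Exi \<phi>"]) auto
qed

lemma codef_all:
  assumes "codef L M N (Suc n) (\<lambda>e. R (hd e) (tl e)) (\<lambda>e. S (hd e) (tl e))"
  shows "codef L M N n (\<lambda>e. \<forall>x\<in>dom_of M. R x e) (\<lambda>e. \<forall>x\<in>dom_of N. S x e)"
proof -
  have "codef L M N n (\<lambda>e. \<not> (\<exists>x\<in>dom_of M. \<not> R x e)) (\<lambda>e. \<not> (\<exists>x\<in>dom_of N. \<not> S x e))"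
    by (intro codef_not codef_ex assms)
  thus ?thesis by (simp only: ball_simps bex_simps not_not)
qed

lemma sat_funpow_Exi:
  "sat M e ((Exi ^^ k) \<phi>) \<longleftrightarrow> (\<exists>xs\<in>tuples k (dom_of M). sat M (xs @ e) \<phi>)"
proof (induction k arbitrary: \<phi>)
  case (Suc k)
  have "sat M e ((Exi ^^ Suc k) \<phi>) \<longleftrightarrow> sat M e ((Exi ^^ k) (Exi \<phi>))"
    by (simp add: funpow_swap1)
  also have "\<dots> \<longleftrightarrow> (\<exists>xs\<in>tuples (Suc k) (dom_of M). sat M (xs @ e) \<phi>)" (is "_ \<longleftrightarrow> ?r")
  proof
    assume "sat M e ((Exi ^^ k) (Exi \<phi>))"
    then obtain xs x where "xs \<in> tuples k (dom_of M)" "x \<in> dom_of M" "sat M (x # xs @ e) \<phi>"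
      unfolding Suc by auto
    thus ?r by (intro bexI[of _ "x # xs"]) auto
  next
    assume ?r
    then obtain xs where "xs \<in> tuples (Suc k) (dom_of M)" "sat M (xs @ e) \<phi>" by blast
    thus "sat M e ((Exi ^^ k) (Exi \<phi>))" unfolding Suc by (elim tuples_SucE) auto
  qed
  finally show ?case .
qed simp

lemma wf_funpow_Exi: "wf_fm L n ((Exi ^^ k) \<phi>) \<longleftrightarrow> wf_fm L (k + n) \<phi>"
  by (induction k arbitrary: n) auto

lemma codef_exs:
  assumes "codef L M N (k + n) (\<lambda>e. R (take k e) (drop k e)) (\<lambda>e. S (take k e) (drop k e))"
  shows "codef L M N n (\<lambda>e. \<exists>xs\<in>tuples k (dom_of M). R xs e) (\<lambda>e. \<exists>xs\<in>tuples k (dom_of N). S xs e)"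
proof -
  from assms obtain \<phi> where \<phi>: "wf_fm L (k + n) \<phi>"
    "\<forall>e\<in>tuples (k + n) (dom_of M). sat M e \<phi> \<longleftrightarrow> R (take k e) (drop k e)"
    "\<forall>e\<in>tuples (k + n) (dom_of N). sat N e \<phi> \<longleftrightarrow> S (take k e) (drop k e)" unfolding codef_def by blast
  have 1: "sat M (xs @ e) \<phi> \<longleftrightarrow> R xs e" if "xs \<in> tuples k (dom_of M)" "e \<in> tuples n (dom_of M)" for xs e
    using \<phi>(2) tuples_append[OF that] tuples_length[OF that(1)] by force
  have 2: "sat N (xs @ e) \<phi> \<longleftrightarrow> S xs e" if "xs \<in> tuples k (dom_of N)" "e \<in> tuples n (dom_of N)" for xs e
    using \<phi>(3) tuples_append[OF that] tuples_length[OF that(1)] by force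
  show ?thesis
    by (rule codefI[of L n "(Exi ^^ k) \<phi>"]) (use \<phi>(1) 1 2 in \<open>auto simp: wf_funpow_Exi sat_funpow_Exi\<close>)
qed

lemma codef_alls:
  assumes "codef L M N (k + n) (\<lambda>e. R (take k e) (drop k e)) (\<lambda>e. S (take k e) (drop k e))"
  shows "codef L M N n (\<lambda>e. \<forall>xs\<in>tuples k (dom_of M). R xs e) (\<lambda>e. \<forall>xs\<in>tuples k (dom_of N). S xs e)"
proof -
  have "codef L M N n (\<lambda>e. \<not> (\<exists>xs\<in>tuples k (dom_of M). \<not> R xs e)) (\<lambda>e. \<not> (\<exists>xs\<in>tuples k (dom_of N). \<not> S xs e))"
    by (intro codef_not codef_exs assms)
  thus ?thesis by (simp only: ball_simps bex_simps not_not)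
qed

lemma codef_all_less:
  fixes m :: nat
  assumes "\<And>i. i < m \<Longrightarrow> codef L M N n (R i) (S i)"
  shows "codef L M N n (\<lambda>e. \<forall>i<m. R i e) (\<lambda>e. \<forall>i<m. S i e)"
  using assms
proof (induction m)
  case (Suc m)
  hence "codef L M N n (\<lambda>e. (\<forall>i<m. R i e) \<and> R m e) (\<lambda>e. (\<forall>i<m. S i e) \<and> S m e)"
    by (intro codef_conj) auto
  thus ?case by (simp add: All_less_Suc conj_commute)
qed (simp add: codef_True)

lemma codef_ex_less:
  fixes m :: nat
  assumes "\<And>i. i < m \<Longrightarrow> codef L M N n (R i) (S i)"
  shows "codef L M N n (\<lambda>e. \<exists>i<m. R i e) (\<lambda>e. \<exists>i<m. S i e)"
proof -
  have "codef L M N n (\<lambda>e. \<not> (\<forall>i<m. \<not> R i e)) (\<lambda>e. \<not> (\<forall>i<m. \<not> S i e))"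
    by (intro codef_not codef_all_less assms)
  thus ?thesis by (simp add: conj_commute)
qed

lemma codef_eq:
  assumes "covar n u v" "covar n u' v'"
  shows "codef L M N n (\<lambda>e. u e = u' e) (\<lambda>e. v e = v' e)"
proof -
  obtain i j where "i < n" "\<forall>e. length e = n \<longrightarrow> u e = e ! i" "\<forall>e. length e = n \<longrightarrow> v e = e ! i"
    "j < n" "\<forall>e. length e = n \<longrightarrow> u' e = e ! j" "\<forall>e. length e = n \<longrightarrow> v' e = e ! j"
    using assms unfolding covar_def by blast
  thus ?thesis by (intro codefI[of L n "Eq (Var i) (Var j)"]) (auto simp: tuples_def)
qed

lemma codef_val:
  fixes p :: "'a list \<Rightarrow> 'a list" and M :: "('a, 'f, 'p) struct"
  assumes "wf_trm L k t" "covar n u v" "cosel n p q" "\<And>e :: 'a list. length e = n \<Longrightarrow> length (p e) = k"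
  shows "codef L M N n (\<lambda>e. val M (p e) t = u e) (\<lambda>e. val N (q e) t = v e)"
proof -
  have "codef L M N (Suc k) (\<lambda>e. val M (tl e) t = hd e) (\<lambda>e. val N (tl e) t = hd e)"
  proof (rule codefI[of _ _ "Eq (ren_trm Suc t) (Var 0)"])
    show "wf_fm L (Suc k) (Eq (ren_trm Suc t) (Var 0))"
      using wf_ren_trm[OF assms(1)] by simp
    have ren: "val X (x # e) (ren_trm Suc t) = val X e t" for X :: "('c, 'f, 'p) struct" and x e
      by (rule val_ren[OF assms(1)]) simp
    show "sat M e (Eq (ren_trm Suc t) (Var 0)) = (val M (tl e) t = hd e)" if "e \<in> tuples (Suc k) (dom_of M)" for e
      using that by (elim tuples_SucE) (simp add: val_ren[OF assms(1)])
    show "sat N e (Eq (ren_trm Suc t) (Var 0)) = (val N (tl e) t = hd e)" if "e \<in> tuples (Suc k) (dom_of N)" for e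
      using that by (elim tuples_SucE) (simp add: val_ren[OF assms(1)])
  qed
  from codef_app[OF this cosel_Cons[OF assms(2,3)]] assms(4) show ?thesis by simp
qed

lemma codef_rel:
  fixes p :: "'a list \<Rightarrow> 'a list" and M :: "('a, 'f, 'p) struct"
  assumes "parity L r = Some k" "cosel n p q" "\<And>e :: 'a list. length e = n \<Longrightarrow> length (p e) = k"
  shows "codef L M N n (\<lambda>e. rel_of M r (p e)) (\<lambda>e. rel_of N r (q e))"
proof -
  have "codef L M N k (rel_of M r) (rel_of N r)"
  proof (rule codefI[of _ _ "Rel r (map Var [0..<k])"])
    show "sat M e (Rel r (map Var [0..<k])) = rel_of M r e" if "e \<in> tuples k (dom_of M)" for e
      using map_nth[of e] tuples_length[OF that] by (simp add: comp_def)
    show "sat N e (Rel r (map Var [0..<k])) = rel_of N r e" if "e \<in> tuples k (dom_of N)" for e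
      using map_nth[of e] tuples_length[OF that] by (simp add: comp_def)
  qed (use assms(1) in auto)
  from codef_app[OF this assms(2,3)] show ?thesis .
qed

lemma codef_fun:
  fixes p :: "'a list \<Rightarrow> 'a list" and M :: "('a, 'f, 'p) struct"
  assumes "farity L f = Some k" "covar n u v" "cosel n p q" "\<And>e :: 'a list. length e = n \<Longrightarrow> length (p e) = k"
  shows "codef L M N n (\<lambda>e. fun_of M f (p e) = u e) (\<lambda>e. fun_of N f (q e) = v e)"
proof -
  have val: "val X (y # ys) (App f (map Var [Suc 0..<Suc k])) = fun_of X f ys" if "length ys = k"
    for X :: "('c, 'f, 'p) struct" and y ys
  proof -
    have "map ((!) (y # ys)) [Suc 0..<Suc k] = ys"
      using that by (intro nth_equalityI) (auto simp del: upt_Suc)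
    thus ?thesis by (simp add: comp_def del: upt_Suc)
  qed
  have "codef L M N (Suc k) (\<lambda>e. fun_of M f (tl e) = hd e) (\<lambda>e. fun_of N f (tl e) = hd e)"
    by (rule codefI[of _ _ "Eq (App f (map Var [Suc 0..<Suc k])) (Var 0)"])
      (use assms(1) in \<open>auto simp: val tuples_length simp del: upt_Suc val.simps(2) elim!: tuples_SucE\<close>)
  from codef_app[OF this cosel_Cons[OF assms(2,3)]] assms(4) show ?thesis by simp
qed

lemmas cosel_intros = covar_hd covar_nth cosel_tl cosel_drop cosel_take cosel_append cosel_Cons
  cosel_Nil cosel_id

section \<open>Imaginary parameters\<close>

lemma codef_imag:
  assumes "dfn L M n R"
  shows "dfn (lang_imag L \<Xi>) (struct_imag M) n R"
proof -
  from assms obtain \<phi> where \<phi>: "wf_fm L n \<phi>" "\<forall>e\<in>tuples n (dom_of M). sat M e \<phi> \<longleftrightarrow> R e"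
    unfolding codef_def by blast
  have "sat (struct_imag M) e (map_fm id Inl \<phi>) = sat M e \<phi>" for e
    by (rule sat_map_fm[OF _ _ \<phi>(1)]) (auto simp: struct_imag_def)
  moreover have "wf_fm (lang_imag L \<Xi>) n (map_fm id Inl \<phi>)"
    by (rule wf_fm_map[OF \<phi>(1)]) (auto simp: lang_imag_def)
  ultimately show ?thesis
    using \<phi>(2) by (intro codefI[of _ _ "map_fm id Inl \<phi>"]) (auto simp: struct_imag_def)
qed

lemma codef_imag_mem:
  assumes "\<xi> \<in> \<Xi>" "covar n u u"
  shows "dfn (lang_imag L \<Xi>) (struct_imag M) n (\<lambda>e. u e \<in> \<xi>)"
proof -
  from assms(2) obtain i where "i < n" "\<forall>e. length e = n \<longrightarrow> u e = e ! i" unfolding covar_def by blast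
  thus ?thesis
    by (intro codefI[of _ _ "Rel (Inr \<xi>) [Var i]"])
      (use assms(1) in \<open>auto simp: lang_imag_def struct_imag_def dest: tuples_length\<close>)
qed

lemma definable_codefI:
  assumes "dfn (lang_imag L \<Xi>) (struct_imag M) (Suc n) R"
    "as \<in> tuples n (dom_of M)" "set as \<subseteq> A"
  shows "definable L M A \<Xi> {x \<in> dom_of M. R (x # as)}"
proof -
  from assms(1) obtain \<phi> where \<phi>: "wf_fm (lang_imag L \<Xi>) (Suc n) \<phi>"
    "\<forall>e\<in>tuples (Suc n) (dom_of M). sat (struct_imag M) e \<phi> \<longleftrightarrow> R e"
    unfolding codef_def by (auto simp: struct_imag_def)
  have "\<forall>x\<in>dom_of M. sat (struct_imag M) (x # as) \<phi> \<longleftrightarrow> R (x # as)"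
    using \<phi>(2) assms(2) by simp
  thus ?thesis
    using \<phi>(1) assms(2,3) unfolding definable_def
    by (intro exI[of _ \<phi>] exI[of _ as]) (auto simp: tuples_length)
qed

text \<open>The parameters are put into the form of the full list \<open>ys\<close>, whatever their
  order and repetitions were, so that the formula can be evaluated with other tuples in place of
  \<open>ys\<close>.\<close>

lemma definable_without_imag:
  assumes "definable L M (set ys) {} C" "set ys \<subseteq> dom_of M"
  obtains \<psi> where "wf_fm L (Suc (length ys)) \<psi>" "C = {x \<in> dom_of M. sat M (x # ys) \<psi>}"
proof -
  from assms(1) obtain \<phi> as where as: "set as \<subseteq> set ys" and wf: "wf_fm (lang_imag L {}) (Suc (length as)) \<phi>"
    and C: "C = {x \<in> dom_of M. sat (struct_imag M) (x # as) \<phi>}"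
    unfolding definable_def by blast
  let ?\<phi> = "map_fm id projl \<phi>"
  have wf': "wf_fm L (Suc (length as)) ?\<phi>"
    by (rule wf_fm_map[OF wf]) (auto simp: lang_imag_def split: sum.splits)
  have sat: "sat M e ?\<phi> = sat (struct_imag M) e \<phi>" for e
    by (rule sat_map_fm[OF _ _ wf]) (auto simp: lang_imag_def struct_imag_def split: sum.splits)
  have "\<exists>j. i < length as \<longrightarrow> j < length ys \<and> ys ! j = as ! i" for i
    using as nth_mem[of i as] by (auto simp: subset_iff in_set_conv_nth)
  then obtain r where r: "i < length as \<Longrightarrow> r i < length ys" "i < length as \<Longrightarrow> ys ! r i = as ! i" for i
    using choice[of "\<lambda>i j. i < length as \<longrightarrow> j < length ys \<and> ys ! j = as ! i"] by blast
  let ?r = "case_nat 0 (\<lambda>i. Suc (r i))"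
  show thesis
  proof
    show "wf_fm L (Suc (length ys)) (ren_fm ?r ?\<phi>)"
      by (rule wf_ren_fm[OF wf']) (auto split: nat.split simp: r)
    have "sat M (x # ys) (ren_fm ?r ?\<phi>) = sat M (x # as) ?\<phi>" for x
      by (rule sat_ren[OF wf']) (auto split: nat.split simp: r)
    thus "C = {x \<in> dom_of M. sat M (x # ys) (ren_fm ?r ?\<phi>)}"
      using C sat by simp
  qed
qed

section \<open>Valued fields\<close>

text \<open>\<open>vdvd M x y\<close> says \<open>|x| \<le> |y|\<close>.\<close>

definition vdvd :: "('a, 'f, 'p) vstruct \<Rightarrow> 'a \<Rightarrow> 'a \<Rightarrow> bool" where
  "vdvd M x y \<longleftrightarrow> (\<exists>r\<in>VR M. fun_of M Times [r, y] = x)"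

text \<open>\<open>rveq M l x y\<close> says \<open>rv x = rv y\<close> at level \<open>|l|\<close>: both are zero, or \<open>x \<in> (1 + b) y\<close> with \<open>|b| < |l|\<close>.\<close>

definition rveq :: "('a, 'f, 'p) vstruct \<Rightarrow> 'a \<Rightarrow> 'a \<Rightarrow> 'a \<Rightarrow> bool" where
  "rveq M l x y \<longleftrightarrow> (\<exists>b\<in>dom_of M. \<not> vdvd M l b \<and>
     (\<exists>t\<in>dom_of M. fun_of M Times [b, y] = t \<and> fun_of M Plus [y, t] = x))"

locale vfield =
  fixes M :: "('a, 'f, 'p) vstruct"
  assumes vf: "valued_field M"
begin

abbreviation "D \<equiv> dom_of M"
abbreviation add (infixl "+!" 65) where "x +! y \<equiv> x \<oplus>\<^bsub>Rng M\<^esub> y"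
abbreviation mult (infixl "*!" 70) where "x *! y \<equiv> x \<otimes>\<^bsub>Rng M\<^esub> y"
abbreviation diff (infixl "-!" 65) where "x -! y \<equiv> x \<ominus>\<^bsub>Rng M\<^esub> y"
abbreviation zero ("0!") where "0! \<equiv> \<zero>\<^bsub>Rng M\<^esub>"
abbreviation one ("1!") where "1! \<equiv> \<one>\<^bsub>Rng M\<^esub>"

lemma carrier_Rng [simp]: "carrier (Rng M) = D"
  by (simp add: Rng_def Let_def)

lemma fun_of_Plus: "fun_of M Plus [x, y] = x +! y"
  by (simp add: Rng_def Let_def)

lemma fun_of_Times: "fun_of M Times [x, y] = x *! y"
  by (simp add: Rng_def Let_def)

sublocale R: field "Rng M"
  rewrites "carrier (Rng M) \<equiv> D"
  using vf by (simp_all add: valued_field_def)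

lemma VR_subring: "subring (VR M) (Rng M)"
  using vf by (simp add: valued_field_def)

lemma VR_D: "r \<in> VR M \<Longrightarrow> r \<in> D"
  by (simp add: VR_def)

lemmas VR_closed [simp] = subringE(2,3,5,6,7)[OF VR_subring]

lemma VR_total: "x \<in> D \<Longrightarrow> x \<noteq> 0! \<Longrightarrow> x \<in> VR M \<or> inv\<^bsub>Rng M\<^esub> x \<in> VR M"
  using vf by (auto simp: valued_field_def)

lemma vdvd_iff: "vdvd M x y \<longleftrightarrow> (\<exists>r\<in>VR M. r *! y = x)"
  by (simp add: vdvd_def fun_of_Times)

lemma rveq_iff: "rveq M l x y \<longleftrightarrow> (\<exists>b\<in>D. \<not> vdvd M l b \<and> x = y +! b *! y)" if "y \<in> D"
  unfolding rveq_def fun_of_Plus fun_of_Times using that by auto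

lemma vdvd_refl [simp]: "x \<in> D \<Longrightarrow> vdvd M x x"
  unfolding vdvd_iff by (intro bexI[of _ "1!"]) auto

lemma vdvd_zero [simp]: "x \<in> D \<Longrightarrow> vdvd M 0! x"
  unfolding vdvd_iff by (intro bexI[of _ "0!"]) auto

lemma vdvd_trans: "vdvd M x y \<Longrightarrow> vdvd M y z \<Longrightarrow> z \<in> D \<Longrightarrow> vdvd M x z"
  unfolding vdvd_iff by (metis VR_D VR_closed(4) R.m_assoc)

lemma vdvd_zero_iff: "x \<in> D \<Longrightarrow> vdvd M x 0! \<longleftrightarrow> x = 0!"
  unfolding vdvd_iff using VR_D VR_closed(1) R.r_null by fastforce

lemma vdvd_one_iff: "x \<in> D \<Longrightarrow> vdvd M x 1! \<longleftrightarrow> x \<in> VR M"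
  unfolding vdvd_iff using VR_D R.r_one by auto

lemma field_inv: "x \<in> D \<Longrightarrow> x \<noteq> 0! \<Longrightarrow> inv\<^bsub>Rng M\<^esub> x \<in> D \<and> inv\<^bsub>Rng M\<^esub> x *! x = 1! \<and> x *! inv\<^bsub>Rng M\<^esub> x = 1!"
  using R.field_Units by (auto intro: R.Units_inv_closed R.Units_l_inv R.Units_r_inv)

lemma vdvd_total:
  assumes "x \<in> D" "y \<in> D"
  shows "vdvd M x y \<or> vdvd M y x"
proof (cases "x = 0! \<or> y = 0!")
  case False
  let ?q = "x *! inv\<^bsub>Rng M\<^esub> y"
  have ix: "inv\<^bsub>Rng M\<^esub> x \<in> D" "x *! inv\<^bsub>Rng M\<^esub> x = 1!" "inv\<^bsub>Rng M\<^esub> x *! x = 1!"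
    and iy: "inv\<^bsub>Rng M\<^esub> y \<in> D" "inv\<^bsub>Rng M\<^esub> y *! y = 1!"
    using field_inv assms False by auto
  have q: "?q *! y = x" using assms iy by (simp add: R.m_assoc)
  have qD: "?q \<in> D" using assms iy by simp
  have "?q \<noteq> 0!" using q assms False by auto
  with VR_total[OF qD] consider "?q \<in> VR M" | "inv\<^bsub>Rng M\<^esub> ?q \<in> VR M" by blast
  thus ?thesis
  proof cases
    case 1 thus ?thesis using q by (auto simp: vdvd_iff)
  next
    case 2
    have "inv\<^bsub>Rng M\<^esub> ?q *! x = inv\<^bsub>Rng M\<^esub> ?q *! (?q *! y)" by (simp only: q)
    also have "\<dots> = (inv\<^bsub>Rng M\<^esub> ?q *! ?q) *! y"
      using field_inv[OF qD \<open>?q \<noteq> 0!\<close>] qD assms by (intro R.m_assoc[symmetric]) auto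
    also have "\<dots> = y" using field_inv[OF qD \<open>?q \<noteq> 0!\<close>] assms by simp
    finally show ?thesis using 2 by (auto simp: vdvd_iff)
  qed
qed (use assms in auto)

lemma vdvd_add: "vdvd M x z \<Longrightarrow> vdvd M y z \<Longrightarrow> z \<in> D \<Longrightarrow> vdvd M (x +! y) z"
  unfolding vdvd_iff by (metis VR_D VR_closed(5) R.l_distr)

lemma vdvd_minus: "vdvd M x z \<Longrightarrow> z \<in> D \<Longrightarrow> vdvd M (\<ominus>\<^bsub>Rng M\<^esub> x) z"
  unfolding vdvd_iff by (metis VR_D VR_closed(3) R.l_minus)

lemma vdvd_mult_VR: "r \<in> VR M \<Longrightarrow> x \<in> D \<Longrightarrow> vdvd M (r *! x) x"
  unfolding vdvd_iff by blast

lemma small_add: "\<not> vdvd M l a \<Longrightarrow> \<not> vdvd M l b \<Longrightarrow> l \<in> D \<Longrightarrow> a \<in> D \<Longrightarrow> b \<in> D \<Longrightarrow> \<not> vdvd M l (a +! b)"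
  by (meson R.a_closed vdvd_add vdvd_refl vdvd_total vdvd_trans)

lemma small_mult: "\<not> vdvd M l b \<Longrightarrow> r \<in> VR M \<Longrightarrow> b \<in> D \<Longrightarrow> \<not> vdvd M l (r *! b)"
  using vdvd_mult_VR vdvd_trans by blast

lemma small_minus: "\<not> vdvd M l b \<Longrightarrow> b \<in> D \<Longrightarrow> \<not> vdvd M l (\<ominus>\<^bsub>Rng M\<^esub> b)"
  using vdvd_minus[of b b] vdvd_trans vdvd_refl by blast

text \<open>Field elements representing the values \<lambda> \<le> 1, so that formulas can quantify
  over levels.\<close>

definition levels :: "'a set" where "levels = VR M - {0!}"

lemma levelsD: "l \<in> levels \<Longrightarrow> l \<in> D" "l \<in> levels \<Longrightarrow> l \<noteq> 0!" "l \<in> levels \<Longrightarrow> vdvd M l 1!"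
  by (auto simp: levels_def VR_D vdvd_one_iff)

lemma one_level: "1! \<in> levels"
  by (simp add: levels_def)

lemma small_zero: "l \<in> levels \<Longrightarrow> \<not> vdvd M l 0!"
  by (simp add: levelsD vdvd_zero_iff)

lemma small_VR: "l \<in> levels \<Longrightarrow> b \<in> D \<Longrightarrow> \<not> vdvd M l b \<Longrightarrow> b \<in> VR M"
  by (meson levelsD vdvd_one_iff vdvd_total vdvd_trans R.one_closed)

text \<open>If \<open>1! +! b\<close> were not invertible in the valuation ring, its value and that
  of \<open>b\<close> would both be below 1, hence also that of their difference 1. With
  \<open>v\<close> the inverse, \<open>c\<close> is \<open>v\<close> minus 1, that is, minus
  \<open>v *! b\<close>.\<close>

lemma small_inverse:
  assumes l: "l \<in> levels" and b: "b \<in> D" "\<not> vdvd M l b"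
  obtains c where "c \<in> D" "\<not> vdvd M l c" "(1! +! c) *! (1! +! b) = 1!"
proof -
  have nb: "\<not> vdvd M 1! b" using b l vdvd_trans levelsD by blast
  have "\<exists>v\<in>VR M. v *! (1! +! b) = 1!"
  proof (rule ccontr)
    assume "\<not> (\<exists>v\<in>VR M. v *! (1! +! b) = 1!)"
    hence "\<not> vdvd M 1! (1! +! b)" by (simp add: vdvd_iff)
    hence "\<not> vdvd M 1! ((1! +! b) +! \<ominus>\<^bsub>Rng M\<^esub> b)"
      using b nb by (intro small_add[of "1!" "1! +! b"] small_minus) auto
    moreover have "(1! +! b) +! \<ominus>\<^bsub>Rng M\<^esub> b = 1!" using b by (simp add: R.a_assoc R.r_neg)
    ultimately show False by simp
  qed
  then obtain v where v: "v \<in> VR M" "v *! (1! +! b) = 1!" by blast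
  let ?c = "\<ominus>\<^bsub>Rng M\<^esub> (v *! b)"
  have vD: "v \<in> D" using v VR_D by blast
  have "v +! v *! b = 1!" using v vD b by (simp add: R.r_distr)
  hence "1! +! ?c = v" using vD b
    by (metis R.a_assoc R.a_inv_closed R.m_closed R.r_neg R.r_zero)
  thus thesis
    using that[of ?c] v vD b by (simp add: small_minus small_mult)
qed

lemma rveq_refl: "l \<in> levels \<Longrightarrow> x \<in> D \<Longrightarrow> rveq M l x x"
  unfolding rveq_iff by (intro bexI[of _ "0!"]) (auto simp: small_zero)

lemma rveq_mult_iff: "rveq M l x y \<longleftrightarrow> (\<exists>b\<in>D. \<not> vdvd M l b \<and> x = (1! +! b) *! y)" if "y \<in> D"
  unfolding rveq_iff[OF that] using that by (auto simp: R.l_distr)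

lemma rveq_sym:
  assumes l: "l \<in> levels" and "x \<in> D" "y \<in> D" "rveq M l x y"
  shows "rveq M l y x"
proof -
  obtain b where b: "b \<in> D" "\<not> vdvd M l b" "x = (1! +! b) *! y"
    using assms by (auto simp: rveq_mult_iff)
  obtain c where c: "c \<in> D" "\<not> vdvd M l c" "(1! +! c) *! (1! +! b) = 1!"
    by (rule small_inverse[OF l b(1,2)])
  have "y = ((1! +! c) *! (1! +! b)) *! y" using assms c by simp
  also have "\<dots> = (1! +! c) *! x"
    unfolding b(3) by (rule R.m_assoc) (use b c assms in auto)
  finally show ?thesis unfolding rveq_mult_iff[OF assms(2)] using c by blast
qed

lemma rveq_trans:
  assumes l: "l \<in> levels" and "x \<in> D" "y \<in> D" "z \<in> D" "rveq M l x y" "rveq M l y z"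
  shows "rveq M l x z"
proof -
  obtain b where b: "b \<in> D" "\<not> vdvd M l b" "x = (1! +! b) *! y"
    using assms by (auto simp: rveq_mult_iff)
  obtain c where c: "c \<in> D" "\<not> vdvd M l c" "y = (1! +! c) *! z"
    using assms by (auto simp: rveq_mult_iff)
  have "x = ((1! +! b) *! (1! +! c)) *! z" using b c assms by (simp add: R.m_assoc)
  moreover have "(1! +! b) *! (1! +! c) = 1! +! (c +! (b +! b *! c))"
    using b c by (simp add: R.l_distr R.r_distr R.a_ac)
  moreover have "\<not> vdvd M l (c +! (b +! b *! c))"
    using b c l small_VR[OF l b(1,2)] by (intro small_add small_mult) (auto simp: levelsD)
  ultimately show ?thesis using b c assms by (auto simp: rveq_mult_iff)
qed

abbreviation "Uts \<equiv> Units (val_ring M)"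

lemma Units_val_ring: "Uts = {u \<in> VR M. \<exists>v\<in>VR M. v *! u = 1!}"
  by (auto simp: Units_def val_ring_def VR_D R.m_comm)

lemma one_Units: "1! \<in> Uts"
  by (auto simp: Units_val_ring intro!: bexI[of _ "1!"])

lemma vabs_eq: "vabs M x = {u *! x | u. u \<in> Uts}"
  by (auto simp: vabs_def r_coset_def)

lemma vle_iff:
  assumes "x \<in> D" "y \<in> D"
  shows "vle M (vabs M x) (vabs M y) \<longleftrightarrow> vdvd M x y"
proof
  assume "vle M (vabs M x) (vabs M y)"
  then obtain u v r where *: "u \<in> Uts" "v \<in> Uts" "r \<in> VR M" "u *! x = r *! (v *! y)"
    unfolding vle_def vabs_eq by auto
  then obtain w where w: "w \<in> VR M" "w *! u = 1!" by (auto simp: Units_val_ring)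
  have D: "u \<in> D" "v \<in> D" "w \<in> D" "r \<in> D" "v \<in> VR M" using * w VR_D by (auto simp: Units_val_ring)
  have "x = (w *! u) *! x" using w assms by simp
  also have "\<dots> = w *! (u *! x)" using D assms by (simp add: R.m_assoc)
  also have "\<dots> = (w *! (r *! v)) *! y" using * D assms by (simp add: R.m_assoc)
  finally show "vdvd M x y" unfolding vdvd_iff using w * D by (metis VR_closed(4))
next
  assume "vdvd M x y"
  then obtain r where "r \<in> VR M" "r *! y = x" by (auto simp: vdvd_iff)
  moreover have "x \<in> vabs M x" "y \<in> vabs M y"
    using assms one_Units R.l_one by (force simp: vabs_eq)+
  ultimately show "vle M (vabs M x) (vabs M y)" unfolding vle_def by blast
qed

lemma vabs_eq_iff:
  assumes "x \<in> D" "y \<in> D"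
  shows "vabs M x = vabs M y \<longleftrightarrow> vdvd M x y \<and> vdvd M y x"
proof
  assume "vabs M x = vabs M y"
  hence "vle M (vabs M x) (vabs M y)" "vle M (vabs M y) (vabs M x)"
    using vle_iff[of x x] vle_iff[of y y] assms by auto
  thus "vdvd M x y \<and> vdvd M y x" using vle_iff assms by blast
next
  assume *: "vdvd M x y \<and> vdvd M y x"
  then obtain r s where r: "r \<in> VR M" "x = r *! y" and s: "s \<in> VR M" "y = s *! x"
    by (auto simp: vdvd_iff)
  have D: "r \<in> D" "s \<in> D" using r s VR_D by auto
  show "vabs M x = vabs M y"
  proof (cases "x = 0!")
    case True
    hence "y = 0!" using s D by simp
    thus ?thesis using True by simp
  next
    case False
    have "(r *! s) *! x = x" using r(2) s(2) D assms by (metis R.m_assoc)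
    hence rs: "r *! s = 1!"
      using False R.m_rcancel[of x "r *! s" "1!"] D assms by simp
    have sub: "vabs M (t *! z) \<subseteq> vabs M z" if t: "t \<in> Uts" "z \<in> D" for t z
    proof
      fix w assume "w \<in> vabs M (t *! z)"
      then obtain u where u: "u \<in> Uts" "w = u *! (t *! z)" by (auto simp: vabs_eq)
      have uD: "u \<in> VR M" "t \<in> VR M" "u \<in> D" "t \<in> D" using u that VR_D by (auto simp: Units_val_ring)
      obtain u' where "u' \<in> VR M" "u' *! u = 1!" using u by (auto simp: Units_val_ring)
      moreover obtain t' where "t' \<in> VR M" "t' *! t = 1!" using t by (auto simp: Units_val_ring)
      ultimately have i: "u' \<in> VR M" "u' *! u = 1!" "t' \<in> VR M" "t' *! t = 1!" .
      have iD: "u' \<in> D" "t' \<in> D" using i VR_D by auto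
      have "(t' *! u') *! (u *! t) = t' *! ((u' *! u) *! t)"
        using iD uD by (simp add: R.m_assoc)
      also have "\<dots> = 1!" using i uD by simp
      finally have "u *! t \<in> Uts"
        using uD i by (auto simp: Units_val_ring intro!: bexI[of _ "t' *! u'"])
      moreover have "w = (u *! t) *! z" using u uD that by (simp add: R.m_assoc)
      ultimately show "w \<in> vabs M z" by (auto simp: vabs_eq)
    qed
    have "s *! r = 1!" using rs D by (simp add: R.m_comm)
    hence "r \<in> Uts" "s \<in> Uts" unfolding Units_val_ring using r(1) s(1) rs by blast+
    hence "vabs M (r *! y) \<subseteq> vabs M y" "vabs M (s *! x) \<subseteq> vabs M x" using sub assms by blast+
    thus ?thesis unfolding r(2)[symmetric] s(2)[symmetric] by (rule equalityI)
  qed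
qed

lemma vless_iff:
  assumes "x \<in> D" "y \<in> D"
  shows "vless M (vabs M x) (vabs M y) \<longleftrightarrow> \<not> vdvd M y x"
  unfolding vless_def vle_iff[OF assms] vabs_eq_iff[OF assms] using vdvd_total[OF assms] by blast

lemma oball_eq: "l \<in> D \<Longrightarrow> oball M (vabs M l) = {b \<in> D. \<not> vdvd M l b}"
  by (auto simp: oball_def vless_iff)

lemma vone_eq: "vone M = vabs M 1!"
  by (simp add: vone_def)

lemma rv_eq:
  assumes l: "l \<in> levels" and y: "y \<in> D"
  shows "rv M (vabs M l) y = {x \<in> D. rveq M l x y}"
proof (cases "y = 0!")
  case True
  thus ?thesis using small_zero[OF l] by (auto simp: rv_def rveq_mult_iff)
next
  case False
  thus ?thesis
    using y levelsD[OF l]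
    by (auto simp: rv_def rv_kernel_def r_coset_def oball_eq rveq_mult_iff)
qed

lemma rv_eq_iff:
  assumes "l \<in> levels" "x \<in> D" "y \<in> D"
  shows "rv M (vabs M l) x = rv M (vabs M l) y \<longleftrightarrow> rveq M l x y"
  unfolding rv_eq[OF assms(1,2)] rv_eq[OF assms(1,3)]
  using rveq_refl[OF assms(1,2)] rveq_sym[OF assms(1)] rveq_trans[OF assms(1)] assms by blast

lemma mem_rv_iff:
  assumes "l \<in> levels" "x \<in> D" "y \<in> D"
  shows "x \<in> rv M (vabs M l) y \<longleftrightarrow> rv M (vabs M l) x = rv M (vabs M l) y"
  using rv_eq_iff[OF assms] rv_eq[OF assms(1,3)] assms by auto

lemma RV_eq:
  assumes "l \<in> levels"
  shows "RV M (vabs M l) = rv M (vabs M l) ` D"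
proof -
  have "carrier (mult_of (Rng M) Mod rv_kernel M (vabs M l)) = rv M (vabs M l) ` (D - {0!})"
    by (auto simp: FactGroup_def RCOSETS_def rv_def)
  moreover have "{0!} = rv M (vabs M l) 0!" by (simp add: rv_def)
  moreover have "D = insert 0! (D - {0!})" by auto
  ultimately show ?thesis unfolding RV_def by (metis Un_insert_right image_insert sup_bot_right)
qed

lemma value_group_le_one_iff:
  "lam \<in> carrier (value_group M) \<and> vle M lam (vone M) \<longleftrightarrow> (\<exists>l\<in>levels. lam = vabs M l)"
proof -
  have "carrier (value_group M) = vabs M ` (D - {0!})"
    by (auto simp: value_group_def FactGroup_def RCOSETS_def vabs_def r_coset_def)
  thus ?thesis
    by (auto simp: levels_def vone_eq vle_iff vdvd_one_iff VR_D)
qed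

lemma ideal_max: "ideal (oball M (vone M)) (val_ring M)"
proof -
  interpret V: ring "val_ring M"
    unfolding val_ring_def by (rule R.subring_is_ring[OF VR_subring])
  have I: "oball M (vone M) = {b \<in> D. \<not> vdvd M 1! b}"
    by (simp add: vone_eq oball_eq)
  have sub: "\<ominus>\<^bsub>val_ring M\<^esub> x = \<ominus>\<^bsub>Rng M\<^esub> x" if "x \<in> VR M" for x
  proof -
    have "\<ominus>\<^bsub>Rng M\<^esub> x \<in> carrier (val_ring M)" "x \<in> carrier (val_ring M)"
      using that by (simp_all add: val_ring_def)
    moreover have "\<ominus>\<^bsub>Rng M\<^esub> x \<oplus>\<^bsub>val_ring M\<^esub> x = \<zero>\<^bsub>val_ring M\<^esub>"
      using that VR_D by (simp add: val_ring_def R.l_neg)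
    ultimately show ?thesis by (metis V.minus_equality)
  qed
  have VRI: "x \<in> VR M" if "x \<in> oball M (vone M)" for x
    using that small_VR[OF one_level] by (auto simp: I)
  show ?thesis
  proof (rule idealI)
    show "ring (val_ring M)" by (rule V.ring_axioms)
    show "subgroup (oball M (vone M)) (add_monoid (val_ring M))"
    proof (rule V.add.subgroupI)
      show "oball M (vone M) \<subseteq> carrier (val_ring M)" using VRI by (auto simp: val_ring_def)
      show "oball M (vone M) \<noteq> {}" using small_zero[OF one_level] I by blast
      fix a b assume a: "a \<in> oball M (vone M)"
      show "\<ominus>\<^bsub>val_ring M\<^esub> a \<in> oball M (vone M)"
        using a sub[OF VRI[OF a]] small_minus by (auto simp: I)
      assume "b \<in> oball M (vone M)"
      thus "a \<oplus>\<^bsub>val_ring M\<^esub> b \<in> oball M (vone M)"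
        using a small_add by (auto simp: I val_ring_def)
    qed
    fix a x assume "a \<in> oball M (vone M)" "x \<in> carrier (val_ring M)"
    thus "x \<otimes>\<^bsub>val_ring M\<^esub> a \<in> oball M (vone M)" "a \<otimes>\<^bsub>val_ring M\<^esub> x \<in> oball M (vone M)"
      using small_mult[of "1!" a x] by (auto simp: I val_ring_def VR_D R.m_comm)
  qed
qed

text \<open>Characteristic 0 of the residue field means that no positive multiple of 1 lies in the
  maximal ideal. As 0 does lie in it, the field itself then has characteristic 0. This form is one
  sentence for each \<open>n\<close>.\<close>

lemma equichar_0_iff: "equichar_0 M \<longleftrightarrow> (\<forall>n::nat. n > 0 \<longrightarrow> vdvd M 1! ([n] \<cdot>\<^bsub>Rng M\<^esub> 1!))"
proof -
  let ?I = "oball M (vone M)" and ?Q = "val_ring M Quot oball M (vone M)"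
  interpret I: ideal ?I "val_ring M" by (rule ideal_max)
  have closed: "[n] \<cdot>\<^bsub>Rng M\<^esub> 1! \<in> VR M" for n :: nat
    by (induction n) (simp_all add: add_pow_def)
  have pow: "[n] \<cdot>\<^bsub>?Q\<^esub> \<one>\<^bsub>?Q\<^esub> = ?I +>\<^bsub>val_ring M\<^esub> ([n] \<cdot>\<^bsub>Rng M\<^esub> 1!)" for n :: nat
  proof (induction n)
    case 0
    have "?I +>\<^bsub>val_ring M\<^esub> \<zero>\<^bsub>val_ring M\<^esub> = ?I"
      by (rule I.a_rcos_zero[OF ideal_max additive_subgroup.zero_closed[OF ideal.axioms(1)[OF ideal_max]]])
    thus ?case by (simp add: add_pow_def FactRing_def val_ring_def)
  next
    case (Suc n)
    have "[Suc n] \<cdot>\<^bsub>?Q\<^esub> \<one>\<^bsub>?Q\<^esub> = [n] \<cdot>\<^bsub>?Q\<^esub> \<one>\<^bsub>?Q\<^esub> \<oplus>\<^bsub>?Q\<^esub> \<one>\<^bsub>?Q\<^esub>"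
      by (simp add: add_pow_def)
    also have "\<dots> = (?I +>\<^bsub>val_ring M\<^esub> ([n] \<cdot>\<^bsub>Rng M\<^esub> 1!)) \<oplus>\<^bsub>?Q\<^esub> (?I +>\<^bsub>val_ring M\<^esub> 1!)"
      unfolding Suc by (simp add: FactRing_def val_ring_def)
    also have "\<dots> = ?I +>\<^bsub>val_ring M\<^esub> ([n] \<cdot>\<^bsub>Rng M\<^esub> 1! \<oplus>\<^bsub>val_ring M\<^esub> 1!)"
      by (rule ring_hom_add[OF I.rcos_ring_hom, symmetric]) (simp_all add: val_ring_def closed)
    also have "[n] \<cdot>\<^bsub>Rng M\<^esub> 1! \<oplus>\<^bsub>val_ring M\<^esub> 1! = [Suc n] \<cdot>\<^bsub>Rng M\<^esub> 1!"
      by (simp add: add_pow_def val_ring_def)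
    finally show ?case .
  qed
  have "?I +>\<^bsub>val_ring M\<^esub> x = ?I \<longleftrightarrow> \<not> vdvd M 1! x" if "x \<in> VR M" for x
  proof -
    have "?I +>\<^bsub>val_ring M\<^esub> x = ?I \<longleftrightarrow> x \<in> ?I"
      using I.rcos_const_imp_mem[of x] I.a_rcos_zero[OF ideal_max] that by (auto simp: val_ring_def)
    thus ?thesis using that by (simp add: vone_eq oball_eq VR_D)
  qed
  hence "char_0 ?Q \<longleftrightarrow> (\<forall>n::nat. n > 0 \<longrightarrow> vdvd M 1! ([n] \<cdot>\<^bsub>Rng M\<^esub> 1!))"
    unfolding char_0_def pow using closed by (simp add: FactRing_def)
  moreover have "\<not> vdvd M 1! 0!" by (simp add: vdvd_zero_iff)
  ultimately show ?thesis unfolding equichar_0_def char_0_def by metis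
qed

lemma prepares_iff:
  assumes "l \<in> levels"
  shows "prepares M (vabs M l) C X \<longleftrightarrow> finite C \<and> C \<noteq> {} \<and> C \<subseteq> D \<and>
    (\<forall>x\<in>D. \<forall>x'\<in>D. (\<forall>c\<in>C. rveq M l (x -! c) (x' -! c)) \<longrightarrow> (x \<in> X \<longleftrightarrow> x' \<in> X))"
proof (cases "C \<subseteq> D")
  case True
  hence "rv M (vabs M l) (x -! c) = rv M (vabs M l) (x' -! c) \<longleftrightarrow> rveq M l (x -! c) (x' -! c)"
    if "x \<in> D" "x' \<in> D" "c \<in> C" for x x' c
    using that by (intro rv_eq_iff assms) auto
  thus ?thesis unfolding prepares_def by auto
qed (auto simp: prepares_def)

end

section \<open>First-order axioms of valued fields\<close>

abbreviation (input) All_fm :: "('f, 'p) fm \<Rightarrow> ('f, 'p) fm" where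
  "All_fm \<phi> \<equiv> Neg (Exi (Neg \<phi>))"

abbreviation (input) Or_fm :: "('f, 'p) fm \<Rightarrow> ('f, 'p) fm \<Rightarrow> ('f, 'p) fm" where
  "Or_fm \<phi> \<psi> \<equiv> Neg (Conj (Neg \<phi>) (Neg \<psi>))"

text \<open>Variable 0 stands for \<open>1\<close> and variable 1 for \<open>0\<close>.\<close>

definition vf_axioms :: "('f, 'p) vfm" where
  "vf_axioms = (let pl = (\<lambda>s t. App Plus [s, t]); ti = (\<lambda>s t. App Times [s, t]);
       v = (\<lambda>t. Rel ValRing [t]); x0 = Var 0; x1 = Var 1; x2 = Var 2; x3 = Var 3
     in foldr Conj
       [Neg (Eq x0 x1),
        All_fm (Eq (pl x2 x0) x0),
        All_fm (Exi (Eq (pl x0 x1) x3)),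
        All_fm (All_fm (Eq (pl x0 x1) (pl x1 x0))),
        All_fm (All_fm (All_fm (Eq (pl (pl x0 x1) x2) (pl x0 (pl x1 x2))))),
        All_fm (Eq (ti x1 x0) x0),
        All_fm (All_fm (Eq (ti x0 x1) (ti x1 x0))),
        All_fm (All_fm (All_fm (Eq (ti (ti x0 x1) x2) (ti x0 (ti x1 x2))))),
        All_fm (All_fm (All_fm (Eq (ti (pl x0 x1) x2) (pl (ti x0 x2) (ti x1 x2))))),
        All_fm (Or_fm (Eq x0 x2) (Exi (Eq (ti x0 x1) x2))),
        v x0,
        All_fm (Or_fm (Neg (v x0)) (Exi (Conj (v x0) (Eq (pl x0 x1) x3)))),
        All_fm (All_fm (Or_fm (Neg (Conj (v x0) (v x1))) (Conj (v (pl x0 x1)) (v (ti x0 x1))))),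
        Exi (Neg (v x0)),
        All_fm (Or_fm (Eq x0 x2) (Or_fm (v x0) (Exi (Conj (v x0) (Eq (ti x0 x1) x2)))))]
       (Eq x0 x0))"

lemma wf_vf_axioms: "contains_vf L \<Longrightarrow> wf_fm L 0 (Exi (Exi vf_axioms))"
  by (simp add: vf_axioms_def Let_def contains_vf_def)

lemma sat_vf_axioms:
  "sat M [u, z] vf_axioms \<longleftrightarrow> (let D = dom_of M; pl = (\<lambda>x y. fun_of M Plus [x, y]);
     ti = (\<lambda>x y. fun_of M Times [x, y]); V = (\<lambda>x. rel_of M ValRing [x]) in
     u \<noteq> z \<and> (\<forall>x\<in>D. pl z x = x) \<and> (\<forall>x\<in>D. \<exists>y\<in>D. pl y x = z) \<and> (\<forall>x\<in>D. \<forall>y\<in>D. pl y x = pl x y) \<and>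
     (\<forall>x\<in>D. \<forall>y\<in>D. \<forall>w\<in>D. pl (pl w y) x = pl w (pl y x)) \<and> (\<forall>x\<in>D. ti u x = x) \<and>
     (\<forall>x\<in>D. \<forall>y\<in>D. ti y x = ti x y) \<and> (\<forall>x\<in>D. \<forall>y\<in>D. \<forall>w\<in>D. ti (ti w y) x = ti w (ti y x)) \<and>
     (\<forall>x\<in>D. \<forall>y\<in>D. \<forall>w\<in>D. ti (pl w y) x = pl (ti w x) (ti y x)) \<and>
     (\<forall>x\<in>D. x = z \<or> (\<exists>y\<in>D. ti y x = u)) \<and> V u \<and> (\<forall>x\<in>D. V x \<longrightarrow> (\<exists>y\<in>D. V y \<and> pl y x = z)) \<and>
     (\<forall>x\<in>D. V x \<longrightarrow> (\<forall>y\<in>D. V y \<longrightarrow> V (pl y x) \<and> V (ti y x))) \<and> (\<exists>x\<in>D. \<not> V x) \<and>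
     (\<forall>x\<in>D. x = z \<or> V x \<or> (\<exists>y\<in>D. V y \<and> ti y x = u)))"
  by (simp add: vf_axioms_def Let_def numeral_eq_Suc)

text \<open>\<open>Rng\<close> obtains 0 and 1 by description. In the converse direction the two
  witnesses of the sentence are identified with them before the field laws can be read off.\<close>

lemma valued_field_iff:
  assumes L: "contains_vf L" and M: "is_struct L M"
  shows "valued_field M \<longleftrightarrow> sat M [] (Exi (Exi vf_axioms))"
proof
  assume "valued_field M"
  then interpret vfield M by unfold_locales
  have "sat M [1!, 0!] vf_axioms"
    unfolding sat_vf_axioms Let_def fun_of_Plus fun_of_Times
  proof (intro conjI ballI impI)
    show "1! \<noteq> 0!" by simp
    fix x assume x: "x \<in> D"
    show "\<exists>y\<in>D. y +! x = 0!" using x R.l_neg by blast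
    show "x = 0! \<or> (\<exists>y\<in>D. y *! x = 1!)" using x field_inv by blast
    show "x = 0! \<or> rel_of M ValRing [x] \<or> (\<exists>y\<in>D. rel_of M ValRing [y] \<and> y *! x = 1!)"
      using VR_total[OF x] field_inv[OF x] by (auto simp: VR_def)
    show "\<exists>y\<in>D. rel_of M ValRing [y] \<and> y +! x = 0!" if "rel_of M ValRing [x]"
      using VR_closed(3)[of x] x that R.l_neg[OF x] by (auto simp: VR_def)
    fix y assume y: "y \<in> D"
    show "rel_of M ValRing [y +! x]" "rel_of M ValRing [y *! x]" if "rel_of M ValRing [x]" "rel_of M ValRing [y]"
      using VR_closed(4,5)[of y x] x y that by (auto simp: VR_def)
  next
    show "\<exists>x\<in>D. \<not> rel_of M ValRing [x]" using vf by (auto simp: valued_field_def VR_def)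
    show "rel_of M ValRing [1!]" using VR_closed(2) by (simp add: VR_def)
  qed (simp_all add: R.a_ac R.m_ac R.l_distr R.r_distr)
  thus "sat M [] (Exi (Exi vf_axioms))" by auto
next
  assume "sat M [] (Exi (Exi vf_axioms))"
  then obtain u z where uz: "u \<in> dom_of M" "z \<in> dom_of M" and ax: "sat M [u, z] vf_axioms" by auto
  define pl where "pl x y = fun_of M Plus [x, y]" for x y
  define ti where "ti x y = fun_of M Times [x, y]" for x y
  define D where "D = dom_of M"
  define V where "V x = rel_of M ValRing [x]" for x
  note ax = ax[unfolded sat_vf_axioms Let_def, folded pl_def ti_def D_def V_def]
  from ax have
    ne: "u \<noteq> z"
    and p0: "\<forall>x\<in>D. pl z x = x"
    and pn: "\<forall>x\<in>D. \<exists>y\<in>D. pl y x = z"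
    and pc: "\<forall>x\<in>D. \<forall>y\<in>D. pl y x = pl x y"
    and pa: "\<forall>x\<in>D. \<forall>y\<in>D. \<forall>w\<in>D. pl (pl w y) x = pl w (pl y x)"
    and t1: "\<forall>x\<in>D. ti u x = x"
    and tc: "\<forall>x\<in>D. \<forall>y\<in>D. ti y x = ti x y"
    and ta: "\<forall>x\<in>D. \<forall>y\<in>D. \<forall>w\<in>D. ti (ti w y) x = ti w (ti y x)"
    and ds: "\<forall>x\<in>D. \<forall>y\<in>D. \<forall>w\<in>D. ti (pl w y) x = pl (ti w x) (ti y x)"
    and tn: "\<forall>x\<in>D. x = z \<or> (\<exists>y\<in>D. ti y x = u)"
    and V1: "V u"
    and Vn: "\<forall>x\<in>D. V x \<longrightarrow> (\<exists>y\<in>D. V y \<and> pl y x = z)"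
    and Vc: "\<forall>x\<in>D. V x \<longrightarrow> (\<forall>y\<in>D. V y \<longrightarrow> V (pl y x) \<and> V (ti y x))"
    and Vne: "\<exists>x\<in>D. \<not> V x"
    and Vt: "\<forall>x\<in>D. x = z \<or> V x \<or> (\<exists>y\<in>D. V y \<and> ti y x = u)"
    by - (elim conjE, assumption)+
  note p0 = p0[rule_format] and pn = pn[rule_format] and pc = pc[rule_format] and pa = pa[rule_format]
    and t1 = t1[rule_format] and tc = tc[rule_format] and ta = ta[rule_format] and ds = ds[rule_format]
  have VR: "VR M = {x \<in> D. V x}" by (simp add: VR_def V_def D_def)
  have cl: "pl x y \<in> D" "ti x y \<in> D" if "x \<in> D" "y \<in> D" for x y
    using M L that by (auto simp: pl_def ti_def D_def is_struct_def contains_vf_def tuples_def)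
  have uz': "u \<in> D" "z \<in> D" using uz by (simp_all add: D_def)
  have "(THE e. e \<in> D \<and> (\<forall>x\<in>D. ti e x = x \<and> ti x e = x)) = u"
    using uz' t1 tc by (intro the_equality) metis+
  moreover have "(THE e. e \<in> D \<and> (\<forall>x\<in>D. pl e x = x \<and> pl x e = x)) = z"
    using uz' p0 pc by (intro the_equality) metis+
  ultimately have Rng: "Rng M = \<lparr>carrier = D, mult = ti, one = u, zero = z, add = pl\<rparr>"
    by (simp add: Rng_def Let_def pl_def[symmetric] ti_def[symmetric] D_def[symmetric])
  interpret cring "Rng M"
  proof (rule cringI)
    show "abelian_group (Rng M)"
      by (rule abelian_groupI) (use cl uz' p0 pn pa in \<open>auto simp: Rng intro: pc\<close>)
    show "Group.comm_monoid (Rng M)"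
      by (rule comm_monoidI) (use cl uz' t1 ta in \<open>auto simp: Rng intro: tc\<close>)
  qed (use ds in \<open>auto simp: Rng\<close>)
  have carr: "carrier (Rng M) = D" by (simp add: Rng)
  have ops: "x \<oplus>\<^bsub>Rng M\<^esub> y = pl x y" "x \<otimes>\<^bsub>Rng M\<^esub> y = ti x y" "\<one>\<^bsub>Rng M\<^esub> = u" "\<zero>\<^bsub>Rng M\<^esub> = z" for x y
    by (simp_all add: Rng)
  have field: "field (Rng M)"
  proof (rule cring_fieldI2)
    show "\<zero>\<^bsub>Rng M\<^esub> \<noteq> \<one>\<^bsub>Rng M\<^esub>" using ne by (simp add: ops)
    fix a assume "a \<in> carrier (Rng M)" "a \<noteq> \<zero>\<^bsub>Rng M\<^esub>"
    hence a: "a \<in> D" "a \<noteq> z" by (simp_all add: carr ops)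
    then obtain b where b: "b \<in> D" "ti b a = u" using tn by blast
    hence "ti a b = u" using tc[of b a] a by simp
    thus "\<exists>b\<in>carrier (Rng M). a \<otimes>\<^bsub>Rng M\<^esub> b = \<one>\<^bsub>Rng M\<^esub>" using b by (auto simp: carr ops)
  qed
  have VR_D: "x \<in> VR M \<Longrightarrow> x \<in> D" for x by (simp add: VR_def D_def)
  have "subring (VR M) (Rng M)"
  proof (rule subringI)
    show "VR M \<subseteq> carrier (Rng M)" using VR_D carr by blast
    show "\<one>\<^bsub>Rng M\<^esub> \<in> VR M" using V1 uz' by (simp add: ops VR)
    fix x assume x: "x \<in> VR M"
    then obtain y where y: "y \<in> VR M" "pl y x = z"
      using Vn unfolding VR by blast
    hence "\<ominus>\<^bsub>Rng M\<^esub> x = y"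
      using x VR_D carr by (intro minus_equality) (auto simp: ops)
    thus "\<ominus>\<^bsub>Rng M\<^esub> x \<in> VR M" using y by simp
    fix y assume "y \<in> VR M"
    thus "x \<otimes>\<^bsub>Rng M\<^esub> y \<in> VR M" "x \<oplus>\<^bsub>Rng M\<^esub> y \<in> VR M"
      using Vc x cl unfolding ops VR by blast+
  qed
  moreover have "VR M \<noteq> dom_of M" using Vne unfolding VR D_def by blast
  moreover have "x \<in> VR M \<or> inv\<^bsub>Rng M\<^esub> x \<in> VR M" if x: "x \<in> dom_of M - {\<zero>\<^bsub>Rng M\<^esub>}" for x
  proof (cases "x \<in> VR M")
    case False
    then obtain y where y: "y \<in> VR M" "ti y x = u"
      using Vt x unfolding VR ops D_def by blast
    have "inv\<^bsub>Rng M\<^esub> x = y"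
      using that y VR_D tc by (intro comm_inv_char) (auto simp: carr ops D_def)
    thus ?thesis using y by simp
  qed simp
  ultimately show "valued_field M" using field unfolding valued_field_def by blast
qed

text \<open>0 and 1 are not symbols of the language; they are singled out as the additive idempotent
  and the non-zero multiplicative idempotent.\<close>

definition is_zero :: "('a, 'f, 'p) vstruct \<Rightarrow> 'a \<Rightarrow> bool" where
  "is_zero M x \<longleftrightarrow> fun_of M Plus [x, x] = x"

definition is_one :: "('a, 'f, 'p) vstruct \<Rightarrow> 'a \<Rightarrow> bool" where
  "is_one M x \<longleftrightarrow> fun_of M Times [x, x] = x \<and> \<not> is_zero M x"

definition level :: "('a, 'f, 'p) vstruct \<Rightarrow> 'a \<Rightarrow> bool" where
  "level M x \<longleftrightarrow> rel_of M ValRing [x] \<and> \<not> is_zero M x"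

text \<open>Equality of leading terms of \<open>x\<close> minus \<open>c\<close> and
  \<open>y\<close> minus \<open>c\<close>, with subtraction written through sums because only
  addition is a symbol.\<close>

definition rveqd :: "('a, 'f, 'p) vstruct \<Rightarrow> 'a \<Rightarrow> 'a \<Rightarrow> 'a \<Rightarrow> 'a \<Rightarrow> bool" where
  "rveqd M l x y c \<longleftrightarrow> (\<exists>d\<in>dom_of M. \<exists>d'\<in>dom_of M. fun_of M Plus [d, c] = x \<and> fun_of M Plus [d', c] = y \<and> rveq M l d d')"

text \<open>\<open>rv1 M x y\<close> says \<open>rv x = rv y\<close>.\<close>

definition rv1 :: "('a, 'f, 'p) vstruct \<Rightarrow> 'a \<Rightarrow> 'a \<Rightarrow> bool" where
  "rv1 M x y \<longleftrightarrow> (\<exists>u\<in>dom_of M. is_one M u \<and> rveq M u x y)"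

context vfield
begin

lemma multiple_Suc: "[Suc k] \<cdot>\<^bsub>Rng M\<^esub> x = [k] \<cdot>\<^bsub>Rng M\<^esub> x +! x" for k :: nat
  by (simp add: add_pow_def)

lemma multiple_closed: "x \<in> D \<Longrightarrow> [k] \<cdot>\<^bsub>Rng M\<^esub> x \<in> D" for k :: nat
proof (induction k)
  case 0 thus ?case by (simp add: add_pow_def)
next
  case (Suc k) thus ?case by (simp add: multiple_Suc)
qed

lemma is_zero_iff: "x \<in> D \<Longrightarrow> is_zero M x \<longleftrightarrow> x = 0!"
  unfolding is_zero_def fun_of_Plus by (metis R.add.r_cancel_one)

lemma is_one_iff: "x \<in> D \<Longrightarrow> is_one M x \<longleftrightarrow> x = 1!"
  unfolding is_one_def fun_of_Times using is_zero_iff R.m_lcancel[of x x "1!"] by auto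

lemma level_iff: "x \<in> D \<Longrightarrow> level M x \<longleftrightarrow> x \<in> levels"
  by (auto simp: level_def levels_def is_zero_iff VR_def)

lemma plus_eq_diff_iff:
  assumes "d \<in> D" "c \<in> D" "x \<in> D"
  shows "d +! c = x \<longleftrightarrow> d = x -! c"
proof -
  have "d +! c -! c = d" "x -! c +! c = x"
    using assms by (simp_all add: R.minus_eq R.a_assoc R.r_neg R.l_neg)
  thus ?thesis by auto
qed

lemma rveqd_iff:
  assumes "x \<in> D" "y \<in> D" "c \<in> D"
  shows "rveqd M l x y c \<longleftrightarrow> rveq M l (x -! c) (y -! c)"
  unfolding rveqd_def fun_of_Plus using assms by (auto simp: plus_eq_diff_iff)

lemma rv1_iff: "x \<in> D \<Longrightarrow> y \<in> D \<Longrightarrow> rv1 M x y \<longleftrightarrow> rveq M 1! x y"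
  by (auto simp: rv1_def is_one_iff)

lemma rv1_rv: "x \<in> D \<Longrightarrow> y \<in> D \<Longrightarrow> rv1 M x y \<longleftrightarrow> rv M (vone M) x = rv M (vone M) y"
  by (simp add: rv1_iff vone_eq rv_eq_iff one_level)

end

lemma covar_tl:
  assumes "covar n u v"
  shows "covar (Suc n) (\<lambda>e. u (tl e)) (\<lambda>e. v (tl e))"
proof -
  obtain i where "i < n" "\<forall>e. length e = n \<longrightarrow> u e = e ! i" "\<forall>e. length e = n \<longrightarrow> v e = e ! i"
    using assms unfolding covar_def by blast
  thus ?thesis unfolding covar_def by (intro exI[of _ "Suc i"]) (auto simp: nth_tl)
qed

locale vlang =
  fixes L :: "('f, 'p) vlang"
  assumes vf: "contains_vf L"
begin

lemma codef_ValRing: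
  assumes "covar n u u'"
  shows "codef L M N n (\<lambda>e. rel_of M ValRing [u e]) (\<lambda>e. rel_of N ValRing [u' e])"
  by (rule codef_rel[of L _ 1]) (use vf assms in \<open>auto simp: contains_vf_def intro!: cosel_intros\<close>)

lemma codef_Plus:
  assumes "covar n u u'" "covar n v v'" "covar n w w'"
  shows "codef L M N n (\<lambda>e. fun_of M Plus [u e, v e] = w e) (\<lambda>e. fun_of N Plus [u' e, v' e] = w' e)"
  by (rule codef_fun[of L _ 2]) (use vf assms in \<open>auto simp: contains_vf_def intro!: cosel_intros\<close>)

lemma codef_Times:
  assumes "covar n u u'" "covar n v v'" "covar n w w'"
  shows "codef L M N n (\<lambda>e. fun_of M Times [u e, v e] = w e) (\<lambda>e. fun_of N Times [u' e, v' e] = w' e)"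
  by (rule codef_fun[of L _ 2]) (use vf assms in \<open>auto simp: contains_vf_def intro!: cosel_intros\<close>)

lemma codef_vdvd:
  assumes "covar n u u'" "covar n v v'"
  shows "codef L M N n (\<lambda>e. vdvd M (u e) (v e)) (\<lambda>e. vdvd N (u' e) (v' e))"
proof -
  have "codef L M N n (\<lambda>e. \<exists>r\<in>dom_of M. rel_of M ValRing [r] \<and> fun_of M Times [r, v e] = u e)
    (\<lambda>e. \<exists>r\<in>dom_of N. rel_of N ValRing [r] \<and> fun_of N Times [r, v' e] = u' e)"
    by (intro codef_ex codef_conj codef_ValRing codef_Times covar_tl assms covar_hd cosel_id) auto
  thus ?thesis by (simp add: vdvd_def VR_def Bex_def conj_assoc)
qed

lemma codef_rveq:
  assumes "covar n l l'" "covar n u u'" "covar n v v'"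
  shows "codef L M N n (\<lambda>e. rveq M (l e) (u e) (v e)) (\<lambda>e. rveq N (l' e) (u' e) (v' e))"
  unfolding rveq_def
  by (intro codef_ex codef_conj codef_not codef_vdvd codef_Plus codef_Times covar_tl assms covar_hd cosel_id) auto

lemma codef_rveqd:
  assumes "covar n l l'" "covar n u u'" "covar n v v'" "covar n c c'"
  shows "codef L M N n (\<lambda>e. rveqd M (l e) (u e) (v e) (c e)) (\<lambda>e. rveqd N (l' e) (u' e) (v' e) (c' e))"
  unfolding rveqd_def
  by (intro codef_ex codef_conj codef_rveq codef_Plus covar_tl assms covar_hd cosel_id) auto

lemma codef_is_zero:
  assumes "covar n u u'"
  shows "codef L M N n (\<lambda>e. is_zero M (u e)) (\<lambda>e. is_zero N (u' e))"
  unfolding is_zero_def by (intro codef_Plus assms)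

lemma codef_is_one:
  assumes "covar n u u'"
  shows "codef L M N n (\<lambda>e. is_one M (u e)) (\<lambda>e. is_one N (u' e))"
  unfolding is_one_def by (intro codef_conj codef_not codef_Times codef_is_zero assms)

lemma codef_level:
  assumes "covar n u u'"
  shows "codef L M N n (\<lambda>e. level M (u e)) (\<lambda>e. level N (u' e))"
  unfolding level_def by (intro codef_conj codef_not codef_ValRing codef_is_zero assms)

lemma codef_rv1:
  assumes "covar n u u'" "covar n v v'"
  shows "codef L M N n (\<lambda>e. rv1 M (u e) (v e)) (\<lambda>e. rv1 N (u' e) (v' e))"
  unfolding rv1_def
  by (intro codef_ex codef_conj codef_rveq codef_is_one covar_tl assms covar_hd cosel_id) auto

lemma codef_multiple:
  fixes k :: nat
  assumes "vfield M" "vfield N"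
  shows "codef L M N 2 (\<lambda>e. [k] \<cdot>\<^bsub>Rng M\<^esub> (e ! 1) = e ! 0) (\<lambda>e. [k] \<cdot>\<^bsub>Rng N\<^esub> (e ! 1) = e ! 0)"
proof (induction k)
  case 0
  interpret M: vfield M by fact
  interpret N: vfield N by fact
  have "codef L M N 2 (\<lambda>e. is_zero M (e ! 0)) (\<lambda>e. is_zero N (e ! 0))"
    by (intro codef_is_zero covar_nth cosel_id) auto
  thus ?case
    by (rule codef_cong) (auto simp: M.is_zero_iff N.is_zero_iff tuples_nth add_pow_def)
next
  case (Suc k)
  interpret M: vfield M by fact
  interpret N: vfield N by fact
  have "codef L M N 2
     (\<lambda>e. \<exists>t\<in>dom_of M. [k] \<cdot>\<^bsub>Rng M\<^esub> ([t, e ! 1] ! 1) = [t, e ! 1] ! 0 \<and> fun_of M Plus [t, e ! 1] = e ! 0)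
     (\<lambda>e. \<exists>t\<in>dom_of N. [k] \<cdot>\<^bsub>Rng N\<^esub> ([t, e ! 1] ! 1) = [t, e ! 1] ! 0 \<and> fun_of N Plus [t, e ! 1] = e ! 0)"
    by (intro codef_ex codef_conj codef_app[OF Suc] codef_Plus cosel_intros) auto
  thus ?case
    by (rule codef_cong)
      (auto simp: M.fun_of_Plus N.fun_of_Plus tuples_nth M.multiple_Suc N.multiple_Suc M.multiple_closed N.multiple_closed)
qed

text \<open>By \<open>equichar_0_iff\<close> the property is an infinite list of sentences, one for
  each multiple \<open>k\<close> of 1.\<close>

lemma equichar_0_transfer:
  assumes "valued_field M" "valued_field N" "equichar_0 M"
    and sat: "\<And>\<phi>. wf_fm L 0 \<phi> \<Longrightarrow> sat M [] \<phi> \<Longrightarrow> sat N [] \<phi>"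
  shows "equichar_0 N"
proof -
  interpret M: vfield M by unfold_locales fact
  interpret N: vfield N by unfold_locales fact
  have "vdvd N \<one>\<^bsub>Rng N\<^esub> ([k] \<cdot>\<^bsub>Rng N\<^esub> \<one>\<^bsub>Rng N\<^esub>)" if "k > 0" for k :: nat
  proof -
    have "codef L M N 0
      (\<lambda>e. \<exists>u\<in>dom_of M. \<exists>t\<in>dom_of M. is_one M u \<and> [k] \<cdot>\<^bsub>Rng M\<^esub> ([t, u] ! 1) = [t, u] ! 0 \<and> vdvd M u t)
      (\<lambda>e. \<exists>u\<in>dom_of N. \<exists>t\<in>dom_of N. is_one N u \<and> [k] \<cdot>\<^bsub>Rng N\<^esub> ([t, u] ! 1) = [t, u] ! 0 \<and> vdvd N u t)"
      by (intro codef_ex codef_conj codef_is_one codef_app[OF codef_multiple[OF M.vfield_axioms N.vfield_axioms]]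
          codef_vdvd cosel_intros) auto
    then obtain \<phi> where \<phi>: "wf_fm L 0 \<phi>"
      and M: "sat M [] \<phi> \<longleftrightarrow> (\<exists>u\<in>dom_of M. \<exists>t\<in>dom_of M. is_one M u \<and> [k] \<cdot>\<^bsub>Rng M\<^esub> u = t \<and> vdvd M u t)"
      and N: "sat N [] \<phi> \<longleftrightarrow> (\<exists>u\<in>dom_of N. \<exists>t\<in>dom_of N. is_one N u \<and> [k] \<cdot>\<^bsub>Rng N\<^esub> u = t \<and> vdvd N u t)"
      unfolding codef_def by auto
    have "sat M [] \<phi>"
      unfolding M using assms(3) that M.multiple_closed
      by (intro bexI[of _ "\<one>\<^bsub>Rng M\<^esub>"] bexI[of _ "[k] \<cdot>\<^bsub>Rng M\<^esub> \<one>\<^bsub>Rng M\<^esub>"])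
        (auto simp: M.is_one_iff M.equichar_0_iff)
    hence "sat N [] \<phi>" using sat \<phi> by blast
    thus ?thesis unfolding N by (auto simp: N.is_one_iff)
  qed
  thus ?thesis by (simp add: N.equichar_0_iff)
qed

end

section \<open>Uniform preparation\<close>

lemma dom_struct_imag [simp]: "dom_of (struct_imag M) = dom_of M"
  by (simp add: struct_imag_def)

lemma sat_sentence: "wf_fm L 0 \<phi> \<Longrightarrow> sat M e \<phi> = sat M e' \<phi>"
  using sat_ren[of L 0 \<phi> e id "[]" M] sat_ren[of L 0 \<phi> e id e M] sat_ren[of L 0 \<phi> e' id "[]" M]
    sat_ren[of L 0 \<phi> e' id e' M] by simp

lemma covar_drop:
  assumes "covar n u v"
  shows "covar (k + n) (\<lambda>e. u (drop k e)) (\<lambda>e. v (drop k e))"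
proof -
  obtain i where "i < n" "\<forall>e. length e = n \<longrightarrow> u e = e ! i" "\<forall>e. length e = n \<longrightarrow> v e = e ! i"
    using assms unfolding covar_def by blast
  thus ?thesis unfolding covar_def by (intro exI[of _ "k + i"]) auto
qed

lemma sel_comp_drop: "sel n is p \<Longrightarrow> sel (k + n) (map ((+) k) is) (\<lambda>e. p (drop k e))"
  by (auto simp: sel_def subset_iff)

lemma cosel_comp_drop: "cosel n p q \<Longrightarrow> cosel (k + n) (\<lambda>e. p (drop k e)) (\<lambda>e. q (drop k e))"
  unfolding cosel_def by (elim exE conjE, rule exI, rule conjI; erule sel_comp_drop)

lemma cosel_comp_tl:
  assumes "cosel n p q"
  shows "cosel (Suc n) (\<lambda>e. p (tl e)) (\<lambda>e. q (tl e))"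
  using cosel_comp_drop[OF assms, of 1] by (simp add: drop_Suc)

text \<open>\<open>instances M m k \<phi> y l w \<xi>\<close> is the set defined by \<open>\<phi>\<close> over \<open>y\<close>, the classes of the
  \<open>w ! i\<close> at level \<open>l\<close> and the classes of the \<open>\<xi> ! i\<close> at level 1. The level itself is not a parameter;
  only its trace on the classes is, hence the quantifier over \<open>l'\<close>.\<close>

definition instances :: "('a, 'f, 'p) vstruct \<Rightarrow> nat \<Rightarrow> nat \<Rightarrow> ('f, 'p) vfm \<Rightarrow>
    'a list \<Rightarrow> 'a \<Rightarrow> 'a list \<Rightarrow> 'a list \<Rightarrow> 'a \<Rightarrow> bool" where
  "instances M m k \<phi> y l w \<xi> x \<longleftrightarrow> (\<exists>\<xi>'\<in>tuples k (dom_of M). \<exists>w'\<in>tuples m (dom_of M). \<exists>l'\<in>dom_of M.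
     level M l' \<and> (\<forall>i<m. \<forall>t\<in>dom_of M. rveq M l' t (w' ! i) \<longleftrightarrow> rveq M l t (w ! i)) \<and>
     (\<forall>i<k. rv1 M (\<xi>' ! i) (\<xi> ! i)) \<and> sat M (x # y @ l' # w' @ \<xi>') \<phi>)"

text \<open>The list \<open>cs\<close> may repeat entries and contain non-solutions, so it expresses
  an upper bound and not an exact number.\<close>

definition fm_bounded :: "('a, 'f, 'p) vstruct \<Rightarrow> ('f, 'p) vfm \<Rightarrow> nat \<Rightarrow> 'a list \<Rightarrow> bool" where
  "fm_bounded M \<psi> \<kappa> y \<longleftrightarrow> (\<exists>cs\<in>tuples \<kappa> (dom_of M). \<forall>x\<in>dom_of M. sat M (x # y) \<psi> \<longrightarrow> (\<exists>i<\<kappa>. x = cs ! i))"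

text \<open>The first-order form of preparation by the solution set of \<psi> over \<open>y\<close>.
  Finiteness of that set is not first-order, hence the explicit bound \<kappa>.\<close>

definition fm_prepares :: "('a, 'f, 'p) vstruct \<Rightarrow> nat \<Rightarrow> nat \<Rightarrow> ('f, 'p) vfm \<Rightarrow> ('f, 'p) vfm \<Rightarrow> nat \<Rightarrow>
    'a list \<Rightarrow> 'a \<Rightarrow> 'a list \<Rightarrow> 'a list \<Rightarrow> bool" where
  "fm_prepares M m k \<phi> \<psi> \<kappa> y l w \<xi> \<longleftrightarrow> fm_bounded M \<psi> \<kappa> y \<and> (\<exists>x\<in>dom_of M. sat M (x # y) \<psi>) \<and>
     (\<forall>x\<in>dom_of M. \<forall>x'\<in>dom_of M. (\<forall>c\<in>dom_of M. sat M (c # y) \<psi> \<longrightarrow> rveqd M l x x' c) \<longrightarrow>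
        (instances M m k \<phi> y l w \<xi> x \<longleftrightarrow> instances M m k \<phi> y l w \<xi> x'))"

lemma fm_bounded_iff:
  assumes "dom_of M \<noteq> {}"
  shows "fm_bounded M \<psi> \<kappa> y \<longleftrightarrow> finite {x \<in> dom_of M. sat M (x # y) \<psi>} \<and> card {x \<in> dom_of M. sat M (x # y) \<psi>} \<le> \<kappa>"
    (is "_ \<longleftrightarrow> finite ?C \<and> _")
proof
  assume "fm_bounded M \<psi> \<kappa> y"
  then obtain cs where cs: "length cs = \<kappa>" "?C \<subseteq> set cs"
    unfolding fm_bounded_def by (fastforce simp: tuples_def)
  thus "finite ?C \<and> card ?C \<le> \<kappa>"
    by (meson List.finite_set card_length card_mono dual_order.trans finite_subset order_refl)
next
  assume "finite ?C \<and> card ?C \<le> \<kappa>"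
  then obtain cs where "cs \<in> tuples \<kappa> (dom_of M)" "?C \<subseteq> set cs"
    using tuples_extend[of ?C \<kappa> "dom_of M"] assms by blast
  thus "fm_bounded M \<psi> \<kappa> y"
    unfolding fm_bounded_def by (intro bexI[of _ cs]) (auto simp: tuples_def subset_iff in_set_conv_nth)
qed

context vlang
begin

lemma codef_instances:
  fixes M :: "('a, 'f, 'p) vstruct" and y :: "'a list \<Rightarrow> 'a list"
  assumes \<phi>: "wf_fm L (Suc n + Suc m + k) \<phi>"
    and v: "covar n' x x'" "cosel n' y y'" "covar n' l l'" "cosel n' w w'" "cosel n' \<xi> \<xi>'"
    and len: "\<And>e :: 'a list. length e = n' \<Longrightarrow> length (y e) = n"
      "\<And>e :: 'a list. length e = n' \<Longrightarrow> length (w e) = m" "\<And>e :: 'a list. length e = n' \<Longrightarrow> length (\<xi> e) = k"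
  shows "codef L M N n' (\<lambda>e. instances M m k \<phi> (y e) (l e) (w e) (\<xi> e) (x e))
    (\<lambda>e. instances N m k \<phi> (y' e) (l' e) (w' e) (\<xi>' e) (x' e))"
  unfolding instances_def
proof (intro codef_exs codef_ex codef_conj codef_all_less codef_all codef_iff)
  let ?n = "Suc (m + (k + n'))"
  note sh = covar_tl covar_drop cosel_comp_tl cosel_comp_drop
  show "codef L M N ?n (\<lambda>e. level M (hd e)) (\<lambda>e. level N (hd e))"
    by (intro codef_level cosel_intros) auto
  fix i assume "i < m"
  thus "codef L M N (Suc ?n) (\<lambda>e. rveq M (hd (tl e)) (hd e) (take m (tl (tl e)) ! i))
      (\<lambda>e. rveq N (hd (tl e)) (hd e) (take m (tl (tl e)) ! i))"
    by (intro codef_rveq cosel_intros) auto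
  show "codef L M N (Suc ?n) (\<lambda>e. rveq M (l (drop k (drop m (tl (tl e))))) (hd e) (w (drop k (drop m (tl (tl e)))) ! i))
      (\<lambda>e. rveq N (l' (drop k (drop m (tl (tl e))))) (hd e) (w' (drop k (drop m (tl (tl e)))) ! i))"
    by (intro codef_rveq covar_hd covar_nth cosel_id sh v) (use \<open>i < m\<close> len in auto)
next
  let ?n = "Suc (m + (k + n'))"
  note sh = covar_tl covar_drop cosel_comp_tl cosel_comp_drop
  show "codef L M N ?n (\<lambda>e. rv1 M (take k (drop m (tl e)) ! i) (\<xi> (drop k (drop m (tl e))) ! i))
      (\<lambda>e. rv1 N (take k (drop m (tl e)) ! i) (\<xi>' (drop k (drop m (tl e))) ! i))" if "i < k" for i
    by (intro codef_rv1 covar_nth cosel_take cosel_drop cosel_tl cosel_id cosel_comp_tl cosel_comp_drop v)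
      (use that len in auto)
  have 1: "covar ?n (\<lambda>e. x (drop k (drop m (tl e)))) (\<lambda>e. x' (drop k (drop m (tl e))))"
    "cosel ?n (\<lambda>e. y (drop k (drop m (tl e)))) (\<lambda>e. y' (drop k (drop m (tl e))))"
    by (intro sh v)+
  show "codef L M N ?n
     (\<lambda>e. sat M (x (drop k (drop m (tl e))) # y (drop k (drop m (tl e))) @ hd e # take m (tl e) @ take k (drop m (tl e))) \<phi>)
     (\<lambda>e. sat N (x' (drop k (drop m (tl e))) # y' (drop k (drop m (tl e))) @ hd e # take m (tl e) @ take k (drop m (tl e))) \<phi>)"
    by (intro codef_sat[OF \<phi>] 1 cosel_Cons cosel_append covar_hd cosel_take cosel_drop cosel_tl cosel_id)
      (use len in auto)
qed

lemma codef_fm_bounded: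
  assumes \<psi>: "wf_fm L (Suc n) \<psi>"
  shows "codef L M N n (fm_bounded M \<psi> \<kappa>) (fm_bounded N \<psi> \<kappa>)"
  unfolding fm_bounded_def
  by (intro codef_exs codef_all codef_imp codef_ex_less codef_sat[OF \<psi>] codef_eq cosel_intros) auto

text \<open>The tuple \<open>e\<close> lists \<open>y\<close>, \<open>l\<close>, \<open>w\<close>
  and \<xi> in this order.\<close>

lemma codef_fm_prepares:
  fixes M :: "('a, 'f, 'p) vstruct" and N :: "('b, 'f, 'p) vstruct"
  assumes \<phi>: "wf_fm L (Suc n + Suc m + k) \<phi>" and \<psi>: "wf_fm L (Suc n) \<psi>"
  shows "codef L M N (n + Suc (m + k))
    (\<lambda>e. fm_prepares M m k \<phi> \<psi> \<kappa> (take n e) (e ! n) (take m (drop (Suc n) e)) (drop (Suc n + m) e))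
    (\<lambda>e. fm_prepares N m k \<phi> \<psi> \<kappa> (take n e) (e ! n) (take m (drop (Suc n) e)) (drop (Suc n + m) e))"
  unfolding fm_prepares_def
proof (intro codef_conj codef_ex codef_all codef_imp codef_iff)
  show "codef L M N (n + Suc (m + k)) (\<lambda>e. fm_bounded M \<psi> \<kappa> (take n e)) (\<lambda>e. fm_bounded N \<psi> \<kappa> (take n e))"
    by (intro codef_app[OF codef_fm_bounded[OF \<psi>]] cosel_intros) auto
qed (intro codef_sat[OF \<psi>] codef_rveqd codef_instances[OF \<phi>] cosel_intros; simp)+

end

context vfield
begin

lemma instances_iff:
  assumes "l \<in> levels" "w \<in> tuples m D" "\<xi> \<in> tuples k D"
  shows "instances M m k \<phi> y l w \<xi> x \<longleftrightarrow> (\<exists>\<xi>'\<in>tuples k D. \<exists>w'\<in>tuples m D. \<exists>l'\<in>D.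
     level M l' \<and> (\<forall>i<m. \<forall>t\<in>D. rveq M l' t (w' ! i) \<longleftrightarrow> t \<in> rv M (vabs M l) (w ! i)) \<and>
     (\<forall>i<k. \<xi>' ! i \<in> rv M (vone M) (\<xi> ! i)) \<and> sat M (x # y @ l' # w' @ \<xi>') \<phi>)"
proof -
  have 1: "rveq M l t (w ! i) \<longleftrightarrow> t \<in> rv M (vabs M l) (w ! i)" if "t \<in> D" "i < m" for t i
    using that assms tuples_nth[OF assms(2)] by (simp add: rv_eq)
  have 2: "rv1 M (\<xi>' ! i) (\<xi> ! i) \<longleftrightarrow> \<xi>' ! i \<in> rv M (vone M) (\<xi> ! i)" if "i < k" "\<xi>' \<in> tuples k D" for \<xi>' i
    using that tuples_nth[OF assms(3)] tuples_nth[of \<xi>' k D i]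
    by (simp add: rv1_iff vone_eq rv_eq one_level)
  show ?thesis unfolding instances_def using 1 2 by (simp cong: bex_cong conj_cong)
qed

text \<open>The classes enter as unary predicates, and \<open>l'\<close>, \<open>w'\<close> and the
  representatives of the leading terms are bound by quantifiers. So neither \<open>l\<close> nor any
  representative is a parameter, and h-minimality will give a preparing set definable over
  \<open>y\<close> alone.\<close>

lemma definable_instances:
  assumes L: "contains_vf L" and \<phi>: "wf_fm L (Suc n + Suc m + k) \<phi>"
    and y: "y \<in> tuples n D" and l: "l \<in> levels" and w: "w \<in> tuples m D" and \<xi>: "\<xi> \<in> tuples k D"
  shows "definable L M (set y) (RV M (vone M) \<union> rv M (vabs M l) ` set w)
    {x \<in> D. instances M m k \<phi> y l w \<xi> x}"
proof -
  interpret vlang L by unfold_locales fact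
  let ?\<Xi> = "RV M (vone M) \<union> rv M (vabs M l) ` set w"
  have mem: "rv M (vabs M l) (w ! i) \<in> ?\<Xi>" if "i < m" for i
    using that w by (auto simp: tuples_def)
  have mem1: "rv M (vone M) (\<xi> ! i) \<in> ?\<Xi>" if "i < k" for i
    using tuples_nth[OF \<xi> that] RV_eq[OF one_level] by (simp add: vone_eq)
  let ?M = "struct_imag M"
  let ?R = "\<lambda>e. (\<exists>\<xi>'\<in>tuples k (dom_of ?M). \<exists>w'\<in>tuples m (dom_of ?M). \<exists>l'\<in>dom_of ?M.
     level M l' \<and> (\<forall>i<m. \<forall>t\<in>dom_of ?M. rveq M l' t (w' ! i) \<longleftrightarrow> t \<in> rv M (vabs M l) (w ! i)) \<and>
     (\<forall>i<k. \<xi>' ! i \<in> rv M (vone M) (\<xi> ! i)) \<and> sat M (e @ l' # w' @ \<xi>') \<phi>)"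
  have "dfn (lang_imag L ?\<Xi>) ?M (Suc n) ?R"
  proof (intro codef_exs codef_ex codef_conj codef_all_less codef_all codef_iff)
    let ?n = "Suc (m + (k + Suc n))"
    show "dfn (lang_imag L ?\<Xi>) ?M ?n (\<lambda>e. level M (hd e))"
      by (intro codef_imag codef_level cosel_intros) auto
    show "dfn (lang_imag L ?\<Xi>) ?M (Suc ?n) (\<lambda>e. rveq M (hd (tl e)) (hd e) (take m (tl (tl e)) ! i))" if "i < m" for i
      using that by (intro codef_imag codef_rveq cosel_intros) auto
    show "dfn (lang_imag L ?\<Xi>) ?M (Suc ?n) (\<lambda>e. hd e \<in> rv M (vabs M l) (w ! i))"
      if "i < m" for i
      by (intro codef_imag_mem mem that cosel_intros) auto
    show "dfn (lang_imag L ?\<Xi>) ?M ?n (\<lambda>e. take k (drop m (tl e)) ! i \<in> rv M (vone M) (\<xi> ! i))" if "i < k" for i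
      using that by (intro codef_imag_mem mem1 that cosel_intros) auto
    show "dfn (lang_imag L ?\<Xi>) ?M ?n (\<lambda>e. sat M (drop k (drop m (tl e)) @ hd e # take m (tl e) @ take k (drop m (tl e))) \<phi>)"
      by (intro codef_imag codef_sat[OF \<phi>] cosel_intros) auto
  qed
  from definable_codefI[OF this y subset_refl]
  show ?thesis by (simp add: instances_iff[OF l w \<xi>])
qed

end

lemma fm_preparesI:
  assumes "vfield M" "level M l" "l \<in> dom_of M" "wf_fm L (Suc n) \<psi>"
    and "prepares M (vabs M l) {x \<in> dom_of M. sat M (x # y) \<psi>} {x \<in> dom_of M. instances M m k \<phi> y l w \<xi> x}"
  shows "fm_prepares M m k \<phi> \<psi> (card {x \<in> dom_of M. sat M (x # y) \<psi>}) y l w \<xi>"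
proof -
  interpret vfield M by fact
  have l: "l \<in> levels" using assms by (simp add: level_iff)
  note p = assms(5)[unfolded prepares_iff[OF l]]
  have "fm_bounded M \<psi> (card {x \<in> dom_of M. sat M (x # y) \<psi>}) y" using p by (subst fm_bounded_iff) auto
  thus ?thesis using p unfolding fm_prepares_def by (auto simp: rveqd_iff)
qed

text \<open>Otherwise every finite set of pairs \<psi>, \<kappa> is defeated by some
  \<open>y\<close>, \<open>l\<close>, \<open>w\<close>, \<xi> in \<open>M\<close>, and compactness
  gives a model of \<open>T\<close> in \<open>'u\<close> with one such tuple defeating all pairs at
  once. There h-minimality provides a preparing set; its defining formula and its cardinality are a
  pair that is not defeated.\<close>

lemma finitely_many_preparing:
  fixes M :: "('v, 'f, 'p) vstruct"
  assumes hmin: "h_minimal TYPE('u) h L T" and large: "large_universe TYPE('u) L"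
    and M: "is_struct L M" "valued_field M" "\<And>\<theta>. \<theta> \<in> T \<Longrightarrow> wf_fm L 0 \<theta> \<and> sat M [] \<theta>"
    and m: "enat m \<le> h" and \<phi>: "wf_fm L (Suc n + Suc m + k) \<phi>"
  obtains ss where "\<And>\<psi> \<kappa>. (\<psi>, \<kappa>) \<in> set ss \<Longrightarrow> wf_fm L (Suc n) \<psi>"
    "\<And>y l w \<xi>. y \<in> tuples n (dom_of M) \<Longrightarrow> l \<in> dom_of M \<Longrightarrow> level M l \<Longrightarrow> w \<in> tuples m (dom_of M) \<Longrightarrow>
       \<xi> \<in> tuples k (dom_of M) \<Longrightarrow> \<exists>(\<psi>, \<kappa>)\<in>set ss. fm_prepares M m k \<phi> \<psi> \<kappa> y l w \<xi>"
proof (rule ccontr)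
  assume no: "\<not> thesis"
  have L: "contains_vf L" using hmin by (simp add: h_minimal_def)
  interpret vlang L by unfold_locales fact
  interpret M: vfield M by unfold_locales fact
  define nn where "nn = n + Suc (m + k)"
  \<comment> \<open>\<open>G S e\<close>: the tuple \<open>e\<close> has a proper level and defeats
    all well-formed pairs in \<open>S\<close>.\<close>
  define G where "G S e \<longleftrightarrow> level M (e ! n) \<and> (\<forall>\<psi> \<kappa>. (\<psi>, \<kappa>) \<in> S \<and> wf_fm L (Suc n) \<psi> \<longrightarrow>
     \<not> fm_prepares M m k \<phi> \<psi> \<kappa> (take n e) (e ! n) (take m (drop (Suc n) e)) (drop (Suc n + m) e))" for S e
  have "\<exists>e\<in>tuples nn (dom_of M). finite S \<longrightarrow> G S e" for S
  proof (cases "finite S")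
    case True
    then obtain ss where ss: "set ss = {s \<in> S. wf_fm L (Suc n) (fst s)}"
      using finite_list[of "{s \<in> S. wf_fm L (Suc n) (fst s)}"] by auto
    have "\<not> (\<forall>y l w \<xi>. y \<in> tuples n (dom_of M) \<longrightarrow> l \<in> dom_of M \<longrightarrow> level M l \<longrightarrow> w \<in> tuples m (dom_of M) \<longrightarrow>
       \<xi> \<in> tuples k (dom_of M) \<longrightarrow> (\<exists>(\<psi>, \<kappa>)\<in>set ss. fm_prepares M m k \<phi> \<psi> \<kappa> y l w \<xi>))"
    proof
      assume *: "\<forall>y l w \<xi>. y \<in> tuples n (dom_of M) \<longrightarrow> l \<in> dom_of M \<longrightarrow> level M l \<longrightarrow> w \<in> tuples m (dom_of M) \<longrightarrow>
       \<xi> \<in> tuples k (dom_of M) \<longrightarrow> (\<exists>(\<psi>, \<kappa>)\<in>set ss. fm_prepares M m k \<phi> \<psi> \<kappa> y l w \<xi>)"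
      have thesis by (rule that[of ss]) (use ss in simp, use * in blast)
      with no show False by contradiction
    qed
    then obtain y l w \<xi> where *: "y \<in> tuples n (dom_of M)" "l \<in> dom_of M" "level M l" "w \<in> tuples m (dom_of M)"
       "\<xi> \<in> tuples k (dom_of M)" "\<not> (\<exists>(\<psi>, \<kappa>)\<in>set ss. fm_prepares M m k \<phi> \<psi> \<kappa> y l w \<xi>)"
      by blast
    have "G S (y @ l # w @ \<xi>)"
      unfolding G_def using * ss by (auto simp: tuples_def nth_append)
    moreover have "y @ l # w @ \<xi> \<in> tuples nn (dom_of M)"
      unfolding nn_def using * by (intro tuples_append) (auto intro: tuples_append)
    ultimately show ?thesis by blast
  next
    case False
    \<comment> \<open>A default value, since \<open>es\<close> has to be a tuple for infinite
      \<open>S\<close> too.\<close>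
    have "replicate nn \<one>\<^bsub>Rng M\<^esub> \<in> tuples nn (dom_of M)" by (auto simp: tuples_def)
    thus ?thesis using False by blast
  qed
  then obtain es where es: "\<And>S. es S \<in> tuples nn (dom_of M)" and G: "\<And>S. finite S \<Longrightarrow> G S (es S)"
    by metis
  obtain N :: "('u, 'f, 'p) vstruct" and e where N: "is_struct L N" and e: "e \<in> tuples nn (dom_of N)"
    and tr': "\<forall>\<theta> S0. wf_fm L nn \<theta> \<longrightarrow> finite S0 \<longrightarrow> (\<forall>S. finite S \<longrightarrow> S0 \<subseteq> S \<longrightarrow> sat M (es S) \<theta>) \<longrightarrow> sat N e \<theta>"
    by (rule compactness_in_universe[OF M(1) large, of es nn], rule es, rule that)
  have tr: "sat N e \<theta>" if "wf_fm L nn \<theta>" "finite S0" "\<And>S. finite S \<Longrightarrow> S0 \<subseteq> S \<Longrightarrow> sat M (es S) \<theta>" for \<theta> S0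
    using tr'[rule_format, of \<theta> S0] that by simp
  have transfer: "Q e" if "codef L M N nn R Q" "finite S0" "\<And>S. finite S \<Longrightarrow> S0 \<subseteq> S \<Longrightarrow> R (es S)" for R Q S0
  proof -
    from that(1) obtain \<theta> where \<theta>: "wf_fm L nn \<theta>" "\<forall>e\<in>tuples nn (dom_of M). sat M e \<theta> \<longleftrightarrow> R e"
     "\<forall>e\<in>tuples nn (dom_of N). sat N e \<theta> \<longleftrightarrow> Q e" unfolding codef_def by blast
    have "sat N e \<theta>" using tr[OF \<theta>(1) that(2)] \<theta>(2) es that(3) by blast
    thus ?thesis using \<theta>(3) e by blast
  qed
  have "sat N [] \<theta>" if "\<theta> \<in> T" for \<theta>
  proof -
    have \<theta>: "wf_fm L 0 \<theta>" "sat M [] \<theta>" using M(3)[OF that] by auto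
    hence "sat M (es S) \<theta>" for S using sat_sentence[of L \<theta> M "es S" "[]"] by simp
    hence "sat N e \<theta>" using tr[of \<theta> "{}"] wf_fm_mono[OF \<theta>(1), of nn] by simp
    thus ?thesis using sat_sentence[OF \<theta>(1), of N e "[]"] by simp
  qed
  hence "is_model L T N" using N by (simp add: is_model_def)
  hence vN: "valued_field N" and prep: "\<And>lam A A' X.
           lam \<in> carrier (value_group N) \<and> vle N lam (vone N) \<and>
           A \<subseteq> dom_of N \<and> A' \<subseteq> RV N lam \<and> card_le A' h \<and>
           definable L N A (RV N (vone N) \<union> A') X \<Longrightarrow>
           (\<exists>C. finite C \<and> definable L N A {} C \<and> prepares N lam C X)"
    using hmin unfolding h_minimal_def by blast+
  interpret N: vfield N by unfold_locales fact
  define y l w \<xi> where "y = take n e" and "l = e ! n" and "w = take m (drop (Suc n) e)" and "\<xi> = drop (Suc n + m) e"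
  have len: "length e = n + Suc (m + k)" and sub: "set e \<subseteq> dom_of N" using e by (auto simp: nn_def tuples_def)
  have y: "y \<in> tuples n (dom_of N)" and w: "w \<in> tuples m (dom_of N)" and \<xi>: "\<xi> \<in> tuples k (dom_of N)"
    using len sub by (auto simp: tuples_def y_def w_def \<xi>_def dest!: in_set_takeD in_set_dropD)
  have lD: "l \<in> dom_of N" using tuples_nth[OF e, of n] by (simp add: l_def nn_def)
  have "codef L M N nn (\<lambda>e. level M (e ! n)) (\<lambda>e. level N (e ! n))"
    by (intro codef_level cosel_intros) (auto simp: nn_def)
  from transfer[OF this, of "{}"] G have lev: "level N l" by (auto simp: G_def l_def)
  hence l: "l \<in> N.levels" using lD by (simp add: N.level_iff)
  let ?X = "{x \<in> dom_of N. instances N m k \<phi> y l w \<xi> x}"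
  have "card_le (rv N (vabs N l) ` set w) h"
  proof (cases h)
    case (enat j)
    have "card (rv N (vabs N l) ` set w) \<le> length w"
      by (meson List.finite_set card_image_le card_length dual_order.trans)
    thus ?thesis using m enat w by (simp add: card_le_def tuples_length)
  qed (simp add: card_le_def countable_finite)
  moreover have "rv N (vabs N l) ` set w \<subseteq> RV N (vabs N l)"
    using w by (auto simp: N.RV_eq[OF l] tuples_def)
  moreover have "vabs N l \<in> carrier (value_group N) \<and> vle N (vabs N l) (vone N)"
    using N.value_group_le_one_iff l by blast
  moreover have "set y \<subseteq> dom_of N" using y by (simp add: tuples_def)
  moreover have "definable L N (set y) (RV N (vone N) \<union> rv N (vabs N l) ` set w) ?X"
    by (rule N.definable_instances[OF L \<phi> y l w \<xi>])
  ultimately obtain C where C: "definable L N (set y) {} C" "prepares N (vabs N l) C ?X"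
    using prep by blast
  obtain \<psi> where \<psi>: "wf_fm L (Suc (length y)) \<psi>" "C = {x \<in> dom_of N. sat N (x # y) \<psi>}"
    by (rule definable_without_imag[OF C(1) \<open>set y \<subseteq> dom_of N\<close>])
  have wf: "wf_fm L (Suc n) \<psi>" using \<psi>(1) y by (simp add: tuples_length)
  have good: "fm_prepares N m k \<phi> \<psi> (card C) y l w \<xi>"
    using fm_preparesI[OF N.vfield_axioms lev lD wf C(2)[unfolded \<psi>(2)]] \<psi>(2) by simp
  have "codef L M N nn
    (\<lambda>e. \<not> fm_prepares M m k \<phi> \<psi> (card C) (take n e) (e ! n) (take m (drop (Suc n) e)) (drop (Suc n + m) e))
    (\<lambda>e. \<not> fm_prepares N m k \<phi> \<psi> (card C) (take n e) (e ! n) (take m (drop (Suc n) e)) (drop (Suc n + m) e))"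
    unfolding nn_def by (intro codef_not codef_fm_prepares \<phi> wf)
  from transfer[OF this, of "{(\<psi>, card C)}"] G wf have "\<not> fm_prepares N m k \<phi> \<psi> (card C) y l w \<xi>"
    unfolding y_def l_def w_def \<xi>_def by (auto simp: G_def)
  with good show False by contradiction
qed

text \<open>One definable family \<open>P\<close> and one bound serve all data, and the preparing
  set depends on \<open>y\<close> only, not on \<open>l\<close>, \<open>w\<close> or \<xi>.\<close>

definition prepares_instances :: "('a, 'f, 'p) vstruct \<Rightarrow> nat \<Rightarrow> nat \<Rightarrow> nat \<Rightarrow> ('f, 'p) vfm \<Rightarrow>
    ('a list \<Rightarrow> bool) \<Rightarrow> nat \<Rightarrow> bool" where
  "prepares_instances M n m k \<phi> P \<kappa> \<longleftrightarrow> (\<forall>y\<in>tuples n (dom_of M).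
      finite {c \<in> dom_of M. P (c # y)} \<and> card {c \<in> dom_of M. P (c # y)} \<le> \<kappa> \<and>
      (\<forall>l\<in>vfield.levels M. \<forall>w\<in>tuples m (dom_of M). \<forall>\<xi>\<in>tuples k (dom_of M).
         prepares M (vabs M l) {c \<in> dom_of M. P (c # y)} {x \<in> dom_of M. instances M m k \<phi> y l w \<xi> x}))"

text \<open>The union of the finitely many candidate sets prepares, because enlarging a preparing
  set by finitely many points keeps it preparing; the bounds add up.\<close>

lemma uniform_preparation:
  fixes M :: "('v, 'f, 'p) vstruct"
  assumes hmin: "h_minimal TYPE('u) h L T" and large: "large_universe TYPE('u) L"
    and M: "is_struct L M" "valued_field M" "\<And>\<theta>. \<theta> \<in> T \<Longrightarrow> wf_fm L 0 \<theta> \<and> sat M [] \<theta>"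
    and m: "enat m \<le> h" and \<phi>: "wf_fm L (Suc n + Suc m + k) \<phi>"
  shows "\<exists>P \<kappa>. dfn L M (Suc n) P \<and> prepares_instances M n m k \<phi> P \<kappa>"
proof -
  have L: "contains_vf L" using hmin by (simp add: h_minimal_def)
  interpret vlang L by unfold_locales fact
  interpret vfield M by unfold_locales fact
  obtain ss where wf: "\<And>\<psi> \<kappa>. (\<psi>, \<kappa>) \<in> set ss \<Longrightarrow> wf_fm L (Suc n) \<psi>"
    and good: "\<And>y l w \<xi>. y \<in> tuples n (dom_of M) \<Longrightarrow> l \<in> dom_of M \<Longrightarrow> level M l \<Longrightarrow> w \<in> tuples m (dom_of M) \<Longrightarrow>
       \<xi> \<in> tuples k (dom_of M) \<Longrightarrow> \<exists>(\<psi>, \<kappa>)\<in>set ss. fm_prepares M m k \<phi> \<psi> \<kappa> y l w \<xi>"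
    using finitely_many_preparing[OF hmin large M m \<phi>] by metis
  define P where "P e \<longleftrightarrow> (\<exists>i<length ss. sat M e (fst (ss ! i)) \<and> fm_bounded M (fst (ss ! i)) (snd (ss ! i)) (tl e))" for e
  \<comment> \<open>A candidate that exceeds its bound over this \<open>y\<close> may be infinite
    and is discarded.\<close>
  define Ci where "Ci y i = (if fm_bounded M (fst (ss ! i)) (snd (ss ! i)) y then {c \<in> D. sat M (c # y) (fst (ss ! i))} else {})" for y i
  have D: "D \<noteq> {}" using R.one_closed by blast
  have C_eq: "{c \<in> D. P (c # y)} = (\<Union>i<length ss. Ci y i)" for y
    unfolding P_def Ci_def by auto
  have Ci: "finite (Ci y i) \<and> card (Ci y i) \<le> snd (ss ! i)" for y i
    by (simp add: Ci_def fm_bounded_iff[OF D])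
  have "dfn L M (Suc n) P"
    unfolding P_def
  proof (intro codef_ex_less codef_conj)
    fix i assume "i < length ss"
    hence "(fst (ss ! i), snd (ss ! i)) \<in> set ss" by simp
    hence w: "wf_fm L (Suc n) (fst (ss ! i))" by (rule wf)
    show "dfn L M (Suc n) (\<lambda>e. sat M e (fst (ss ! i)))"
      by (intro codef_sat[OF w] cosel_intros) auto
    show "dfn L M (Suc n) (\<lambda>e. fm_bounded M (fst (ss ! i)) (snd (ss ! i)) (tl e))"
      by (intro codef_app[OF codef_fm_bounded[OF w]] cosel_intros) auto
  qed
  moreover have "finite {c \<in> D. P (c # y)} \<and> card {c \<in> D. P (c # y)} \<le> (\<Sum>i<length ss. snd (ss ! i))" for y
  proof
    show "finite {c \<in> D. P (c # y)}" unfolding C_eq using Ci by blast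
    have "card (\<Union>i<length ss. Ci y i) \<le> (\<Sum>i<length ss. card (Ci y i))" by (rule card_UN_le) simp
    also have "\<dots> \<le> (\<Sum>i<length ss. snd (ss ! i))" using Ci by (intro sum_mono) blast
    finally show "card {c \<in> D. P (c # y)} \<le> (\<Sum>i<length ss. snd (ss ! i))" unfolding C_eq .
  qed
  moreover have "prepares M (vabs M l) {c \<in> D. P (c # y)} {x \<in> D. instances M m k \<phi> y l w \<xi> x}"
    if y: "y \<in> tuples n D" and l: "l \<in> levels" and w: "w \<in> tuples m D" and \<xi>: "\<xi> \<in> tuples k D" for y l w \<xi>
  proof -
    have lD: "l \<in> D" "level M l" using l levelsD(1) level_iff by auto
    obtain \<psi> \<kappa> where g: "(\<psi>, \<kappa>) \<in> set ss" "fm_prepares M m k \<phi> \<psi> \<kappa> y l w \<xi>"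
      using good[OF y lD w \<xi>] by blast
    then obtain i where i: "i < length ss" "ss ! i = (\<psi>, \<kappa>)" by (auto simp: in_set_conv_nth)
    have sub: "P (c # y)" if "sat M (c # y) \<psi>" for c
      unfolding P_def using i that g(2) by (intro exI[of _ i]) (auto simp: fm_prepares_def)
    show ?thesis
      unfolding prepares_iff[OF l]
    proof (intro conjI ballI impI)
      show "finite {c \<in> D. P (c # y)}" unfolding C_eq using Ci by blast
      show "{c \<in> D. P (c # y)} \<noteq> {}" using g(2) sub unfolding fm_prepares_def by blast
      fix x x' assume x: "x \<in> D" "x' \<in> D"
        and eq: "\<forall>c\<in>{c \<in> D. P (c # y)}. rveq M l (x -! c) (x' -! c)"
      have "\<forall>c\<in>D. sat M (c # y) \<psi> \<longrightarrow> rveqd M l x x' c"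
        using eq sub x by (auto simp: rveqd_iff)
      hence "instances M m k \<phi> y l w \<xi> x \<longleftrightarrow> instances M m k \<phi> y l w \<xi> x'"
        using g(2) x unfolding fm_prepares_def by blast
      thus "x \<in> {x \<in> D. instances M m k \<phi> y l w \<xi> x} \<longleftrightarrow> x' \<in> {x \<in> D. instances M m k \<phi> y l w \<xi> x}"
        using x by simp
    qed auto
  qed
  ultimately show ?thesis unfolding prepares_instances_def by blast
qed

section \<open>Families indexed by leading terms\<close>

text \<open>Isolates all that is used of h-minimality from here on: the uniform preparation of
  formulas in the small language.\<close>

locale prepared_model = vfield M + vlang L
  for M :: "('a, 'f, 'p) vstruct" and L :: "('f, 'p) vlang" +
  fixes h :: enat
  assumes struct: "is_struct L M"
    and prep: "enat m \<le> h \<Longrightarrow> wf_fm L (Suc n + Suc m + k) \<phi> \<Longrightarrow>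
      \<exists>P \<kappa>. dfn L M (Suc n) P \<and> prepares_instances M n m k \<phi> P \<kappa>"
begin

lemma rv1_refl: "x \<in> D \<Longrightarrow> rv1 M x x"
  by (simp add: rv1_rv)

lemma rv1_is_zero: "x \<in> D \<Longrightarrow> y \<in> D \<Longrightarrow> rv1 M x y \<Longrightarrow> is_zero M x \<longleftrightarrow> is_zero M y"
  using rveq_sym[OF one_level, of x y] by (auto simp: rv1_iff is_zero_iff rveq_iff)

lemma rv1_cong_nth:
  assumes "\<xi> \<in> tuples k D" "\<xi>' \<in> tuples k D" "list_all2 (rv1 M) \<xi> \<xi>'" "d \<in> D" "i < k"
  shows "rv1 M d (\<xi> ! i) \<longleftrightarrow> rv1 M d (\<xi>' ! i)"
  using assms tuples_nth[OF assms(1), of i] tuples_nth[OF assms(2), of i]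
  by (auto simp: rv1_rv list_all2_conv_all_nth tuples_length)

lemma plus_eq_iff:
  assumes "x \<in> D" "c \<in> D"
  shows "(\<exists>d\<in>D. fun_of M Plus [d, c] = x \<and> Q d) \<longleftrightarrow> Q (x -! c)"
  using assms by (auto simp: fun_of_Plus plus_eq_diff_iff)

text \<open>\<open>R\<close> is read as the family of the sets \<open>{a. R a \<xi>}\<close>, indexed by tuples \<open>\<xi>\<close> of leading terms.\<close>

definition rvfam :: "nat \<Rightarrow> nat \<Rightarrow> ('a list \<Rightarrow> 'a list \<Rightarrow> bool) \<Rightarrow> bool" where
  "rvfam n k R \<longleftrightarrow> dfn L M (n + k) (\<lambda>e. R (take n e) (drop n e)) \<and>
     (\<forall>a\<in>tuples n D. \<forall>\<xi>\<in>tuples k D. \<forall>\<xi>'\<in>tuples k D. list_all2 (rv1 M) \<xi> \<xi>' \<longrightarrow> (R a \<xi> \<longleftrightarrow> R a \<xi>'))"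

definition sim :: "nat \<Rightarrow> ('a list \<Rightarrow> 'a list \<Rightarrow> bool) \<Rightarrow> 'a list \<Rightarrow> 'a list \<Rightarrow> bool" where
  "sim k R a b \<longleftrightarrow> (\<forall>\<xi>\<in>tuples k D. R a \<xi> \<longleftrightarrow> R b \<xi>)"

lemma sim_refl [simp]: "sim k R a a"
  by (simp add: sim_def)

lemma sim_sym: "sim k R a b \<Longrightarrow> sim k R b a"
  by (simp add: sim_def)

lemma sim_trans: "sim k R a b \<Longrightarrow> sim k R b c \<Longrightarrow> sim k R a c"
  by (simp add: sim_def)

lemma rvfam_codef:
  assumes R: "rvfam n k R" and p: "cosel n' p p" "cosel n' q q"
    and len: "\<And>e :: 'a list. length e = n' \<Longrightarrow> length (p e) = n" "\<And>e :: 'a list. length e = n' \<Longrightarrow> length (q e) = k"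
  shows "dfn L M n' (\<lambda>e. R (p e) (q e))"
proof -
  have Rc: "dfn L M (n + k) (\<lambda>e. R (take n e) (drop n e))"
    using R unfolding rvfam_def by blast
  show ?thesis
    by (rule codef_cong, rule codef_app[OF Rc cosel_append[OF p]]) (simp_all add: len tuples_length)
qed

lemma rvfam_inv:
  "rvfam n k R \<Longrightarrow> a \<in> tuples n D \<Longrightarrow> \<xi> \<in> tuples k D \<Longrightarrow> \<xi>' \<in> tuples k D \<Longrightarrow> list_all2 (rv1 M) \<xi> \<xi>' \<Longrightarrow> R a \<xi> \<longleftrightarrow> R a \<xi>'"
  unfolding rvfam_def by blast

lemma rvfamI:
  assumes "dfn L M (n + k) (\<lambda>e. R (take n e) (drop n e))"
    "\<And>a \<xi> \<xi>'. a \<in> tuples n D \<Longrightarrow> \<xi> \<in> tuples k D \<Longrightarrow> \<xi>' \<in> tuples k D \<Longrightarrow> list_all2 (rv1 M) \<xi> \<xi>' \<Longrightarrow> R a \<xi> \<longleftrightarrow> R a \<xi>'"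
  shows "rvfam n k R"
  using assms unfolding rvfam_def by blast

text \<open>Uniform preparation at level 1 with no classes \<open>w\<close>. Since the preparing set
  is the same for all \<xi>, it controls all members of the family at once and hence the similarity
  class.\<close>

lemma rvfam_prepared:
  assumes R: "rvfam (Suc n) k R"
  obtains P \<kappa> where "dfn L M (Suc n) P"
    "\<And>a. a \<in> tuples n D \<Longrightarrow> finite {c \<in> D. P (c # a)} \<and> card {c \<in> D. P (c # a)} \<le> \<kappa> \<and> {c \<in> D. P (c # a)} \<noteq> {}"
    "\<And>a x x'. a \<in> tuples n D \<Longrightarrow> x \<in> D \<Longrightarrow> x' \<in> D \<Longrightarrow>
       \<forall>c\<in>D. P (c # a) \<longrightarrow> rv1 M (x -! c) (x' -! c) \<Longrightarrow> sim k R (x # a) (x' # a)"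
proof -
  \<comment> \<open>The additional position is the one where \<open>instances\<close> inserts its
    level \<open>l'\<close>; it is skipped by the formula.\<close>
  have "dfn L M (Suc n + Suc 0 + k) (\<lambda>e. R (take (Suc n) e) (drop (Suc (Suc n)) e))"
    by (rule rvfam_codef[OF R]; (intro cosel_intros | simp))
  then obtain \<phi> where \<phi>: "wf_fm L (Suc n + Suc 0 + k) \<phi>"
    and sat: "\<And>e. e \<in> tuples (Suc n + Suc 0 + k) D \<Longrightarrow> sat M e \<phi> \<longleftrightarrow> R (take (Suc n) e) (drop (Suc (Suc n)) e)"
    unfolding codef_def by blast
  have inst: "instances M 0 k \<phi> a 1! [] \<xi> x \<longleftrightarrow> R (x # a) \<xi>"
    if "a \<in> tuples n D" "x \<in> D" "\<xi> \<in> tuples k D" for a \<xi> x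
  proof -
    have *: "sat M (x # a @ l' # \<xi>') \<phi> \<longleftrightarrow> R (x # a) \<xi>'" if "l' \<in> D" "\<xi>' \<in> tuples k D" for l' \<xi>'
      using sat[of "x # a @ l' # \<xi>'"] that \<open>a \<in> tuples n D\<close> \<open>x \<in> D\<close> by (auto simp: tuples_def)
    have inv: "R (x # a) \<xi>' \<longleftrightarrow> R (x # a) \<xi>" if "\<xi>' \<in> tuples k D" "\<forall>i<k. rv1 M (\<xi>' ! i) (\<xi> ! i)" for \<xi>'
      using rvfam_inv[OF R, of "x # a" \<xi>' \<xi>] that \<open>a \<in> tuples n D\<close> \<open>x \<in> D\<close> \<open>\<xi> \<in> tuples k D\<close>
      by (auto simp: list_all2_conv_all_nth tuples_length)
    have rfl: "\<forall>i<k. rv1 M (\<xi> ! i) (\<xi> ! i)" using \<open>\<xi> \<in> tuples k D\<close> by (auto intro: rv1_refl tuples_nth)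
    have lev: "level M 1!" by (simp add: level_iff one_level)
    show ?thesis
    proof
      assume "instances M 0 k \<phi> a 1! [] \<xi> x"
      then obtain \<xi>' l' where "\<xi>' \<in> tuples k D" "l' \<in> D" "\<forall>i<k. rv1 M (\<xi>' ! i) (\<xi> ! i)" "sat M (x # a @ l' # \<xi>') \<phi>"
        unfolding instances_def by auto
      thus "R (x # a) \<xi>" using * inv by blast
    next
      assume "R (x # a) \<xi>"
      hence "sat M (x # a @ 1! # [] @ \<xi>) \<phi>" using *[of "1!" \<xi>] \<open>\<xi> \<in> tuples k D\<close> by simp
      thus "instances M 0 k \<phi> a 1! [] \<xi> x"
        unfolding instances_def using rfl lev \<open>\<xi> \<in> tuples k D\<close>
        by (intro bexI[of _ \<xi>] bexI[of _ "[]"] bexI[of _ "1!"] conjI) simp_all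
    qed
  qed
  obtain P \<kappa> where P: "dfn L M (Suc n) P"
    and C: "prepares_instances M n 0 k \<phi> P \<kappa>"
    using prep[OF _ \<phi>] by (simp only: zero_enat_def[symmetric] zero_le) blast
  have pr: "prepares M (vabs M 1!) {c \<in> D. P (c # a)} {x \<in> D. instances M 0 k \<phi> a 1! [] \<xi> x}"
    if "a \<in> tuples n D" "\<xi> \<in> tuples k D" for a \<xi>
    using C that one_level unfolding prepares_instances_def by force
  show thesis
  proof
    show "dfn L M (Suc n) P" by fact
    \<comment> \<open>Some index is needed to read off from \<open>pr\<close> that the preparing set
      is not empty.\<close>
    have ne: "replicate k 0! \<in> tuples k D" by (auto simp: tuples_def)
    show "finite {c \<in> D. P (c # a)} \<and> card {c \<in> D. P (c # a)} \<le> \<kappa> \<and> {c \<in> D. P (c # a)} \<noteq> {}"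
      if "a \<in> tuples n D" for a
      using C pr[OF that ne] that unfolding prepares_def prepares_instances_def by blast
    fix a x x' assume *: "a \<in> tuples n D" "x \<in> D" "x' \<in> D"
      and eq: "\<forall>c\<in>D. P (c # a) \<longrightarrow> rv1 M (x -! c) (x' -! c)"
    have "\<forall>c\<in>{c \<in> D. P (c # a)}. rveq M 1! (x -! c) (x' -! c)"
      using eq * by (auto simp: rv1_iff)
    hence "instances M 0 k \<phi> a 1! [] \<xi> x \<longleftrightarrow> instances M 0 k \<phi> a 1! [] \<xi> x'" if "\<xi> \<in> tuples k D" for \<xi>
      using pr[OF *(1) that] * unfolding prepares_iff[OF one_level] by blast
    thus "sim k R (x # a) (x' # a)" unfolding sim_def using inst * by blast
  qed
qed

text \<open>The witnesses \<open>z\<close> allowed by \<open>T\<close> and \<open>\<xi>\<close> fall into at most \<open>N\<close>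
  classes with respect to \<open>sim k R\<close>, over any base \<open>a'\<close>.\<close>

definition cover :: "nat \<Rightarrow> nat \<Rightarrow> nat \<Rightarrow> ('a list \<Rightarrow> 'a list \<Rightarrow> bool) \<Rightarrow> nat \<Rightarrow> ('a list \<Rightarrow> 'a list \<Rightarrow> bool) \<Rightarrow> nat \<Rightarrow> bool" where
  "cover m n k R k' T N \<longleftrightarrow> rvfam (m + n) k' T \<and> (\<forall>a\<in>tuples n D. \<forall>z\<in>tuples m D. \<exists>\<xi>\<in>tuples k' D. T (z @ a) \<xi> \<and>
     (\<forall>a'\<in>tuples n D. \<exists>Z\<subseteq>tuples m D. finite Z \<and> card Z \<le> N \<and>
        (\<forall>z'\<in>tuples m D. T (z' @ a') \<xi> \<longrightarrow> (\<exists>u\<in>Z. sim k R (u @ a') (z' @ a')))))"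

text \<open>The parameters list the leading terms of the differences of \<open>x\<close> to the
  points of the preparing set, and \<open>T\<close> demands that all these leading terms occur in
  the list. Over any base an allowed element then determines a function from at most \<kappa> points
  to at most \<kappa> leading terms, and by preparation this function determines its class.\<close>

lemma cover_one:
  assumes R: "rvfam (1 + n) k R"
  shows "\<exists>k' T N. cover 1 n k R k' T N"
proof -
  have R': "rvfam (Suc n) k R" using R by simp
  obtain P \<kappa> where P: "dfn L M (Suc n) P"
    and C: "\<And>a. a \<in> tuples n D \<Longrightarrow> finite {c \<in> D. P (c # a)} \<and> card {c \<in> D. P (c # a)} \<le> \<kappa> \<and> {c \<in> D. P (c # a)} \<noteq> {}"
    and prep: "\<And>a x x'. a \<in> tuples n D \<Longrightarrow> x \<in> D \<Longrightarrow> x' \<in> D \<Longrightarrow>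
       \<forall>c\<in>D. P (c # a) \<longrightarrow> rv1 M (x -! c) (x' -! c) \<Longrightarrow> sim k R (x # a) (x' # a)"
    by (rule rvfam_prepared[OF R'], rule that)
  define T where "T p \<zeta> \<longleftrightarrow> (\<forall>c\<in>D. P (c # tl p) \<longrightarrow>
    (\<exists>d\<in>D. fun_of M Plus [d, c] = hd p \<and> (\<exists>i<\<kappa>. rv1 M d (\<zeta> ! i))))" for p \<zeta>
  have T: "T (x # a) \<zeta> \<longleftrightarrow> (\<forall>c\<in>D. P (c # a) \<longrightarrow> (\<exists>i<\<kappa>. rv1 M (x -! c) (\<zeta> ! i)))" if "x \<in> D" for x a \<zeta>
    unfolding T_def using that plus_eq_iff by auto
  have famT: "rvfam (1 + n) \<kappa> T"
  proof (rule rvfamI)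
    show "dfn L M (1 + n + \<kappa>) (\<lambda>e. T (take (1 + n) e) (drop (1 + n) e))"
      unfolding T_def
      by (intro codef_all codef_imp codef_ex codef_conj codef_ex_less codef_app[OF P] codef_Plus codef_rv1 cosel_intros) auto
    fix a \<xi> \<xi>' assume *: "a \<in> tuples (1 + n) D" "\<xi> \<in> tuples \<kappa> D" "\<xi>' \<in> tuples \<kappa> D" "list_all2 (rv1 M) \<xi> \<xi>'"
    show "T a \<xi> \<longleftrightarrow> T a \<xi>'" unfolding T_def using rv1_cong_nth[OF *(2-4)] by (simp cong: bex_cong conj_cong)
  qed
  have main: "\<exists>\<xi>\<in>tuples \<kappa> D. T (x # a) \<xi> \<and>
     (\<forall>a'\<in>tuples n D. \<exists>Z\<subseteq>D. finite Z \<and> card Z \<le> \<kappa> ^ \<kappa> \<and>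
        (\<forall>x'\<in>D. T (x' # a') \<xi> \<longrightarrow> (\<exists>u\<in>Z. sim k R (u # a') (x' # a'))))"
    if a: "a \<in> tuples n D" and x: "x \<in> D" for a x
  proof -
    let ?S = "(\<lambda>c. x -! c) ` {c \<in> D. P (c # a)}"
    have "finite ?S" "card ?S \<le> \<kappa>"
      using C[OF a] card_image_le[of "{c \<in> D. P (c # a)}" "\<lambda>c. x -! c"] by auto
    moreover have "?S \<subseteq> D" using x by auto
    ultimately obtain \<zeta> where \<zeta>: "\<zeta> \<in> tuples \<kappa> D" "?S \<subseteq> set \<zeta>"
      using tuples_extend[of ?S \<kappa> D] R.one_closed by blast
    have "T (x # a) \<zeta>"
      unfolding T[OF x]
    proof (intro ballI impI)
      fix c assume c: "c \<in> D" "P (c # a)"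
      hence "x -! c \<in> set \<zeta>" using \<zeta>(2) by blast
      then obtain i where "i < \<kappa>" "\<zeta> ! i = x -! c"
        using \<zeta>(1) by (auto simp: in_set_conv_nth tuples_def)
      thus "\<exists>i<\<kappa>. rv1 M (x -! c) (\<zeta> ! i)" using rv1_refl[of "x -! c"] x c by auto
    qed
    moreover have "\<exists>Z\<subseteq>D. finite Z \<and> card Z \<le> \<kappa> ^ \<kappa> \<and>
        (\<forall>x'\<in>D. T (x' # a') \<zeta> \<longrightarrow> (\<exists>u\<in>Z. sim k R (u # a') (x' # a')))" if a': "a' \<in> tuples n D" for a'
    proof -
      let ?C = "{c \<in> D. P (c # a')}" and ?B = "rv M (vone M) ` set \<zeta>"
      define X where "X = {x' \<in> D. T (x' # a') \<zeta>}"
      \<comment> \<open>The function whose fibres are contained in similarity classes; choosing one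
        element from each fibre gives the set \<open>?Z\<close>.\<close>
      define g where "g x' = restrict (\<lambda>c. rv M (vone M) (x' -! c)) ?C" for x'
      note C' = C[OF a']
      have sub: "g ` X \<subseteq> PiE ?C (\<lambda>_. ?B)"
      proof
        fix f assume "f \<in> g ` X"
        then obtain x' where x': "x' \<in> D" "T (x' # a') \<zeta>" "f = g x'" unfolding X_def by blast
        have "rv M (vone M) (x' -! c) \<in> ?B" if c: "c \<in> ?C" for c
        proof -
          obtain i where i: "i < \<kappa>" "rv1 M (x' -! c) (\<zeta> ! i)" using x'(2) c unfolding T[OF x'(1)] by blast
          hence "rv M (vone M) (x' -! c) = rv M (vone M) (\<zeta> ! i)"
            using rv1_rv[of "x' -! c" "\<zeta> ! i"] x'(1) c tuples_nth[OF \<zeta>(1) i(1)] by auto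
          thus ?thesis using i(1) \<zeta>(1) by (auto simp: tuples_def)
        qed
        thus "f \<in> PiE ?C (\<lambda>_. ?B)" unfolding x'(3) g_def by auto
      qed
      have fin: "finite (PiE ?C (\<lambda>_. ?B))" using C' by (intro finite_PiE) auto
      \<comment> \<open>Positivity of \<kappa> is needed for the power to be monotone in the
        exponent; it comes from the preparing set being non-empty.\<close>
      have "card ?C > 0" using C' by (meson card_gt_0_iff)
      hence "\<kappa> > 0" using C' by linarith
      have "card ?B \<le> \<kappa>"
        using \<zeta>(1) by (metis List.finite_set card_image_le card_length dual_order.trans tuples_length)
      hence "card (PiE ?C (\<lambda>_. ?B)) \<le> \<kappa> ^ card ?C" using C' by (simp add: card_PiE power_mono)
      also have "\<dots> \<le> \<kappa> ^ \<kappa>" using C' \<open>\<kappa> > 0\<close> by (intro power_increasing) auto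
      finally have card: "card (g ` X) \<le> \<kappa> ^ \<kappa>" using card_mono[OF fin sub] by simp
      have finX: "finite (g ` X)" using finite_subset[OF sub fin] .
      let ?Z = "inv_into X g ` (g ` X)"
      have Zc: "card ?Z \<le> \<kappa> ^ \<kappa>" using card_image_le[OF finX, of "inv_into X g"] card by linarith
      have Zs: "?Z \<subseteq> D" using inv_into_into[of _ g X] unfolding X_def by blast
      have Zw: "\<exists>u\<in>?Z. sim k R (u # a') (x' # a')" if "x' \<in> D" "T (x' # a') \<zeta>" for x'
      proof -
        have x': "x' \<in> X" using that by (simp add: X_def)
        let ?u = "inv_into X g (g x')"
        have u: "?u \<in> X" "g ?u = g x'" using x' by (auto intro: inv_into_into f_inv_into_f)
        have "sim k R (?u # a') (x' # a')"
        proof (rule prep[OF a'])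
          show "?u \<in> D" using u(1) by (simp add: X_def)
          show "x' \<in> D" by fact
          show "\<forall>c\<in>D. P (c # a') \<longrightarrow> rv1 M (?u -! c) (x' -! c)"
          proof (intro ballI impI)
            fix c assume c: "c \<in> D" "P (c # a')"
            hence "rv M (vone M) (?u -! c) = rv M (vone M) (x' -! c)"
              using fun_cong[OF u(2), of c] by (simp add: g_def)
            thus "rv1 M (?u -! c) (x' -! c)" using \<open>?u \<in> D\<close> \<open>x' \<in> D\<close> c by (simp add: rv1_rv)
          qed
        qed
        thus ?thesis using x' by blast
      qed
      show ?thesis
        by (intro exI[of _ ?Z] conjI ballI impI Zs Zc Zw finite_imageI finX)
    qed
    ultimately show ?thesis using \<zeta>(1) by blast
  qed
  have "cover 1 n k R \<kappa> T (\<kappa> ^ \<kappa>)"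
    unfolding cover_def
  proof (intro conjI famT ballI)
    fix a z assume a: "a \<in> tuples n D" and "z \<in> tuples 1 D"
    then obtain x where z: "z = [x]" "x \<in> D" by (auto simp: tuples_def length_Suc_conv)
    obtain \<xi> where \<xi>: "\<xi> \<in> tuples \<kappa> D" "T (x # a) \<xi>"
      and Z: "\<forall>a'\<in>tuples n D. \<exists>Z\<subseteq>D. finite Z \<and> card Z \<le> \<kappa> ^ \<kappa> \<and>
        (\<forall>x'\<in>D. T (x' # a') \<xi> \<longrightarrow> (\<exists>u\<in>Z. sim k R (u # a') (x' # a')))"
      using main[OF a z(2)] by blast
    have "\<exists>Z\<subseteq>tuples 1 D. finite Z \<and> card Z \<le> \<kappa> ^ \<kappa> \<and>
        (\<forall>z'\<in>tuples 1 D. T (z' @ a') \<xi> \<longrightarrow> (\<exists>u\<in>Z. sim k R (u @ a') (z' @ a')))" if "a' \<in> tuples n D" for a'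
    proof -
      obtain Z where Z: "Z \<subseteq> D" "finite Z" "card Z \<le> \<kappa> ^ \<kappa>"
        "\<forall>x'\<in>D. T (x' # a') \<xi> \<longrightarrow> (\<exists>u\<in>Z. sim k R (u # a') (x' # a'))"
        using Z \<open>a' \<in> tuples n D\<close> by blast
      have "card ((\<lambda>x. [x]) ` Z) \<le> \<kappa> ^ \<kappa>" using card_image_le[OF Z(2), of "\<lambda>x. [x]"] Z(3) by linarith
      moreover have "\<exists>u\<in>(\<lambda>x. [x]) ` Z. sim k R (u @ a') (z' @ a')" if "z' \<in> tuples 1 D" "T (z' @ a') \<xi>" for z'
        using Z(4) that by (auto simp: tuples_def length_Suc_conv)
      ultimately show ?thesis using Z by (intro exI[of _ "(\<lambda>x. [x]) ` Z"]) (auto simp: tuples_def)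
    qed
    thus "\<exists>\<xi>\<in>tuples \<kappa> D. T (z @ a) \<xi> \<and> (\<forall>a'\<in>tuples n D. \<exists>Z\<subseteq>tuples 1 D. finite Z \<and> card Z \<le> \<kappa> ^ \<kappa> \<and>
        (\<forall>z'\<in>tuples 1 D. T (z' @ a') \<xi> \<longrightarrow> (\<exists>u\<in>Z. sim k R (u @ a') (z' @ a'))))"
      using \<xi> z by (intro bexI[of _ \<xi>]) auto
  qed
  thus ?thesis by blast
qed

end

section \<open>Separation of similarity classes and back-and-forth\<close>

lemma list_all2_hd: "list_all2 P xs ys \<Longrightarrow> xs \<noteq> [] \<Longrightarrow> P (hd xs) (hd ys)"
  by (cases xs; cases ys) auto

lemma list_all2_tl: "list_all2 P xs ys \<Longrightarrow> list_all2 P (tl xs) (tl ys)"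
  by (cases xs; cases ys) auto

lemma tuples_take: "xs \<in> tuples n D \<Longrightarrow> k \<le> n \<Longrightarrow> take k xs \<in> tuples k D"
  by (auto simp: tuples_def dest: in_set_takeD)

lemma tuples_drop: "xs \<in> tuples (k + n) D \<Longrightarrow> drop k xs \<in> tuples n D"
  by (auto simp: tuples_def dest: in_set_dropD)

lemma tuples_tl: "xs \<in> tuples (Suc n) D \<Longrightarrow> tl xs \<in> tuples n D"
  by (auto elim: tuples_SucE)

lemma tuples_hd: "xs \<in> tuples (Suc n) D \<Longrightarrow> hd xs \<in> D"
  by (auto elim: tuples_SucE)

context prepared_model
begin

lemma hd_is_zero:
  assumes "\<xi> \<in> tuples (Suc k) D" "\<xi>' \<in> tuples (Suc k) D" "list_all2 (rv1 M) \<xi> \<xi>'"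
  shows "is_zero M (hd \<xi>) \<longleftrightarrow> is_zero M (hd \<xi>')"
  using rv1_is_zero[OF tuples_hd[OF assms(1)] tuples_hd[OF assms(2)] list_all2_hd[OF assms(3)]] assms(1)
  by (auto elim: tuples_SucE)

text \<open>A disjoint union of two families: whether the first leading term vanishes is a switch
  between them. This is well defined on leading terms, and similarity for the union implies
  similarity for both parts.\<close>

definition join :: "nat \<Rightarrow> ('a list \<Rightarrow> 'a list \<Rightarrow> bool) \<Rightarrow> ('a list \<Rightarrow> 'a list \<Rightarrow> bool) \<Rightarrow> 'a list \<Rightarrow> 'a list \<Rightarrow> bool" where
  "join k R R' p \<zeta> \<longleftrightarrow> (is_zero M (hd \<zeta>) \<and> R p (take k (tl \<zeta>))) \<or> (\<not> is_zero M (hd \<zeta>) \<and> R' p (drop k (tl \<zeta>)))"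

text \<open>\<open>T\<close> together with one bit of information about \<open>R\<close>: its truth
  value at the first block must be the one encoded by the first entry.\<close>

definition refine :: "nat \<Rightarrow> ('a list \<Rightarrow> 'a list \<Rightarrow> bool) \<Rightarrow> ('a list \<Rightarrow> 'a list \<Rightarrow> bool) \<Rightarrow> 'a list \<Rightarrow> 'a list \<Rightarrow> bool" where
  "refine k R T p \<zeta> \<longleftrightarrow> T p (drop k (tl \<zeta>)) \<and> (R p (take k (tl \<zeta>)) \<longleftrightarrow> is_zero M (hd \<zeta>))"

lemma
  assumes R: "rvfam n k R" and R': "rvfam n k' R'"
  shows rvfam_join: "rvfam n (Suc (k + k')) (join k R R')" and rvfam_refine: "rvfam n (Suc (k + k')) (refine k R R')"
proof -
  have inv: "R a (take k (tl \<xi>)) \<longleftrightarrow> R a (take k (tl \<xi>'))" "R' a (drop k (tl \<xi>)) \<longleftrightarrow> R' a (drop k (tl \<xi>'))"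
    "is_zero M (hd \<xi>) \<longleftrightarrow> is_zero M (hd \<xi>')"
    if *: "a \<in> tuples n D" "\<xi> \<in> tuples (Suc (k + k')) D" "\<xi>' \<in> tuples (Suc (k + k')) D" "list_all2 (rv1 M) \<xi> \<xi>'" for a \<xi> \<xi>'
  proof -
    show "R a (take k (tl \<xi>)) \<longleftrightarrow> R a (take k (tl \<xi>'))"
      by (rule rvfam_inv[OF R]) (use * in \<open>auto intro!: tuples_take tuples_tl list_all2_takeI list_all2_tl\<close>)
    show "R' a (drop k (tl \<xi>)) \<longleftrightarrow> R' a (drop k (tl \<xi>'))"
      by (rule rvfam_inv[OF R']) (use * in \<open>auto intro!: tuples_drop tuples_tl list_all2_dropI list_all2_tl\<close>)
    show "is_zero M (hd \<xi>) \<longleftrightarrow> is_zero M (hd \<xi>')" by (rule hd_is_zero[OF *(2-4)])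
  qed
  note intros = rvfam_codef[OF R] rvfam_codef[OF R'] codef_is_zero cosel_intros
  show "rvfam n (Suc (k + k')) (join k R R')" unfolding join_def
    by (rule rvfamI, intro codef_disj codef_conj codef_not intros) (use inv in auto)
  show "rvfam n (Suc (k + k')) (refine k R R')" unfolding refine_def
    by (rule rvfamI, intro codef_iff codef_conj intros) (use inv in auto)
qed

lemma sim_join:
  assumes "sim (Suc (k + k')) (join k R R') a b"
  shows "sim k R a b" "sim k' R' a b"
proof -
  have z: "replicate j 0! \<in> tuples j D" for j by (auto simp: tuples_def)
  show "sim k R a b"
    unfolding sim_def
  proof
    fix \<xi> assume \<xi>: "\<xi> \<in> tuples k D"
    hence "0! # \<xi> @ replicate k' 0! \<in> tuples (Suc (k + k')) D" using z by auto
    thus "R a \<xi> \<longleftrightarrow> R b \<xi>"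
      using assms \<xi> unfolding sim_def by (fastforce simp: join_def is_zero_iff tuples_length)
  qed
  show "sim k' R' a b"
    unfolding sim_def
  proof
    fix \<xi> assume \<xi>: "\<xi> \<in> tuples k' D"
    hence "1! # replicate k 0! @ \<xi> \<in> tuples (Suc (k + k')) D" using z by auto
    thus "R' a \<xi> \<longleftrightarrow> R' b \<xi>"
      using assms \<xi> unfolding sim_def by (fastforce simp: join_def is_zero_iff tuples_length)
  qed
qed

text \<open>Here \<xi> may depend on \<open>a'\<close>, as the classes to be excluded are those over
  \<open>a'\<close>; only \<open>T\<close> and the length \<open>k'\<close> are uniform. In
  \<open>cover\<close> the choice of \<xi> precedes \<open>a'\<close>.\<close>

definition selects :: "nat \<Rightarrow> nat \<Rightarrow> nat \<Rightarrow> ('a list \<Rightarrow> 'a list \<Rightarrow> bool) \<Rightarrow> nat \<Rightarrow> ('a list \<Rightarrow> 'a list \<Rightarrow> bool) \<Rightarrow> bool" where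
  "selects m n k R k' T \<longleftrightarrow> (\<forall>a\<in>tuples n D. \<forall>a'\<in>tuples n D. \<forall>z\<in>tuples m D.
     \<exists>\<xi>\<in>tuples k' D. T (z @ a) \<xi> \<and> (\<forall>z'\<in>tuples m D. T (z' @ a') \<xi> \<longrightarrow> sim k R (z @ a) (z' @ a')))"

text \<open>Each of the finitely many classes left over by \<open>T\<close> is excluded by one more parameter that
  separates it from \<open>z\<close>; whether \<open>R\<close> holds there is recorded by the vanishing of a further
  parameter.\<close>

lemma selection_aux:
  assumes R: "rvfam (m + n) k R" and T: "rvfam (m + n) k' T"
    and cov: "\<And>a a' z. a \<in> tuples n D \<Longrightarrow> a' \<in> tuples n D \<Longrightarrow> z \<in> tuples m D \<Longrightarrow> \<exists>\<xi>\<in>tuples k' D. T (z @ a) \<xi> \<and>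
      (\<exists>Z\<subseteq>tuples m D. finite Z \<and> card Z \<le> N \<and> (\<forall>z'\<in>tuples m D. T (z' @ a') \<xi> \<longrightarrow>
         sim k R (z @ a) (z' @ a') \<or> (\<exists>u\<in>Z. sim k R (u @ a') (z' @ a'))))"
  shows "\<exists>k' T. rvfam (m + n) k' T \<and> selects m n k R k' T"
  using T cov
proof (induction N arbitrary: k' T)
  case 0
  have "\<exists>\<xi>\<in>tuples k' D. T (z @ a) \<xi> \<and> (\<forall>z'\<in>tuples m D. T (z' @ a') \<xi> \<longrightarrow> sim k R (z @ a) (z' @ a'))"
    if "a \<in> tuples n D" "a' \<in> tuples n D" "z \<in> tuples m D" for a a' z
    using "0.prems"(2)[OF that] by force
  thus ?case using "0.prems"(1) unfolding selects_def by blast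
next
  case (Suc N)
  show ?case
  \<comment> \<open>Passing to \<open>refine k R T\<close> spends one more block of parameters and
    lowers the bound on the unwanted classes by one.\<close>
  proof (rule Suc.IH)
    show "rvfam (m + n) (Suc (k + k')) (refine k R T)" by (rule rvfam_refine[OF R Suc.prems(1)])
    fix a a' z assume a: "a \<in> tuples n D" "a' \<in> tuples n D" and z: "z \<in> tuples m D"
    obtain \<xi> Z where \<xi>: "\<xi> \<in> tuples k' D" "T (z @ a) \<xi>" and Z: "Z \<subseteq> tuples m D" "finite Z" "card Z \<le> Suc N"
      and cov: "\<And>z'. z' \<in> tuples m D \<Longrightarrow> T (z' @ a') \<xi> \<Longrightarrow> sim k R (z @ a) (z' @ a') \<or> (\<exists>u\<in>Z. sim k R (u @ a') (z' @ a'))"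
      using Suc.prems(2)[OF a z] by blast
    define s where "s \<xi>1 = (if R (z @ a) \<xi>1 then 0! else 1!)" for \<xi>1
    have s: "s \<xi>1 \<in> D" "R (z @ a) \<xi>1 \<longleftrightarrow> is_zero M (s \<xi>1)" for \<xi>1 by (auto simp: s_def is_zero_iff)
    have tt: "refine k R T p (s \<xi>1 # \<xi>1 @ \<xi>) \<longleftrightarrow> T p \<xi> \<and> (R p \<xi>1 \<longleftrightarrow> is_zero M (s \<xi>1))" if "\<xi>1 \<in> tuples k D" for p \<xi>1
      using that by (simp add: refine_def tuples_length)
    have "\<exists>\<xi>1\<in>tuples k D. \<exists>Z\<subseteq>tuples m D. finite Z \<and> card Z \<le> N \<and> (\<forall>z'\<in>tuples m D. T (z' @ a') \<xi> \<longrightarrow>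
        (R (z' @ a') \<xi>1 \<longleftrightarrow> is_zero M (s \<xi>1)) \<longrightarrow> sim k R (z @ a) (z' @ a') \<or> (\<exists>u\<in>Z. sim k R (u @ a') (z' @ a')))"
    proof (cases "Z = {}")
      case True
      have "replicate k 0! \<in> tuples k D" by (auto simp: tuples_def)
      thus ?thesis using cov True by (intro bexI[of _ "replicate k 0!"] exI[of _ "{}"]) auto
    next
      case False
      then obtain u where u: "u \<in> Z" by blast
      have card: "card (Z - {u}) \<le> N" using u Z by simp
      show ?thesis
      proof (cases "sim k R (z @ a) (u @ a')")
        \<comment> \<open>Here \<open>u\<close> is in the class that is to be kept, so it leaves
          \<open>Z\<close> without being separated; the new block is filled arbitrarily.\<close>
        case True
        have "sim k R (z @ a) (z' @ a') \<or> (\<exists>u\<in>Z - {u}. sim k R (u @ a') (z' @ a'))"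
          if "z' \<in> tuples m D" "T (z' @ a') \<xi>" for z'
          using cov[OF that] sim_trans[OF True] by blast
        moreover have "replicate k 0! \<in> tuples k D" by (auto simp: tuples_def)
        ultimately show ?thesis using card Z
          by (intro bexI[of _ "replicate k 0!"] exI[of _ "Z - {u}"]) auto
      next
        case False
        then obtain \<xi>1 where \<xi>1: "\<xi>1 \<in> tuples k D" "R (z @ a) \<xi>1 \<noteq> R (u @ a') \<xi>1"
          unfolding sim_def by blast
        have "\<not> sim k R (u @ a') (z' @ a')" if "R (z' @ a') \<xi>1 \<longleftrightarrow> is_zero M (s \<xi>1)" for z'
          using that \<xi>1 s(2)[of \<xi>1] unfolding sim_def by blast
        thus ?thesis using cov card Z \<xi>1(1) by (intro bexI[of _ \<xi>1] exI[of _ "Z - {u}"]) blast+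
      qed
    qed
    then obtain \<xi>1 Z' where \<xi>1: "\<xi>1 \<in> tuples k D" and Z': "Z' \<subseteq> tuples m D" "finite Z'" "card Z' \<le> N"
      "\<forall>z'\<in>tuples m D. T (z' @ a') \<xi> \<longrightarrow>
        (R (z' @ a') \<xi>1 \<longleftrightarrow> is_zero M (s \<xi>1)) \<longrightarrow> sim k R (z @ a) (z' @ a') \<or> (\<exists>u\<in>Z'. sim k R (u @ a') (z' @ a'))"
      by blast
    have "s \<xi>1 # \<xi>1 @ \<xi> \<in> tuples (Suc (k + k')) D" using s \<xi>1 \<xi> by auto
    thus "\<exists>\<xi>\<in>tuples (Suc (k + k')) D. refine k R T (z @ a) \<xi> \<and>
      (\<exists>Z\<subseteq>tuples m D. finite Z \<and> card Z \<le> N \<and> (\<forall>z'\<in>tuples m D. refine k R T (z' @ a') \<xi> \<longrightarrow>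
         sim k R (z @ a) (z' @ a') \<or> (\<exists>u\<in>Z. sim k R (u @ a') (z' @ a'))))"
      using Z' tt[OF \<xi>1] s(2) \<xi>(2) by (intro bexI[of _ "s \<xi>1 # \<xi>1 @ \<xi>"] conjI exI[of _ Z']) auto
  qed
qed

lemma selection:
  assumes R: "rvfam (m + n) k R" and cov: "cover m n k R k' T N"
  shows "\<exists>k' T. rvfam (m + n) k' T \<and> selects m n k R k' T"
proof (rule selection_aux[OF R])
  show "rvfam (m + n) k' T" using cov by (simp add: cover_def)
  fix a a' z assume a: "a \<in> tuples n D" "a' \<in> tuples n D" and z: "z \<in> tuples m D"
  obtain \<xi> where \<xi>: "\<xi> \<in> tuples k' D" "T (z @ a) \<xi>" and Z: "\<forall>a'\<in>tuples n D. \<exists>Z\<subseteq>tuples m D. finite Z \<and> card Z \<le> N \<and>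
        (\<forall>z'\<in>tuples m D. T (z' @ a') \<xi> \<longrightarrow> (\<exists>u\<in>Z. sim k R (u @ a') (z' @ a')))"
    using cov a(1) z unfolding cover_def by blast
  obtain Z where "Z \<subseteq> tuples m D" "finite Z" "card Z \<le> N"
    "\<forall>z'\<in>tuples m D. T (z' @ a') \<xi> \<longrightarrow> (\<exists>u\<in>Z. sim k R (u @ a') (z' @ a'))"
    using Z a(2) by blast
  thus "\<exists>\<xi>\<in>tuples k' D. T (z @ a) \<xi> \<and>
      (\<exists>Z\<subseteq>tuples m D. finite Z \<and> card Z \<le> N \<and> (\<forall>z'\<in>tuples m D. T (z' @ a') \<xi> \<longrightarrow>
         sim k R (z @ a) (z' @ a') \<or> (\<exists>u\<in>Z. sim k R (u @ a') (z' @ a'))))"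
    using \<xi> by (intro bexI[of _ \<xi>] conjI exI[of _ Z]) auto
qed

lemma back_and_forth:
  assumes R: "rvfam (Suc n) k R"
  obtains k' R' where "rvfam n k' R'"
    "\<And>a b x. a \<in> tuples n D \<Longrightarrow> b \<in> tuples n D \<Longrightarrow> sim k' R' a b \<Longrightarrow> x \<in> D \<Longrightarrow> \<exists>x'\<in>D. sim k R (x # a) (x' # b)"
proof -
  have R1: "rvfam (1 + n) k R" using R by simp
  obtain k0 T0 N0 where "cover 1 n k R k0 T0 N0" using cover_one[OF R1] by blast
  from selection[OF R1 this] obtain k' T where T: "rvfam (1 + n) k' T"
    and sel: "selects 1 n k R k' T"
    by blast
  define R' where "R' a \<xi> \<longleftrightarrow> (\<exists>x\<in>D. T (x # a) \<xi>)" for a \<xi>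
  have one: "[x] \<in> tuples 1 D \<longleftrightarrow> x \<in> D" for x by (simp add: tuples_def)
  show thesis
  proof (rule that)
    show "rvfam n k' R'"
    proof (rule rvfamI)
      show "dfn L M (n + k') (\<lambda>e. R' (take n e) (drop n e))"
        unfolding R'_def by (intro codef_ex rvfam_codef[OF T] cosel_intros) auto
      show "R' a \<xi> \<longleftrightarrow> R' a \<xi>'" if "a \<in> tuples n D" "\<xi> \<in> tuples k' D" "\<xi>' \<in> tuples k' D" "list_all2 (rv1 M) \<xi> \<xi>'" for a \<xi> \<xi>'
        unfolding R'_def using rvfam_inv[OF T _ that(2-4)] that(1) by auto
    qed
    fix a b x assume a: "a \<in> tuples n D" and b: "b \<in> tuples n D" and s: "sim k' R' a b" and x: "x \<in> D"
    \<comment> \<open>The parameters are chosen for the pair of bases \<open>a\<close>,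
      \<open>b\<close>; similarity of the bases is then used only at this \<xi>, to find some
      element over \<open>b\<close> that satisfies \<open>T\<close>.\<close>
    obtain \<xi> where \<xi>: "\<xi> \<in> tuples k' D" "T ([x] @ a) \<xi>"
      "\<forall>z'\<in>tuples 1 D. T (z' @ b) \<xi> \<longrightarrow> sim k R ([x] @ a) (z' @ b)"
      using sel a b x one unfolding selects_def by blast
    have "R' a \<xi>" unfolding R'_def using x \<xi>(2) by auto
    hence "R' b \<xi>" using s \<xi>(1) by (simp add: sim_def)
    then obtain x' where "x' \<in> D" "T (x' # b) \<xi>" unfolding R'_def by blast
    thus "\<exists>x'\<in>D. sim k R (x # a) (x' # b)" using \<xi>(3)[rule_format, of "[x']"] one by auto
  qed
qed

text \<open>For a tuple with head \<open>x\<close> and tail \<open>y\<close>, first bound the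
  classes of \<open>y\<close>, then those of \<open>x\<close> over one representative of each class
  of \<open>y\<close>. The classes of \<open>y\<close> must be fine enough to move \<open>x\<close>
  between similar tails, so they are taken for the family that \<open>back_and_forth\<close>
  returns; the bounds multiply.\<close>

lemma cover_exists: "rvfam (m + n) k R \<Longrightarrow> \<exists>k' T N. cover m n k R k' T N"
proof (induction m arbitrary: k R)
  case 0
  have "cover 0 n k R 0 (\<lambda>_ _. True) 1"
    unfolding cover_def by (auto intro!: rvfamI codef_True exI[of _ "{[]}"])
  thus ?case by blast
next
  case (Suc m)
  hence R: "rvfam (Suc (m + n)) k R" by simp
  have R1: "rvfam (1 + (m + n)) k R" using R by simp
  obtain k1 T1 N1 where c1: "cover 1 (m + n) k R k1 T1 N1" using cover_one[OF R1] by blast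
  hence T1: "rvfam (Suc (m + n)) k1 T1" by (simp add: cover_def)
  obtain k2 R2 where R2: "rvfam (m + n) k2 R2" and bf: "\<And>a b x. a \<in> tuples (m + n) D \<Longrightarrow> b \<in> tuples (m + n) D \<Longrightarrow>
      sim k2 R2 a b \<Longrightarrow> x \<in> D \<Longrightarrow> \<exists>x'\<in>D. sim (Suc (k + k1)) (join k R T1) (x # a) (x' # b)"
    by (rule back_and_forth[OF rvfam_join[OF R T1]], rule that)
  obtain k3 T3 N3 where c3: "cover m n k2 R2 k3 T3 N3" using Suc.IH[OF R2] by blast
  hence T3: "rvfam (m + n) k3 T3" by (simp add: cover_def)
  define T where "T p \<zeta> \<longleftrightarrow> T1 p (take k1 \<zeta>) \<and> T3 (tl p) (drop k1 \<zeta>)" for p \<zeta>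
  have T: "rvfam (Suc m + n) (k1 + k3) T"
  proof (rule rvfamI)
    show "dfn L M (Suc m + n + (k1 + k3)) (\<lambda>e. T (take (Suc m + n) e) (drop (Suc m + n) e))"
      unfolding T_def by (intro codef_conj rvfam_codef[OF T1] rvfam_codef[OF T3] cosel_intros) auto
    fix a \<xi> \<xi>' assume *: "a \<in> tuples (Suc m + n) D" "\<xi> \<in> tuples (k1 + k3) D" "\<xi>' \<in> tuples (k1 + k3) D" "list_all2 (rv1 M) \<xi> \<xi>'"
    have "T1 a (take k1 \<xi>) \<longleftrightarrow> T1 a (take k1 \<xi>')"
      by (rule rvfam_inv[OF T1]) (use * in \<open>auto intro: tuples_take list_all2_takeI\<close>)
    moreover have "T3 (tl a) (drop k1 \<xi>) \<longleftrightarrow> T3 (tl a) (drop k1 \<xi>')"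
      by (rule rvfam_inv[OF T3]) (use * in \<open>auto intro: tuples_drop tuples_tl list_all2_dropI\<close>)
    ultimately show "T a \<xi> \<longleftrightarrow> T a \<xi>'" by (simp add: T_def)
  qed
  have "cover (Suc m) n k R (k1 + k3) T (N3 * N1)"
    unfolding cover_def
  proof (intro conjI T ballI)
    fix a z assume a: "a \<in> tuples n D" and "z \<in> tuples (Suc m) D"
    then obtain x y where z: "z = x # y" "x \<in> D" "y \<in> tuples m D" by (auto elim: tuples_SucE)
    have ya: "y @ a \<in> tuples (m + n) D" using z a by auto
    have x1: "[x] \<in> tuples 1 D" using z by (simp add: tuples_def)
    obtain \<xi>1 where \<xi>1: "\<xi>1 \<in> tuples k1 D" "T1 ([x] @ y @ a) \<xi>1"
      and cov1: "\<forall>a'\<in>tuples (m + n) D. \<exists>Z\<subseteq>tuples 1 D. finite Z \<and> card Z \<le> N1 \<and>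
        (\<forall>z'\<in>tuples 1 D. T1 (z' @ a') \<xi>1 \<longrightarrow> (\<exists>u\<in>Z. sim k R (u @ a') (z' @ a')))"
      using c1 ya x1 unfolding cover_def by blast
    obtain \<xi>3 where \<xi>3: "\<xi>3 \<in> tuples k3 D" "T3 (y @ a) \<xi>3"
      and cov3: "\<forall>a'\<in>tuples n D. \<exists>Z\<subseteq>tuples m D. finite Z \<and> card Z \<le> N3 \<and>
        (\<forall>z'\<in>tuples m D. T3 (z' @ a') \<xi>3 \<longrightarrow> (\<exists>u\<in>Z. sim k2 R2 (u @ a') (z' @ a')))"
      using c3 a z(3) unfolding cover_def by blast
    have TT: "T p (\<xi>1 @ \<xi>3) \<longleftrightarrow> T1 p \<xi>1 \<and> T3 (tl p) \<xi>3" for p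
      using \<xi>1(1) by (simp add: T_def tuples_length)
    have "\<exists>Z\<subseteq>tuples (Suc m) D. finite Z \<and> card Z \<le> N3 * N1 \<and>
        (\<forall>z'\<in>tuples (Suc m) D. T (z' @ a') (\<xi>1 @ \<xi>3) \<longrightarrow> (\<exists>u\<in>Z. sim k R (u @ a') (z' @ a')))" if a': "a' \<in> tuples n D" for a'
    proof -
      obtain Z3 where Z3: "Z3 \<subseteq> tuples m D" "finite Z3" "card Z3 \<le> N3"
        "\<forall>z'\<in>tuples m D. T3 (z' @ a') \<xi>3 \<longrightarrow> (\<exists>u\<in>Z3. sim k2 R2 (u @ a') (z' @ a'))"
        using cov3 a' by blast
      have "\<forall>u\<in>Z3. \<exists>Z\<subseteq>tuples 1 D. finite Z \<and> card Z \<le> N1 \<and>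
        (\<forall>z'\<in>tuples 1 D. T1 (z' @ u @ a') \<xi>1 \<longrightarrow> (\<exists>v\<in>Z. sim k R (v @ u @ a') (z' @ u @ a')))"
        using cov1 Z3(1) a' tuples_append by blast
      then obtain Y where Y: "\<forall>u\<in>Z3. Y u \<subseteq> tuples 1 D \<and> finite (Y u) \<and> card (Y u) \<le> N1 \<and>
        (\<forall>z'\<in>tuples 1 D. T1 (z' @ u @ a') \<xi>1 \<longrightarrow> (\<exists>v\<in>Y u. sim k R (v @ u @ a') (z' @ u @ a')))"
        by metis
      define Z where "Z = (\<Union>u\<in>Z3. (\<lambda>v. v @ u) ` Y u)"
      have "v @ u \<in> tuples (Suc m) D" if "u \<in> Z3" "v \<in> Y u" for u v
        using that Y Z3(1) tuples_append[of v 1 D u m] by auto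
      hence "Z \<subseteq> tuples (Suc m) D" unfolding Z_def by blast
      moreover have "finite Z" unfolding Z_def using Z3 Y by blast
      moreover have "card Z \<le> N3 * N1"
      proof -
        have "card Z \<le> (\<Sum>u\<in>Z3. card ((\<lambda>v. v @ u) ` Y u))" unfolding Z_def by (rule card_UN_le[OF Z3(2)])
        also have "\<dots> \<le> (\<Sum>u\<in>Z3. N1)"
          by (rule sum_mono) (use Y card_image_le le_trans in blast)
        also have "\<dots> \<le> N3 * N1" using Z3(3) by simp
        finally show ?thesis .
      qed
      moreover have "\<exists>u\<in>Z. sim k R (u @ a') (z' @ a')"
        if z': "z' \<in> tuples (Suc m) D" and Tz': "T (z' @ a') (\<xi>1 @ \<xi>3)" for z'
      proof -
        obtain x' y' where xy': "z' = x' # y'" "x' \<in> D" "y' \<in> tuples m D" using z' by (auto elim: tuples_SucE)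
        have T13: "T1 (x' # y' @ a') \<xi>1" "T3 (y' @ a') \<xi>3" using Tz' unfolding TT xy' by auto
        obtain u where u: "u \<in> Z3" "sim k2 R2 (u @ a') (y' @ a')" using Z3(4) T13(2) xy'(3) by blast
        have ua: "u @ a' \<in> tuples (m + n) D" using u(1) Z3(1) a' by blast
        \<comment> \<open>Moves \<open>x'\<close> from the tail \<open>y'\<close> to the
          representative \<open>u\<close>. Preserving \<open>T1\<close> puts \<open>x''\<close>
          among the elements counted over \<open>u\<close>; preserving \<open>R\<close> carries the
          class found there back to the original tuple.\<close>
        obtain x'' where x'': "x'' \<in> D" "sim (Suc (k + k1)) (join k R T1) (x' # y' @ a') (x'' # u @ a')"
          using bf[OF tuples_append[OF xy'(3) a'] ua sim_sym[OF u(2)] xy'(2)] by blast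
        note s = sim_join[OF x''(2)]
        have "T1 ([x''] @ u @ a') \<xi>1" using s(2) T13(1) \<xi>1(1) by (simp add: sim_def)
        moreover have "[x''] \<in> tuples 1 D" using x''(1) by (simp add: tuples_def)
        ultimately obtain v where v: "v \<in> Y u" "sim k R (v @ u @ a') ([x''] @ u @ a')" using Y u(1) by blast
        have "sim k R (v @ u @ a') (x' # y' @ a')" using sim_trans[OF v(2)] sim_sym[OF s(1)] by simp
        thus ?thesis unfolding Z_def xy' using u(1) v(1) by (intro bexI[of _ "v @ u"]) auto
      qed
      ultimately show ?thesis by blast
    qed
    moreover have "T (z @ a) (\<xi>1 @ \<xi>3)" using \<xi>1(2) \<xi>3(2) by (simp add: TT z)
    ultimately show "\<exists>\<xi>\<in>tuples (k1 + k3) D. T (z @ a) \<xi> \<and> (\<forall>a'\<in>tuples n D. \<exists>Z\<subseteq>tuples (Suc m) D. finite Z \<and> card Z \<le> N3 * N1 \<and>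
        (\<forall>z'\<in>tuples (Suc m) D. T (z' @ a') \<xi> \<longrightarrow> (\<exists>u\<in>Z. sim k R (u @ a') (z' @ a'))))"
      using \<xi>1(1) \<xi>3(1) by (intro bexI[of _ "\<xi>1 @ \<xi>3"] conjI ballI) auto
  qed
  thus ?case by blast
qed

end

section \<open>Elimination of the predicates on leading terms\<close>

lemma wf_fm_extend:
  assumes "wf_fm L n \<phi>" "farity L' = farity L" "parity L \<subseteq>\<^sub>m parity L'"
  shows "wf_fm L' n \<phi>"
proof -
  have "wf_fm L' n (map_fm id id \<phi>)"
    by (rule wf_fm_map[OF assms(1,2)]) (use assms(3) in \<open>auto simp: map_le_def dom_def\<close>)
  thus ?thesis by (simp add: fm.map_id)
qed

lemma wf_trm_cong: "farity L' = farity L \<Longrightarrow> wf_trm L' n t = wf_trm L n t"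
  by (induction t) auto

lemma farity_imag [simp]: "farity (lang_imag L \<Xi>) = farity L"
  by (simp add: lang_imag_def)

lemma val_struct_imag [simp]: "val (struct_imag M) = val M"
proof -
  have "val (struct_imag M) e t = val M e t" for e t
    by (induction t) (auto simp: struct_imag_def cong: map_cong)
  thus ?thesis by (simp add: fun_eq_iff)
qed

lemma wf_trm_imag [simp]: "wf_trm (lang_imag L \<Xi>) n t = wf_trm L n t"
  by (rule wf_trm_cong) simp

lemma parity_imag [simp]:
  "parity (lang_imag L \<Xi>) (Inl p) = parity L p"
  "parity (lang_imag L \<Xi>) (Inr \<xi>) = (if \<xi> \<in> \<Xi> then Some 1 else None)"
  by (simp_all add: lang_imag_def)

lemma rel_of_struct_imag [simp]:
  "rel_of (struct_imag M) (Inl p) = rel_of M p"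
  "rel_of (struct_imag M) (Inr \<xi>) xs \<longleftrightarrow> hd xs \<in> \<xi>"
  by (simp_all add: struct_imag_def)

lemma wf_fm_imag_mono: "wf_fm (lang_imag L \<Xi>) n \<phi> \<Longrightarrow> \<Xi> \<subseteq> \<Xi>' \<Longrightarrow> wf_fm (lang_imag L \<Xi>') n \<phi>"
proof (induction \<phi> arbitrary: n)
  case (Rel q ts)
  thus ?case by (cases q) (auto split: if_splits)
qed auto

text \<open>A formula mentions finitely many parameters; this reduces countable sets
  \<open>A'\<close> to finite tuples of classes.\<close>

lemma wf_fm_imag_finite:
  "wf_fm (lang_imag L (B \<union> A)) n \<phi> \<Longrightarrow> \<exists>A0\<subseteq>A. finite A0 \<and> wf_fm (lang_imag L (B \<union> A0)) n \<phi>"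
proof (induction \<phi> arbitrary: n)
  case (Eq s t)
  thus ?case by (intro exI[of _ "{}"]) auto
next
  case (Rel q ts)
  show ?case
  proof (cases q)
    case (Inl p)
    thus ?thesis using Rel by (intro exI[of _ "{}"]) auto
  next
    case (Inr \<xi>)
    thus ?thesis using Rel by (intro exI[of _ "{\<xi>} \<inter> A"]) (auto split: if_splits)
  qed
next
  case (Conj \<phi> \<psi>)
  obtain A1 where 1: "A1 \<subseteq> A" "finite A1" "wf_fm (lang_imag L (B \<union> A1)) n \<phi>"
    using Conj.IH(1)[of n] Conj.prems by auto
  obtain A2 where 2: "A2 \<subseteq> A" "finite A2" "wf_fm (lang_imag L (B \<union> A2)) n \<psi>"
    using Conj.IH(2)[of n] Conj.prems by auto
  have "wf_fm (lang_imag L (B \<union> (A1 \<union> A2))) n (Conj \<phi> \<psi>)"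
    using wf_fm_imag_mono[OF 1(3), of "B \<union> (A1 \<union> A2)"] wf_fm_imag_mono[OF 2(3), of "B \<union> (A1 \<union> A2)"]
    by auto
  thus ?case using 1 2 by (intro exI[of _ "A1 \<union> A2"]) simp
qed auto

text \<open>The new predicates are required to be invariant under equality of leading terms, not to
  be preimages of given relations: invariance is expressed by sentences and so passes to all models
  of the theory of the expansion.\<close>

locale rv_expansion = prepared_model M L h
  for M :: "('a, 'f, 'p) vstruct" and L :: "('f, 'p) vlang" and h :: enat +
  fixes L' :: "('f, 'p) vlang"
  assumes farity_L': "farity L' = farity L" and parity_L': "parity L \<subseteq>\<^sub>m parity L'"
    and inv: "parity L p = None \<Longrightarrow> parity L' p = Some n \<Longrightarrow> xs \<in> tuples n D \<Longrightarrow> ys \<in> tuples n D \<Longrightarrow>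
      list_all2 (rv1 M) xs ys \<Longrightarrow> rel_of M p xs \<longleftrightarrow> rel_of M p ys"
begin

abbreviation "isat \<equiv> sat (struct_imag M)"

text \<open>Without index parameters, similarity is plain agreement on \<open>R\<close>.\<close>

lemma rvfam_plain:
  assumes "dfn L M n R"
  shows "rvfam n 0 (\<lambda>e _. R e)"
  by (rule rvfamI) (use codef_app[OF assms cosel_take[OF cosel_id], of n n] in auto)

text \<open>All ways to present the same classes by a level and a tuple; exactly the pairs over
  which \<open>instances\<close> quantifies.\<close>

definition reps :: "nat \<Rightarrow> 'a \<Rightarrow> 'a list \<Rightarrow> 'a list set" where
  "reps m l w = {l' # w' | l' w'. l' \<in> D \<and> level M l' \<and> w' \<in> tuples m D \<and>
     (\<forall>i<m. \<forall>t\<in>D. rveq M l' t (w' ! i) \<longleftrightarrow> rveq M l t (w ! i))}"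

lemma reps_tuples: "z \<in> reps m l w \<Longrightarrow> z \<in> tuples (Suc m) D"
  by (auto simp: reps_def)

text \<open>The representatives stand behind the environment, out of the way of the entries that
  \<open>Exi\<close> pushes to the front. \<open>z\<close> and \<open>z'\<close> may differ, since
  the presentation of the classes is not fixed.\<close>

definition decides :: "nat \<Rightarrow> 'a \<Rightarrow> 'a list \<Rightarrow> nat \<Rightarrow> nat \<Rightarrow> ('a list \<Rightarrow> 'a list \<Rightarrow> bool) \<Rightarrow>
    ('f vfun, 'p vpred + 'a set) fm \<Rightarrow> bool" where
  "decides m l w n k R \<Phi> \<longleftrightarrow> (\<forall>a\<in>tuples n D. \<forall>a'\<in>tuples n D. \<forall>z\<in>reps m l w. \<forall>z'\<in>reps m l w.
     sim k R (a @ z) (a' @ z') \<longrightarrow> (isat a \<Phi> \<longleftrightarrow> isat a' \<Phi>))"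

text \<open>A new atomic formula depends only on the leading terms of its arguments, which
  similarity can detect, and class parameters are expressed through their representatives.
  Conjunctions use \<open>join\<close>, quantifiers use \<open>back_and_forth\<close> with the
  representatives as part of the base.\<close>

lemma elimination:
  assumes l: "l \<in> levels" and w: "w \<in> tuples m D"
    and "wf_fm (lang_imag L' (RV M (vone M) \<union> rv M (vabs M l) ` set w)) n \<Phi>"
  shows "\<exists>k R. rvfam (n + Suc m) k R \<and> decides m l w n k R \<Phi>"
  using assms(3)
proof (induction \<Phi> arbitrary: n)
  case (Eq s t)
  have wf: "wf_fm L n (Eq s t)"
    using Eq by (simp add: wf_trm_cong[OF farity_L'])
  have "rvfam (n + Suc m) 0 (\<lambda>e _. sat M (take n e) (Eq s t))"
    by (intro rvfam_plain codef_sat[OF wf] cosel_intros) auto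
  moreover have "sim 0 (\<lambda>e _. sat M (take n e) (Eq s t)) (a @ z) (a' @ z') \<longrightarrow>
     (isat a (Eq s t) \<longleftrightarrow> isat a' (Eq s t))" if "a \<in> tuples n D" "a' \<in> tuples n D" for a a' z z'
    using that by (simp add: sim_def tuples_length)
  ultimately show ?case unfolding decides_def by blast
next
  case (Rel q ts)
  have wft: "wf_trm L n t" if "t \<in> set ts" for t
    using Rel.prems that by (auto simp: wf_trm_cong[OF farity_L'])
  have vD: "val M a t \<in> D" if "a \<in> tuples n D" "t \<in> set ts" for a t
    using that wft by (intro val_in_dom[OF struct]) (auto simp: tuples_def)
  consider p where "q = Inl p" "parity L p = Some (length ts)"
    | p where "q = Inl p" "parity L p = None" "parity L' p = Some (length ts)"
    | c t where "q = Inr (rv M (vone M) c)" "c \<in> D" "ts = [t]"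
    | i t where "q = Inr (rv M (vabs M l) (w ! i))" "i < m" "ts = [t]"
  proof (cases q)
    case (Inl p)
    hence "parity L' p = Some (length ts)" using Rel by simp
    moreover have "parity L p = None \<or> parity L p = parity L' p"
      using parity_L' unfolding map_le_def dom_def by auto
    ultimately show ?thesis using that Inl by auto
  next
    case (Inr \<xi>)
    hence "\<xi> \<in> RV M (vone M) \<union> rv M (vabs M l) ` set w" "length ts = 1"
      using Rel by (auto split: if_splits)
    thus ?thesis using that(3,4) Inr w RV_eq[OF one_level]
      by (auto simp: vone_eq length_Suc_conv in_set_conv_nth tuples_length)
  qed
  thus ?case
  proof cases
    case 1
    hence wf: "wf_fm L n (Rel p ts)" using wft by simp
    have "rvfam (n + Suc m) 0 (\<lambda>e _. sat M (take n e) (Rel p ts))"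
      by (intro rvfam_plain codef_sat[OF wf] cosel_intros) auto
    moreover have "sim 0 (\<lambda>e _. sat M (take n e) (Rel p ts)) (a @ z) (a' @ z') \<longrightarrow>
       (isat a (Rel q ts) \<longleftrightarrow> isat a' (Rel q ts))" if "a \<in> tuples n D" "a' \<in> tuples n D" for a a' z z'
      using that 1 by (simp add: sim_def tuples_length)
    ultimately show ?thesis unfolding decides_def by blast
  next
    case 2
    \<comment> \<open>The family names the leading terms of the arguments and does not involve the
      new predicate \<open>p\<close>.\<close>
    define R where "R e \<xi> \<longleftrightarrow> (\<forall>i<length ts. \<exists>d\<in>D. val M (take n e) (ts ! i) = d \<and> rv1 M d (\<xi> ! i))" for e \<xi>
    have "rvfam (n + Suc m) (length ts) R"
    proof (rule rvfamI)
      show "dfn L M (n + Suc m + length ts) (\<lambda>e. R (take (n + Suc m) e) (drop (n + Suc m) e))"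
        unfolding R_def
      proof (intro codef_all_less codef_ex codef_conj)
        fix i assume i: "i < length ts"
        show "dfn L M (Suc (n + Suc m + length ts)) (\<lambda>e. val M (take n (take (n + Suc m) (tl e))) (ts ! i) = hd e)"
          by (intro codef_val[OF wft] cosel_intros) (use i in auto)
        show "dfn L M (Suc (n + Suc m + length ts)) (\<lambda>e. rv1 M (hd e) (drop (n + Suc m) (tl e) ! i))"
          by (intro codef_rv1 cosel_intros) (use i in auto)
      qed
      fix a \<xi> \<xi>' assume *: "\<xi> \<in> tuples (length ts) D" "\<xi>' \<in> tuples (length ts) D" "list_all2 (rv1 M) \<xi> \<xi>'"
      show "R a \<xi> \<longleftrightarrow> R a \<xi>'" unfolding R_def using rv1_cong_nth[OF *] by (simp cong: bex_cong conj_cong)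
    qed
    moreover have "isat a (Rel q ts) \<longleftrightarrow> isat a' (Rel q ts)"
      if a: "a \<in> tuples n D" "a' \<in> tuples n D" and s: "sim (length ts) R (a @ z) (a' @ z')" for a a' z z'
    proof -
      let ?v = "map (val M a) ts" and ?v' = "map (val M a') ts"
      have v: "?v \<in> tuples (length ts) D" "?v' \<in> tuples (length ts) D" using vD a by auto
      have R: "R (b @ y) \<xi> \<longleftrightarrow> (\<forall>i<length ts. rv1 M (val M b (ts ! i)) (\<xi> ! i))" if "b \<in> tuples n D" for b y \<xi>
        using vD[OF that] that unfolding R_def by (auto simp: tuples_length)
      \<comment> \<open>Testing the similarity at the values over \<open>a'\<close> themselves shows
        that the arguments over \<open>a\<close> have the same leading terms.\<close>
      have "R (a' @ z') ?v'" unfolding R[OF a(2)] using vD[OF a(2)] by (auto intro: rv1_refl)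
      hence "R (a @ z) ?v'" using s v by (simp add: sim_def)
      hence "list_all2 (rv1 M) ?v ?v'" unfolding R[OF a(1)] by (simp add: list_all2_conv_all_nth)
      from inv[OF 2(2,3) v this] show ?thesis using 2(1) by simp
    qed
    ultimately show ?thesis unfolding decides_def by blast
  next
    case 3
    define R where "R e \<xi> \<longleftrightarrow> (\<exists>d\<in>D. val M (take n e) t = d \<and> rv1 M d (\<xi> ! 0))" for e \<xi>
    have wt: "wf_trm L n t" using wft 3 by simp
    have "rvfam (n + Suc m) 1 R"
    proof (rule rvfamI)
      show "dfn L M (n + Suc m + 1) (\<lambda>e. R (take (n + Suc m) e) (drop (n + Suc m) e))"
        unfolding R_def by (intro codef_ex codef_conj codef_val[OF wt] codef_rv1 cosel_intros) auto
      fix a \<xi> \<xi>' assume *: "\<xi> \<in> tuples 1 D" "\<xi>' \<in> tuples 1 D" "list_all2 (rv1 M) \<xi> \<xi>'"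
      show "R a \<xi> \<longleftrightarrow> R a \<xi>'" unfolding R_def using rv1_cong_nth[OF *] by (simp cong: bex_cong conj_cong)
    qed
    moreover have "isat a (Rel q ts) \<longleftrightarrow> isat a' (Rel q ts)"
      if a: "a \<in> tuples n D" "a' \<in> tuples n D" and s: "sim 1 R (a @ z) (a' @ z')" for a a' z z'
    proof -
      have sat: "isat b (Rel q ts) \<longleftrightarrow> R (b @ y) [c]" if "b \<in> tuples n D" for b y
      proof -
        have "val M b t \<in> D" using vD that 3 by simp
        hence "R (b @ y) [c] \<longleftrightarrow> rv M (vone M) (val M b t) = rv M (vone M) c"
          using that 3(2) unfolding R_def by (auto simp: tuples_length rv1_rv)
        also have "\<dots> \<longleftrightarrow> val M b t \<in> rv M (vone M) c"
          using mem_rv_iff[OF one_level \<open>val M b t \<in> D\<close> 3(2)] by (simp add: vone_eq)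
        finally show ?thesis using 3 by simp
      qed
      have "[c] \<in> tuples 1 D" using 3(2) by (simp add: tuples_def)
      thus ?thesis using s sat[OF a(1), of z] sat[OF a(2), of z'] by (simp add: sim_def)
    qed
    ultimately show ?thesis unfolding decides_def by blast
  next
    case 4
    \<comment> \<open>Behind the environment of length \<open>n\<close>, entry \<open>n\<close> is
      the level and entry \<open>Suc (n + i)\<close> represents the class in question.\<close>
    define R where "R e \<longleftrightarrow> (\<exists>d\<in>D. val M (take n e) t = d \<and> rveq M (e ! n) d (e ! (Suc (n + i))))" for e
    have wt: "wf_trm L n t" using wft 4 by simp
    have "rvfam (n + Suc m) 0 (\<lambda>e _. R e)"
      unfolding R_def
      by (intro rvfam_plain codef_ex codef_conj codef_val[OF wt] codef_rveq cosel_intros) (use 4(2) in auto)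
    moreover have "isat a (Rel q ts) \<longleftrightarrow> isat a' (Rel q ts)"
      if a: "a \<in> tuples n D" "a' \<in> tuples n D" and z: "z \<in> reps m l w" "z' \<in> reps m l w"
        and s: "sim 0 (\<lambda>e _. R e) (a @ z) (a' @ z')" for a a' z z'
    proof -
      have sat: "isat b (Rel q ts) \<longleftrightarrow> R (b @ y)" if b: "b \<in> tuples n D" and y: "y \<in> reps m l w" for b y
      proof -
        have v: "val M b t \<in> D" using vD b 4 by simp
        obtain l' w' where y': "y = l' # w'" "\<forall>i<m. \<forall>t\<in>D. rveq M l' t (w' ! i) \<longleftrightarrow> rveq M l t (w ! i)"
          using y unfolding reps_def by blast
        have "R (b @ y) \<longleftrightarrow> rveq M l' (val M b t) (w' ! i)"
          using v b unfolding R_def y'(1) by (auto simp: tuples_length nth_append)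
        also have "\<dots> \<longleftrightarrow> rveq M l (val M b t) (w ! i)" using y'(2) 4(2) v by blast
        also have "\<dots> \<longleftrightarrow> val M b t \<in> rv M (vabs M l) (w ! i)"
          using v rv_eq[OF l tuples_nth[OF w 4(2)]] by simp
        finally show ?thesis using 4 by simp
      qed
      show ?thesis using s sat[OF a(1) z(1)] sat[OF a(2) z(2)] by (simp add: sim_def)
    qed
    ultimately show ?thesis unfolding decides_def by blast
  qed
next
  case (Neg \<Phi>)
  thus ?case by (simp add: decides_def)
next
  case (Conj \<Phi> \<Psi>)
  obtain k R where R: "rvfam (n + Suc m) k R"
    "decides m l w n k R \<Phi>"
    using Conj.IH(1)[of n] Conj.prems by auto
  obtain k' R' where R': "rvfam (n + Suc m) k' R'"
    "decides m l w n k' R' \<Psi>"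
    using Conj.IH(2)[of n] Conj.prems by auto
  have "decides m l w n (Suc (k + k')) (join k R R') (Conj \<Phi> \<Psi>)"
    unfolding decides_def
  proof (intro ballI impI)
    fix a a' z z' assume a: "a \<in> tuples n D" "a' \<in> tuples n D" and z: "z \<in> reps m l w" "z' \<in> reps m l w"
      and s: "sim (Suc (k + k')) (join k R R') (a @ z) (a' @ z')"
    show "isat a (Conj \<Phi> \<Psi>) \<longleftrightarrow> isat a' (Conj \<Phi> \<Psi>)"
      using R(2)[unfolded decides_def, rule_format, OF a z sim_join(1)[OF s]] R'(2)[unfolded decides_def, rule_format, OF a z sim_join(2)[OF s]] by simp
  qed
  thus ?case using rvfam_join[OF R(1) R'(1)] by blast
next
  case (Exi \<Phi>)
  obtain k R where R: "rvfam (Suc n + Suc m) k R"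
    "decides m l w (Suc n) k R \<Phi>"
    using Exi.IH[of "Suc n"] Exi.prems by auto
  have RS: "rvfam (Suc (n + Suc m)) k R" using R(1) by simp
  obtain k' R' where R': "rvfam (n + Suc m) k' R'" and bf: "\<And>a b x. a \<in> tuples (n + Suc m) D \<Longrightarrow> b \<in> tuples (n + Suc m) D \<Longrightarrow>
      sim k' R' a b \<Longrightarrow> x \<in> D \<Longrightarrow> \<exists>x'\<in>D. sim k R (x # a) (x' # b)"
    by (rule back_and_forth[OF RS], rule that)
  have half: "isat a' (Exi \<Phi>)"
    if a: "a \<in> tuples n D" "a' \<in> tuples n D" and z: "z \<in> reps m l w" "z' \<in> reps m l w"
      and s: "sim k' R' (a @ z) (a' @ z')" and sat: "isat a (Exi \<Phi>)" for a a' z z'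
  proof -
    obtain x where x: "x \<in> D" "isat (x # a) \<Phi>" using sat by auto
    obtain x' where x': "x' \<in> D" "sim k R (x # a @ z) (x' # a' @ z')"
      using bf[OF tuples_append[OF a(1) reps_tuples[OF z(1)]] tuples_append[OF a(2) reps_tuples[OF z(2)]] s x(1)] by blast
    have "isat (x' # a') \<Phi>"
      using R(2)[unfolded decides_def, rule_format, of "x # a" "x' # a'" z z'] a x x' z by simp
    thus ?thesis using x'(1) by auto
  qed
  have "decides m l w n k' R' (Exi \<Phi>)"
    unfolding decides_def using half sim_sym by blast
  thus ?case using R' by blast
qed

end

context rv_expansion
begin

text \<open>Let \<open>T\<close> select the class of a representing pair and \<open>x\<close>
  together. For fixed \<xi>, the \<open>x\<close> that admit some representing pair allowed by
  \<open>T\<close> form a set covered by uniform preparation in \<open>L\<close>. If \<xi> fits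
  \<open>x\<close> and \<open>x'\<close> is not separated from \<open>x\<close> by the preparing
  set, then \<open>x'\<close> has such a pair too; the two tuples are similar, so \<Phi> holds at
  both or at neither.\<close>

lemma transport:
  assumes l: "l \<in> levels" and A: "A \<subseteq> D" and A': "A' \<subseteq> RV M (vabs M l)" "card_le A' h"
    and X: "definable L' M A (RV M (vone M) \<union> A') X"
  shows "\<exists>C. finite C \<and> definable L' M A {} C \<and> prepares M (vabs M l) C X"
proof -
  obtain \<Phi> as where as: "set as \<subseteq> A" and wf: "wf_fm (lang_imag L' (RV M (vone M) \<union> A')) (Suc (length as)) \<Phi>"
    and X_eq: "X = {x \<in> D. isat (x # as) \<Phi>}"
    using X unfolding definable_def by blast
  obtain A0 where A0: "A0 \<subseteq> A'" "finite A0" and wf0: "wf_fm (lang_imag L' (RV M (vone M) \<union> A0)) (Suc (length as)) \<Phi>"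
    using wf_fm_imag_finite[OF wf] by blast
  obtain \<zeta>s where \<zeta>s: "set \<zeta>s = A0" "distinct \<zeta>s" using finite_distinct_list[OF A0(2)] by blast
  define m where "m = length \<zeta>s"
  have card: "m = card A0" using \<zeta>s distinct_card m_def by metis
  have m: "enat m \<le> h"
  proof (cases h)
    case (enat j)
    hence "finite A'" "card A' \<le> j" using A'(2) by (simp_all add: card_le_def)
    thus ?thesis using card_mono[of A' A0] A0(1) card enat by simp
  qed simp
  have "\<forall>\<zeta>\<in>A0. \<exists>c\<in>D. \<zeta> = rv M (vabs M l) c" using A0(1) A'(1) RV_eq[OF l] by blast
  then obtain c where c: "\<forall>\<zeta>\<in>A0. c \<zeta> \<in> D \<and> \<zeta> = rv M (vabs M l) (c \<zeta>)" by metis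
  define w where "w = map c \<zeta>s"
  have w: "w \<in> tuples m D" using c \<zeta>s by (auto simp: w_def m_def)
  have A0_eq: "A0 = rv M (vabs M l) ` set w"
  proof -
    have "rv M (vabs M l) ` set w = (\<lambda>\<zeta>. rv M (vabs M l) (c \<zeta>)) ` A0" using \<zeta>s by (auto simp: w_def)
    also have "\<dots> = (\<lambda>\<zeta>. \<zeta>) ` A0" using c by (intro image_cong) auto
    finally show ?thesis by simp
  qed
  define n where "n = length as"
  have as_t: "as \<in> tuples n D" using as A by (auto simp: n_def tuples_def)
  obtain k R where R: "rvfam (Suc n + Suc m) k R" and elim: "decides m l w (Suc n) k R \<Phi>"
    using elimination[OF l w wf0[unfolded A0_eq n_def[symmetric]]] by blast
  \<comment> \<open>The blocks are swapped because \<open>cover\<close> and \<open>selects\<close>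
    act on the front block, here the representatives.\<close>
  define R' where "R' p \<xi> \<longleftrightarrow> R (drop (Suc m) p @ take (Suc m) p) \<xi>" for p \<xi>
  have R': "rvfam (Suc m + Suc n) k R'"
  proof (rule rvfamI)
    show "dfn L M (Suc m + Suc n + k) (\<lambda>e. R' (take (Suc m + Suc n) e) (drop (Suc m + Suc n) e))"
      unfolding R'_def by (intro rvfam_codef[OF R] cosel_intros) auto
    show "R' a \<xi> \<longleftrightarrow> R' a \<xi>'" if "a \<in> tuples (Suc m + Suc n) D" "\<xi> \<in> tuples k D" "\<xi>' \<in> tuples k D" "list_all2 (rv1 M) \<xi> \<xi>'" for a \<xi> \<xi>'
    proof -
      have "drop (Suc m) a @ take (Suc m) a \<in> tuples (Suc n + Suc m) D"
        using that(1) by (intro tuples_append tuples_drop tuples_take) auto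
      thus ?thesis unfolding R'_def by (rule rvfam_inv[OF R _ that(2-4)])
    qed
  qed
  obtain k0 T0 N0 where "cover (Suc m) (Suc n) k R' k0 T0 N0" using cover_exists[OF R'] by blast
  from selection[OF R' this] obtain k' T where T: "rvfam (Suc m + Suc n) k' T"
    and sel: "selects (Suc m) (Suc n) k R' k' T"
    by blast
  \<comment> \<open>Restores the order of variables that \<open>instances\<close> expects.\<close>
  have "dfn L M (Suc n + Suc m + k') (\<lambda>e. T (take (Suc m) (drop (Suc n) e) @ take (Suc n) e) (drop (Suc n + Suc m) e))"
    by (intro rvfam_codef[OF T] cosel_intros) auto
  then obtain \<phi> where \<phi>: "wf_fm L (Suc n + Suc m + k') \<phi>"
    and sat_\<phi>: "\<forall>e\<in>tuples (Suc n + Suc m + k') D. sat M e \<phi> \<longleftrightarrow> T (take (Suc m) (drop (Suc n) e) @ take (Suc n) e) (drop (Suc n + Suc m) e)"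
    unfolding codef_def by blast
  have sat_T: "sat M (x # as @ l' # w' @ \<xi>) \<phi> \<longleftrightarrow> T ((l' # w') @ x # as) \<xi>"
    if "x \<in> D" "l' \<in> D" "w' \<in> tuples m D" "\<xi> \<in> tuples k' D" for x l' w' \<xi>
  proof -
    have "x # as @ l' # w' @ \<xi> \<in> tuples (Suc n + Suc m + k') D"
      using that as_t by (auto simp: tuples_def)
    thus ?thesis using sat_\<phi>[rule_format, of "x # as @ l' # w' @ \<xi>"] that as_t
      by (simp add: tuples_length)
  qed
  obtain P \<kappa> where P: "dfn L M (Suc n) P" and C: "prepares_instances M n m k' \<phi> P \<kappa>"
    using prep[OF m \<phi>] by blast
  let ?C = "{c \<in> D. P (c # as)}"
  have pr: "prepares M (vabs M l) ?C {x \<in> D. instances M m k' \<phi> as l w \<xi> x}" if "\<xi> \<in> tuples k' D" for \<xi>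
    using C as_t l w that unfolding prepares_instances_def by blast
  have fin: "finite ?C" using C as_t unfolding prepares_instances_def by blast
  have "dfn L' M (Suc n) P"
  proof -
    obtain \<psi> where \<psi>: "wf_fm L (Suc n) \<psi>" "\<forall>e\<in>tuples (Suc n) D. sat M e \<psi> \<longleftrightarrow> P e"
      using P unfolding codef_def by blast
    thus ?thesis by (intro codefI[OF wf_fm_extend[OF \<psi>(1) farity_L' parity_L']]) auto
  qed
  hence def: "definable L' M A {} ?C"
    by (rule definable_codefI[OF codef_imag as_t as])
  have lev: "level M l" "l \<in> D" using l levelsD(1) level_iff by auto
  have z: "l # w \<in> reps m l w" using w lev by (auto simp: reps_def)
  have half: "x' \<in> X" if x: "x \<in> D" "x' \<in> D" and eq: "\<forall>c\<in>?C. rveq M l (x -! c) (x' -! c)" and xX: "x \<in> X" for x x'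
  proof -
    have xas: "x # as \<in> tuples (Suc n) D" "x' # as \<in> tuples (Suc n) D" using x as_t by auto
    \<comment> \<open>This \<xi> depends on both \<open>x\<close> and \<open>x'\<close>, which is
      harmless as \<open>?C\<close> prepares the instances for all \<xi> simultaneously.\<close>
    obtain \<xi> where \<xi>: "\<xi> \<in> tuples k' D" "T ((l # w) @ x # as) \<xi>"
      and sel: "\<forall>z'\<in>tuples (Suc m) D. T (z' @ x' # as) \<xi> \<longrightarrow> sim k R' ((l # w) @ x # as) (z' @ x' # as)"
      using sel[unfolded selects_def, rule_format, OF xas reps_tuples[OF z]] by blast
    have "sat M (x # as @ l # w @ \<xi>) \<phi>" using sat_T[OF x(1) lev(2) w \<xi>(1)] \<xi>(2) by simp
    moreover have "\<forall>i<k'. rv1 M (\<xi> ! i) (\<xi> ! i)" using \<xi>(1) by (auto intro: rv1_refl tuples_nth)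
    ultimately have "instances M m k' \<phi> as l w \<xi> x"
      unfolding instances_def using lev w \<xi>(1) by blast
    hence "instances M m k' \<phi> as l w \<xi> x'"
      using pr[OF \<xi>(1)] x eq unfolding prepares_iff[OF l] by blast
    then obtain \<xi>' w' l' where *: "\<xi>' \<in> tuples k' D" "w' \<in> tuples m D" "l' \<in> D" "level M l'"
      "\<forall>i<m. \<forall>t\<in>D. rveq M l' t (w' ! i) \<longleftrightarrow> rveq M l t (w ! i)"
      "\<forall>i<k'. rv1 M (\<xi>' ! i) (\<xi> ! i)" "sat M (x' # as @ l' # w' @ \<xi>') \<phi>"
      unfolding instances_def by blast
    have z': "l' # w' \<in> reps m l w" using * by (auto simp: reps_def)
    have "T ((l' # w') @ x' # as) \<xi>'" using sat_T[OF x(2) *(3,2,1)] *(7) by simp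
    moreover have "(l' # w') @ x' # as \<in> tuples (Suc m + Suc n) D"
      using reps_tuples[OF z'] xas(2) by (rule tuples_append)
    moreover have "list_all2 (rv1 M) \<xi>' \<xi>" using * \<xi>(1) by (simp add: list_all2_conv_all_nth tuples_length)
    ultimately have "T ((l' # w') @ x' # as) \<xi>" using rvfam_inv[OF T _ *(1) \<xi>(1)] by blast
    hence "sim k R' ((l # w) @ x # as) ((l' # w') @ x' # as)" using sel reps_tuples[OF z'] by blast
    hence "sim k R ((x # as) @ l # w) ((x' # as) @ l' # w')"
      using w *(2) by (simp add: sim_def R'_def tuples_length)
    hence "isat (x # as) \<Phi> \<longleftrightarrow> isat (x' # as) \<Phi>"
      using elim xas z z' unfolding decides_def by blast
    thus ?thesis using xX x(2) by (simp add: X_eq)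
  qed
  have "replicate k' 0! \<in> tuples k' D" by (auto simp: tuples_def)
  hence ne: "?C \<noteq> {}" using pr unfolding prepares_def by blast
  have "prepares M (vabs M l) ?C X"
    unfolding prepares_iff[OF l]
  proof (intro conjI fin ne ballI impI)
    fix x x' assume x: "x \<in> D" "x' \<in> D" and eq: "\<forall>c\<in>?C. rveq M l (x -! c) (x' -! c)"
    have "\<forall>c\<in>?C. rveq M l (x' -! c) (x -! c)" using eq x rveq_sym[OF l] by auto
    thus "x \<in> X \<longleftrightarrow> x' \<in> X" using half x eq by blast
  qed auto
  thus ?thesis using fin def by blast
qed

end

section \<open>The given expansion and the models of its theory\<close>

lemma sat_agree:
  assumes K: "is_struct L K" and dom: "dom_of K' = dom_of K"
    and fn: "\<And>f n xs. farity L f = Some n \<Longrightarrow> xs \<in> tuples n (dom_of K) \<Longrightarrow> fun_of K' f xs = fun_of K f xs"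
    and rl: "\<And>p n xs. parity L p = Some n \<Longrightarrow> xs \<in> tuples n (dom_of K) \<Longrightarrow> rel_of K' p xs \<longleftrightarrow> rel_of K p xs"
  shows "wf_fm L (length e) \<phi> \<Longrightarrow> set e \<subseteq> dom_of K \<Longrightarrow> sat K' e \<phi> \<longleftrightarrow> sat K e \<phi>"
proof (induction \<phi> arbitrary: e)
  have val: "val K' e t = val K e t" if "wf_trm L (length e) t" "set e \<subseteq> dom_of K" for e t
    using that(1)
  proof (induction t)
    case (App f ts)
    have eq: "map (val K' e) ts = map (val K e) ts" using App by auto
    have "map (val K e) ts \<in> tuples (length ts) (dom_of K)"
      using val_in_dom[OF K _ that(2)] App.prems by auto
    thus ?case unfolding val.simps eq using fn[of f "length ts"] App.prems by simp
  qed simp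
  {
    case (Eq s t)
    thus ?case using val by simp
  next
    case (Rel p ts)
    have eq: "map (val K' e) ts = map (val K e) ts" using Rel val by auto
    have "map (val K e) ts \<in> tuples (length ts) (dom_of K)"
      using val_in_dom[OF K _ Rel(2)] Rel(1) by auto
    thus ?case unfolding sat.simps eq using rl[of p "length ts"] Rel by simp
  next
    case (Exi \<phi>)
    thus ?case using Exi.IH[of "_ # e"] by (auto simp: dom)
  }
qed auto

theorem theorem4p1p19:
  fixes K K' :: "('k, 'f, 'p) vstruct"
    and L L' :: "('f, 'p) vlang"
    and l :: enat
  assumes "contains_vf L"
    and "is_struct L K"
    and "valued_field K"
    and "equichar_0 K"
    and "l \<in> {0, 1, \<infinity>}"
    and "large_universe TYPE('u) L"
    and "h_minimal TYPE('u) l L (Th L K)"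
    and "RV_expansion L K L' K'"
  shows "h_minimal TYPE('v) l L' (Th L' K')"
proof -
  note L = assms(1) and K = assms(2) and vK = assms(3) and hmin = assms(7)
  have fa: "farity L' = farity L" and pa: "parity L \<subseteq>\<^sub>m parity L'" and dom: "dom_of K' = dom_of K"
    and fn: "\<And>f n xs. farity L f = Some n \<Longrightarrow> xs \<in> tuples n (dom_of K) \<Longrightarrow> fun_of K' f xs = fun_of K f xs"
    and rl: "\<And>p n xs. parity L p = Some n \<Longrightarrow> xs \<in> tuples n (dom_of K) \<Longrightarrow> rel_of K' p xs \<longleftrightarrow> rel_of K p xs"
    and new: "\<And>p n. parity L p = None \<Longrightarrow> parity L' p = Some n \<Longrightarrow> \<exists>P\<subseteq>tuples n (RV K (vone K)).
           \<forall>xs\<in>tuples n (dom_of K). rel_of K' p xs \<longleftrightarrow> map (rv K (vone K)) xs \<in> P"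
    using assms(8) unfolding RV_expansion_def by blast+
  have agree: "sat K' e \<phi> \<longleftrightarrow> sat K e \<phi>" if "wf_fm L n \<phi>" "e \<in> tuples n (dom_of K)" for n e \<phi>
    using sat_agree[OF K dom fn rl] that by (auto simp: tuples_def)
  have K': "is_struct L K'"
    using K fn unfolding is_struct_def dom by auto
  have vK': "valued_field K'"
    using vK agree[OF wf_vf_axioms[OF L], of "[]"] unfolding valued_field_iff[OF L K] valued_field_iff[OF L K'] by simp
  have L': "contains_vf L'"
  proof -
    have "ValRing \<in> dom (parity L)" using L by (simp add: contains_vf_def domI)
    hence "parity L' ValRing = parity L ValRing" using pa unfolding map_le_def by simp
    thus ?thesis using L fa by (simp add: contains_vf_def)
  qed
  interpret K: vfield K by unfold_locales fact
  interpret K': vfield K' by unfold_locales fact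
  interpret vL: vlang L by unfold_locales fact
  interpret vL': vlang L' by unfold_locales fact
  \<comment> \<open>Equality of leading terms is given by an \<open>L\<close>-formula, on which
    \<open>K\<close> and \<open>K'\<close> agree.\<close>
  have rv1_K: "rv1 K' x y \<longleftrightarrow> rv1 K x y" if "x \<in> dom_of K" "y \<in> dom_of K" for x y
  proof -
    have "codef L K K' 2 (\<lambda>e. rv1 K (e ! 0) (e ! 1)) (\<lambda>e. rv1 K' (e ! 0) (e ! 1))"
      by (intro vL.codef_rv1 cosel_intros) auto
    then obtain \<phi> where \<phi>: "wf_fm L 2 \<phi>" "\<forall>e\<in>tuples 2 (dom_of K). sat K e \<phi> \<longleftrightarrow> rv1 K (e ! 0) (e ! 1)"
      "\<forall>e\<in>tuples 2 (dom_of K). sat K' e \<phi> \<longleftrightarrow> rv1 K' (e ! 0) (e ! 1)"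
      unfolding codef_def dom by blast
    have "[x, y] \<in> tuples 2 (dom_of K)" using that by (simp add: tuples_def)
    thus ?thesis using \<phi>(2,3)[rule_format, of "[x, y]"] agree[OF \<phi>(1), of "[x, y]"] by simp
  qed
  have inv_K': "rel_of K' p xs \<longleftrightarrow> rel_of K' p ys"
    if p: "parity L p = None" "parity L' p = Some n" and xs: "xs \<in> tuples n (dom_of K)" "ys \<in> tuples n (dom_of K)"
      and eq: "\<forall>i<n. rv1 K' (xs ! i) (ys ! i)" for p n xs ys
  proof -
    obtain P where P: "\<forall>xs\<in>tuples n (dom_of K). rel_of K' p xs \<longleftrightarrow> map (rv K (vone K)) xs \<in> P"
      using new[OF p] by blast
    have "map (rv K (vone K)) xs = map (rv K (vone K)) ys"
      using xs eq by (intro nth_equalityI) (auto simp: tuples_length rv1_K K.rv1_rv tuples_nth)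
    thus ?thesis using P xs by simp
  qed
  \<comment> \<open>\<open>M\<close> lives in \<open>'v\<close>, yet as a model of
    \<open>Th L K\<close> it has uniform preparation, derived from h-minimality in
    \<open>'u\<close>.\<close>
  have main: "valued_field M \<and> equichar_0 M \<and> (\<forall>lam A A' X.
           lam \<in> carrier (value_group M) \<and> vle M lam (vone M) \<and>
           A \<subseteq> dom_of M \<and> A' \<subseteq> RV M lam \<and> card_le A' l \<and>
           definable L' M A (RV M (vone M) \<union> A') X \<longrightarrow>
           (\<exists>C. finite C \<and> definable L' M A {} C \<and> prepares M lam C X))"
    if mod: "is_model L' (Th L' K') M" for M :: "('v, 'f, 'p) vstruct"
  proof -
    have M': "is_struct L' M" and th': "\<And>\<phi>. wf_fm L' 0 \<phi> \<Longrightarrow> sat K' [] \<phi> \<Longrightarrow> sat M [] \<phi>"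
      using mod by (auto simp: is_model_def Th_def)
    have M: "is_struct L M" using M' fa by (simp add: is_struct_def)
    have th: "sat M [] \<phi>" if "wf_fm L 0 \<phi>" "sat K [] \<phi>" for \<phi>
      using th'[OF wf_fm_extend[OF that(1) fa pa]] agree[OF that(1), of "[]"] that(2) by simp
    have vM: "valued_field M"
      using vK th[OF wf_vf_axioms[OF L]] unfolding valued_field_iff[OF L K] valued_field_iff[OF L M] by simp
    have eM: "equichar_0 M" by (rule vL.equichar_0_transfer[OF vK vM assms(4) th])
    interpret M: vfield M by unfold_locales fact
    have inv: "rel_of M p xs \<longleftrightarrow> rel_of M p ys"
      if p: "parity L p = None" "parity L' p = Some n" and xs: "xs \<in> tuples n (dom_of M)" "ys \<in> tuples n (dom_of M)"
        and eq: "list_all2 (rv1 M) xs ys" for p n xs ys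
    proof -
      \<comment> \<open>Invariance of \<open>p\<close> is a sentence of the expanded language, true
        in \<open>K'\<close> and therefore in \<open>M\<close>.\<close>
      have "codef L' K' M 0 (\<lambda>e. \<forall>xs\<in>tuples n (dom_of K'). \<forall>ys\<in>tuples n (dom_of K').
          (\<forall>i<n. rv1 K' (xs ! i) (ys ! i)) \<longrightarrow> (rel_of K' p xs \<longleftrightarrow> rel_of K' p ys))
        (\<lambda>e. \<forall>xs\<in>tuples n (dom_of M). \<forall>ys\<in>tuples n (dom_of M).
          (\<forall>i<n. rv1 M (xs ! i) (ys ! i)) \<longrightarrow> (rel_of M p xs \<longleftrightarrow> rel_of M p ys))"
        by (intro codef_alls codef_imp codef_iff codef_all_less vL'.codef_rv1 codef_rel[OF p(2)] cosel_intros) auto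
      then obtain \<phi> where \<phi>: "wf_fm L' 0 \<phi>"
        "sat K' [] \<phi> \<longleftrightarrow> (\<forall>xs\<in>tuples n (dom_of K'). \<forall>ys\<in>tuples n (dom_of K').
          (\<forall>i<n. rv1 K' (xs ! i) (ys ! i)) \<longrightarrow> (rel_of K' p xs \<longleftrightarrow> rel_of K' p ys))"
        "sat M [] \<phi> \<longleftrightarrow> (\<forall>xs\<in>tuples n (dom_of M). \<forall>ys\<in>tuples n (dom_of M).
          (\<forall>i<n. rv1 M (xs ! i) (ys ! i)) \<longrightarrow> (rel_of M p xs \<longleftrightarrow> rel_of M p ys))"
        unfolding codef_def by auto
      have "sat K' [] \<phi>" unfolding \<phi>(2) dom using inv_K'[OF p] by blast
      hence "sat M [] \<phi>" using th' \<phi>(1) by blast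
      thus ?thesis unfolding \<phi>(3) using xs eq by (auto simp: list_all2_conv_all_nth tuples_length)
    qed
    interpret M: rv_expansion M L l L'
    proof unfold_locales
      show "is_struct L M" by fact
      show "farity L' = farity L" "parity L \<subseteq>\<^sub>m parity L'" by fact+
      show "rel_of M p xs = rel_of M p ys"
        if "parity L p = None" "parity L' p = Some n" "xs \<in> tuples n (dom_of M)" "ys \<in> tuples n (dom_of M)"
          "list_all2 (rv1 M) xs ys" for p n xs ys
        by (rule inv[OF that])
      show "\<exists>P \<kappa>. dfn L M (Suc n) P \<and> prepares_instances M n m k \<phi> P \<kappa>"
        if "enat m \<le> l" "wf_fm L (Suc n + Suc m + k) \<phi>" for m n k \<phi>
        by (rule uniform_preparation[OF hmin assms(6) M vM _ that]) (use th in \<open>auto simp: Th_def\<close>)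
    qed
    show ?thesis
    proof (intro conjI vM eM allI impI)
      fix lam A A' X
      assume *: "lam \<in> carrier (value_group M) \<and> vle M lam (vone M) \<and>
           A \<subseteq> dom_of M \<and> A' \<subseteq> RV M lam \<and> card_le A' l \<and> definable L' M A (RV M (vone M) \<union> A') X"
      then obtain l0 where "l0 \<in> M.levels" "lam = vabs M l0" using M.value_group_le_one_iff by blast
      thus "\<exists>C. finite C \<and> definable L' M A {} C \<and> prepares M lam C X"
        using M.transport[of l0 A A' X] * by blast
    qed
  qed
  thus ?thesis using L' unfolding h_minimal_def by blast
qed

end
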